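(* Let $n\ge2$, let $\bar D_n$ be the double dihedral group of order $4n$, let $p\in\{0,\dots,2n-1\}$, let $k$ be a field (of characteristic different from $2$) containing a primitive $2n^2$-th root of unity and a primitive fourth root of unity, and let $\omega_p$ be the $3$-cocycle on $\bar D_n$ defined in the context. For the quasi-Hopf algebra $(k^{\bar D_n},\Phi_{\omega_p})$, there are non-trivial $2$-dimensional braided Hopf algebras in ${}_{(k^{\bar D_n},\Phi_{\omega_p})}^{(k^{\bar D_n},\Phi_{\omega_p})}\mathcal{YD}$ if and only if either $p$ is odd or $p$ and $n$ have different parities.
   Context: $\bar D_n$ is generated by $R,X$ with relations $R^{2n}=e$, $X^2=R^n$, $XR=R^{-1}X$; its elements are uniquely $X^AR^a$ with $A\in\{0,1\}$, $a\in\{-n+1,\dots,n\}$. Let $\xi$ be a primitive $2n^2$-th root of unity in $k$, $\xi_n=\xi^{2n}$, $\xi_{2n}=\xi^n$, and $\xi_4\in k$ a primitive fourth root of unity ($\xi_4=\xi^{n^2/2}$, a square root of $\xi^{n^2}=-1$). The normalized $3$-cocycle $\omega_p:\bar D_n^3\to k^*$ is $$\omega_p(X^AR^a,X^BR^b,X^CR^c)=\xi_{2n}^{p(-1)^{B+C+1}aBC}\;\xi_n^{p(-1)^{B+C+1}a\left\lfloor\frac{n-(-1)^Cb-c-nBC}{2n}\right\rfloor}\;\xi_4^{-pABC}$$ for $A,B,C\in\{0,1\}$, $a,b,c\in\{-n+1,\dots,n\}$. For a finite group $G$ and a normalized $3$-cocycle $\omega$, with $\{P_g\}$ the basis of $k^G$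 dual to $G$, $(k^G,\Phi_\omega)$ is the algebra of functions with $\Delta(P_h)=\sum_{xy=h}P_x\otimes P_y$, $\varepsilon(P_h)=\delta_{h,e}$, reassociator $\Phi_\omega=\sum\omega(g_1,g_2,g_3)P_{g_1}\otimes P_{g_2}\otimes P_{g_3}$, antipode $S(P_g)=P_{g^{-1}}$, $\alpha=1$, $\beta=\sum_g\omega(g,g^{-1},g)^{-1}P_g$; it is a quasi-Hopf algebra, i.e. $(\mathrm{id}\otimes\Delta)\Delta(h)=\Phi(\Delta\otimes\mathrm{id})(\Delta(h))\Phi^{-1}$, $\Phi$ satisfies $(1\otimes\Phi)(\mathrm{id}\otimes\Delta\otimes\mathrm{id})(\Phi)(\Phi\otimes1)=(\mathrm{id}\otimes\mathrm{id}\otimes\Delta)(\Phi)(\Delta\otimes\mathrm{id}\otimes\mathrm{id})(\Phi)$, and $S,\alpha,\beta$ satisfy the usual quasi-Hopf antipode axioms. Notation for a quasi-Hopf algebra $H$: $\Delta(h)=h_1\otimes h_2$, $\Phi=X^1\otimes X^2\otimes X^3=Y^1\otimes Y^2\otimes Y^3$, $\Phi^{-1}=x^1\otimes x^2\otimes x^3$ (summation understood; different letters are independent copies). A left Yetter-Drinfeld module over $H$ is a left $H$-module $M$ with a map $M\to H\otimes M$, $m\mapsto m_{[-1]}\otimes m_{[0]}$, such that $\varepsilon(m_{[-1]})m_{[0]}=m$, $X^1m_{[-1]}\otimes(X^2\cdot m_{[0]})_{[-1]}X^3\otimes(X^2\cdot m_{[0]})_{[0]}=X^1((Y^1\cdot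 m)_{[-1]})_1Y^2\otimes X^2((Y^1\cdot m)_{[-1]})_2Y^3\otimes X^3\cdot(Y^1\cdot m)_{[0]}$, and $h_1m_{[-1]}\otimes h_2\cdot m_{[0]}=(h_1\cdot m)_{[-1]}h_2\otimes(h_1\cdot m)_{[0]}$. ${}_H^H\mathcal{YD}$ is braided monoidal with diagonal action, coaction $m\otimes n\mapsto X^1(x^1Y^1\cdot m)_{[-1]}x^2(Y^2\cdot n)_{[-1]}Y^3\otimes X^2\cdot(x^1Y^1\cdot m)_{[0]}\otimes X^3x^3\cdot(Y^2\cdot n)_{[0]}$, associativity constraint $(m\otimes n)\otimes p\mapsto X^1\cdot m\otimes(X^2\cdot n\otimes X^3\cdot p)$, trivial unit object $k$, braiding $m\otimes n\mapsto m_{[-1]}\cdot n\otimes m_{[0]}$. A braided Hopf algebra is a Hopf algebra in this category; a $2$-dimensional one is non-trivial if it is not isomorphic to the group Hopf algebra $k[C_2]$ with trivial action (via $\varepsilon$) and coaction (via $1_H$). *)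

theory Defs
  imports
    Complex_Main
    "HOL-Library.Poly_Mapping"
    "HOL-Library.Monad_Syntax"
    "HOL-Algebra.Group"
begin

section \<open>Vector spaces with a basis\<close>

text \<open>
  The vector space over \<open>'k\<close> with basis \<open>'i\<close> is the type \<open>'i \<Rightarrow>\<^sub>0 'k\<close> of finitely supported
  functions; its basis vectors are the \<open>ket i\<close>. Over a field every vector space is of this form.
  The tensor product of the spaces with bases \<open>'i\<close> and \<open>'j\<close> is the space with basis \<open>'i \<times> 'j\<close>, the
  ground field is the space with basis \<open>unit\<close>, and a linear map is given by its values on the
  basis, i.e. by a function \<open>'i \<Rightarrow> ('j \<Rightarrow>\<^sub>0 'k)\<close>. Its linear extension, applied to a vector, is the
  bind operation of a monad, so that do-notation is Sweedler notation: for instance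
  \<open>do {(h1, h2) \<leftarrow> \<Delta> h; ket (h2, h1)}\<close> is the element $h_2 \otimes h_1$.
\<close>

definition scal :: "'k::field \<Rightarrow> ('i \<Rightarrow>\<^sub>0 'k) \<Rightarrow> ('i \<Rightarrow>\<^sub>0 'k)"
  where "scal c v = Poly_Mapping.map ((*) c) v"

definition lbind :: "('i \<Rightarrow>\<^sub>0 'k::field) \<Rightarrow> ('i \<Rightarrow> ('j \<Rightarrow>\<^sub>0 'k)) \<Rightarrow> ('j \<Rightarrow>\<^sub>0 'k)"
  where "lbind v f = (\<Sum>i\<in>Poly_Mapping.keys v. scal (Poly_Mapping.lookup v i) (f i))"

adhoc_overloading bind \<rightleftharpoons> lbind

definition ket :: "'i \<Rightarrow> ('i \<Rightarrow>\<^sub>0 'k::field)"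
  where "ket i = Poly_Mapping.single i 1"

definition lcomp :: "('j \<Rightarrow> ('l \<Rightarrow>\<^sub>0 'k::field)) \<Rightarrow> ('i \<Rightarrow> ('j \<Rightarrow>\<^sub>0 'k)) \<Rightarrow> 'i \<Rightarrow> ('l \<Rightarrow>\<^sub>0 'k)"
    (infixl \<open>\<circ>\<^sub>l\<close> 55)
  where "(g \<circ>\<^sub>l f) i = do {j \<leftarrow> f i; g j}"

definition ltensor ::
    "('i \<Rightarrow> ('j \<Rightarrow>\<^sub>0 'k::field)) \<Rightarrow> ('l \<Rightarrow> ('m \<Rightarrow>\<^sub>0 'k)) \<Rightarrow> 'i \<times> 'l \<Rightarrow> ('j \<times> 'm \<Rightarrow>\<^sub>0 'k)"
    (infixr \<open>\<boxtimes>\<close> 70)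
  where "f \<boxtimes> g = (\<lambda>(i, l). do {j \<leftarrow> f i; m \<leftarrow> g l; ket (j, m)})"


lemma lookup_scal [simp]: "Poly_Mapping.lookup (scal c v) i = c * Poly_Mapping.lookup v i"
  by (simp add: scal_def Poly_Mapping.map.rep_eq when_def)

lemma lookup_ket: "Poly_Mapping.lookup (ket i :: 'i \<Rightarrow>\<^sub>0 'k::field) j = (if i = j then 1 else 0)"
  by (simp add: ket_def lookup_single when_def)

lemma lookup_lbind:
  assumes "finite S" "Poly_Mapping.keys v \<subseteq> S"
  shows "Poly_Mapping.lookup (lbind v f) j =
    (\<Sum>i\<in>S. Poly_Mapping.lookup v i * Poly_Mapping.lookup (f i) j)"
  unfolding lbind_def lookup_sum lookup_scal
  using assms by (intro sum.mono_neutral_left) (auto simp: in_keys_iff)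

lemma lbind_ket [simp]: "lbind (ket i) f = f i"
  by (rule poly_mapping_eqI, subst lookup_lbind[of "{i}"]) (auto simp: ket_def lookup_single)

lemma lbind_zero [simp]: "lbind 0 f = 0"
  by (simp add: lbind_def)

lemma lbind_add: "lbind (u + v) f = lbind u f + lbind v f"
  by (rule poly_mapping_eqI)
     (simp add: lookup_add lookup_lbind[of "Poly_Mapping.keys u \<union> Poly_Mapping.keys v"]
       keys_add algebra_simps sum.distrib)

lemma lbind_scal [simp]: "lbind (scal c v) f = scal c (lbind v f)"
proof (rule poly_mapping_eqI)
  fix k
  have "Poly_Mapping.keys (scal c v) \<subseteq> Poly_Mapping.keys v" by (auto simp: in_keys_iff)
  then show "Poly_Mapping.lookup (lbind (scal c v) f) k = Poly_Mapping.lookup (scal c (lbind v f)) k"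
    by (simp add: lookup_lbind[of "Poly_Mapping.keys v"] sum_distrib_left mult.assoc)
qed

lemma lbind_sum [simp]: "lbind (\<Sum>x\<in>S. g x) f = (\<Sum>x\<in>S. lbind (g x) f)"
  by (induction S rule: infinite_finite_induct) (auto simp: lbind_add)

lemma lbind_sum_right [simp]: "lbind v (\<lambda>i. \<Sum>x\<in>S. g i x) = (\<Sum>x\<in>S. lbind v (\<lambda>i. g i x))"
  by (rule poly_mapping_eqI)
     (simp add: lookup_lbind[of "Poly_Mapping.keys v"] lookup_sum sum_distrib_left sum.swap[of _ S])


section \<open>Quasi-Hopf algebras\<close>

text \<open>
  The underlying vector space of \<open>H\<close> is spanned by the basis vectors in the set \<open>qbasis H\<close>; the
  values of the structure maps on other basis vectors are irrelevant. The field \<open>qPhi_inv\<close> is the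
  inverse reassociator.
\<close>

record (overloaded) ('h, 'k) quasi_hopf =
  qbasis :: "'h set"
  qmul :: "'h \<Rightarrow> 'h \<Rightarrow> ('h \<Rightarrow>\<^sub>0 'k)"
  qone :: "'h \<Rightarrow>\<^sub>0 'k"
  qDelta :: "'h \<Rightarrow> ('h \<times> 'h \<Rightarrow>\<^sub>0 'k)"
  qeps :: "'h \<Rightarrow> 'k"
  qPhi :: "'h \<times> 'h \<times> 'h \<Rightarrow>\<^sub>0 'k"
  qPhi_inv :: "'h \<times> 'h \<times> 'h \<Rightarrow>\<^sub>0 'k"
  qS :: "'h \<Rightarrow> ('h \<Rightarrow>\<^sub>0 'k)"
  qalpha :: "'h \<Rightarrow>\<^sub>0 'k"
  qbeta :: "'h \<Rightarrow>\<^sub>0 'k"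

definition vmul :: "('h \<Rightarrow> 'h \<Rightarrow> ('h \<Rightarrow>\<^sub>0 'k)) \<Rightarrow> ('h \<Rightarrow>\<^sub>0 'k::field) \<Rightarrow> ('h \<Rightarrow>\<^sub>0 'k) \<Rightarrow> ('h \<Rightarrow>\<^sub>0 'k)"
  where "vmul m u v = do {a \<leftarrow> u; b \<leftarrow> v; m a b}"

definition mul_tensor ::
    "('h \<Rightarrow> 'h \<Rightarrow> ('h \<Rightarrow>\<^sub>0 'k::field)) \<Rightarrow> ('j \<Rightarrow> 'j \<Rightarrow> ('j \<Rightarrow>\<^sub>0 'k)) \<Rightarrow>
     'h \<times> 'j \<Rightarrow> 'h \<times> 'j \<Rightarrow> ('h \<times> 'j \<Rightarrow>\<^sub>0 'k)"
  where "mul_tensor m m' = (\<lambda>(a, b) (a', b'). do {c \<leftarrow> m a a'; d \<leftarrow> m' b b'; ket (c, d)})"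

definition quasi_hopf_algebra :: "('h, 'k::field) quasi_hopf \<Rightarrow> bool"
  where "quasi_hopf_algebra H \<longleftrightarrow>
    (let I = qbasis H; m = qmul H; m2 = mul_tensor m m; m3 = mul_tensor m m2; m4 = mul_tensor m m3;
         one2 = do {a \<leftarrow> qone H; b \<leftarrow> qone H; ket (a, b)};
         one3 = do {a \<leftarrow> qone H; b \<leftarrow> one2; ket (a, b)} in
      \<comment> \<open>closure of the span of \<open>I\<close> under the structure\<close>
      (\<forall>a\<in>I. \<forall>b\<in>I. Poly_Mapping.keys (m a b) \<subseteq> I) \<and> Poly_Mapping.keys (qone H) \<subseteq> I \<and>
      (\<forall>a\<in>I. Poly_Mapping.keys (qDelta H a) \<subseteq> I \<times> I) \<and>
      Poly_Mapping.keys (qPhi H) \<subseteq> I \<times> I \<times> I \<and> Poly_Mapping.keys (qPhi_inv H) \<subseteq> I \<times> I \<times> I \<and>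
      (\<forall>a\<in>I. Poly_Mapping.keys (qS H a) \<subseteq> I) \<and>
      Poly_Mapping.keys (qalpha H) \<subseteq> I \<and> Poly_Mapping.keys (qbeta H) \<subseteq> I \<and>
      \<comment> \<open>associative unital algebra\<close>
      (\<forall>a\<in>I. \<forall>b\<in>I. \<forall>c\<in>I. do {x \<leftarrow> m a b; m x c} = do {y \<leftarrow> m b c; m a y}) \<and>
      (\<forall>a\<in>I. vmul m (qone H) (ket a) = ket a \<and> vmul m (ket a) (qone H) = ket a) \<and>
      \<comment> \<open>\<open>\<Delta>\<close> and \<open>\<epsilon>\<close> are algebra maps\<close>
      (\<forall>a\<in>I. \<forall>b\<in>I. do {c \<leftarrow> m a b; qDelta H c} = vmul m2 (qDelta H a) (qDelta H b)) \<and>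
      do {a \<leftarrow> qone H; qDelta H a} = one2 \<and>
      (\<forall>a\<in>I. \<forall>b\<in>I. do {c \<leftarrow> m a b; scal (qeps H c) (ket ())} = scal (qeps H a * qeps H b) (ket ())) \<and>
      do {a \<leftarrow> qone H; scal (qeps H a) (ket ())} = ket () \<and>
      \<comment> \<open>counit and quasi-coassociativity\<close>
      (\<forall>h\<in>I. do {(h1, h2) \<leftarrow> qDelta H h; scal (qeps H h1) (ket h2)} = ket h) \<and>
      (\<forall>h\<in>I. do {(h1, h2) \<leftarrow> qDelta H h; scal (qeps H h2) (ket h1)} = ket h) \<and>
      vmul m3 (qPhi H) (qPhi_inv H) = one3 \<and> vmul m3 (qPhi_inv H) (qPhi H) = one3 \<and>
      (\<forall>h\<in>I. do {(h1, h2) \<leftarrow> qDelta H h; (h21, h22) \<leftarrow> qDelta H h2; ket (h1, h21, h22)} =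
        vmul m3 (vmul m3 (qPhi H)
          (do {(h1, h2) \<leftarrow> qDelta H h; (h11, h12) \<leftarrow> qDelta H h1; ket (h11, h12, h2)})) (qPhi_inv H)) \<and>
      \<comment> \<open>pentagon and normalization\<close>
      vmul m4 (vmul m4
          (do {u \<leftarrow> qone H; (X1, X2, X3) \<leftarrow> qPhi H; ket (u, X1, X2, X3)})
          (do {(X1, X2, X3) \<leftarrow> qPhi H; (y, y') \<leftarrow> qDelta H X2; ket (X1, y, y', X3)}))
          (do {(X1, X2, X3) \<leftarrow> qPhi H; u \<leftarrow> qone H; ket (X1, X2, X3, u)}) =
        vmul m4
          (do {(X1, X2, X3) \<leftarrow> qPhi H; (y, y') \<leftarrow> qDelta H X3; ket (X1, X2, y, y')})
          (do {(X1, X2, X3) \<leftarrow> qPhi H; (y, y') \<leftarrow> qDelta H X1; ket (y, y', X2, X3)}) \<and>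
      do {(X1, X2, X3) \<leftarrow> qPhi H; scal (qeps H X2) (ket (X1, X3))} = one2 \<and>
      \<comment> \<open>antipode\<close>
      (\<forall>a\<in>I. \<forall>b\<in>I. do {c \<leftarrow> m a b; qS H c} = vmul m (qS H b) (qS H a)) \<and>
      do {a \<leftarrow> qone H; qS H a} = qone H \<and>
      (\<forall>h\<in>I. do {(h1, h2) \<leftarrow> qDelta H h; vmul m (vmul m (qS H h1) (qalpha H)) (ket h2)} =
        scal (qeps H h) (qalpha H)) \<and>
      (\<forall>h\<in>I. do {(h1, h2) \<leftarrow> qDelta H h; vmul m (vmul m (ket h1) (qbeta H)) (qS H h2)} =
        scal (qeps H h) (qbeta H)) \<and>
      do {(X1, X2, X3) \<leftarrow> qPhi H;
        vmul m (vmul m (vmul m (vmul m (ket X1) (qbeta H)) (qS H X2)) (qalpha H)) (ket X3)} = qone H \<and>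
      do {(x1, x2, x3) \<leftarrow> qPhi_inv H;
        vmul m (vmul m (vmul m (vmul m (qS H x1) (qalpha H)) (ket x2)) (qbeta H)) (qS H x3)} = qone H)"


section \<open>The braided monoidal category of left Yetter-Drinfeld modules\<close>

record (overloaded) ('h, 'i, 'k) yd =
  act :: "'h \<Rightarrow> 'i \<Rightarrow> ('i \<Rightarrow>\<^sub>0 'k)"
  coact :: "'i \<Rightarrow> ('h \<times> 'i \<Rightarrow>\<^sub>0 'k)"

definition yd_module :: "('h, 'k::field) quasi_hopf \<Rightarrow> ('h, 'i, 'k, 'z) yd_scheme \<Rightarrow> bool"
  where "yd_module H M \<longleftrightarrow>
    (\<forall>m. do {h \<leftarrow> qone H; act M h m} = ket m) \<and>
    (\<forall>g\<in>qbasis H. \<forall>h\<in>qbasis H. \<forall>m.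
      do {m' \<leftarrow> act M h m; act M g m'} = do {x \<leftarrow> qmul H g h; act M x m}) \<and>
    (\<forall>m. Poly_Mapping.keys (coact M m) \<subseteq> qbasis H \<times> UNIV) \<and>
    (\<forall>m. do {(h, m0) \<leftarrow> coact M m; scal (qeps H h) (ket m0)} = ket m) \<and>
    (\<forall>m.
      do {(X1, X2, X3) \<leftarrow> qPhi H;
          (h, m0) \<leftarrow> coact M m;
          m1 \<leftarrow> act M X2 m0;
          (l, m2) \<leftarrow> coact M m1;
          a \<leftarrow> qmul H X1 h;
          b \<leftarrow> qmul H l X3;
          ket (a, b, m2)} =
      do {(X1, X2, X3) \<leftarrow> qPhi H;
          (Y1, Y2, Y3) \<leftarrow> qPhi H;
          m1 \<leftarrow> act M Y1 m;
          (h, m0) \<leftarrow> coact M m1;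
          (h1, h2) \<leftarrow> qDelta H h;
          a \<leftarrow> vmul (qmul H) (qmul H X1 h1) (ket Y2);
          b \<leftarrow> vmul (qmul H) (qmul H X2 h2) (ket Y3);
          m2 \<leftarrow> act M X3 m0;
          ket (a, b, m2)}) \<and>
    (\<forall>h\<in>qbasis H. \<forall>m.
      do {(h1, h2) \<leftarrow> qDelta H h;
          (l, m0) \<leftarrow> coact M m;
          a \<leftarrow> qmul H h1 l;
          m1 \<leftarrow> act M h2 m0;
          ket (a, m1)} =
      do {(h1, h2) \<leftarrow> qDelta H h;
          m1 \<leftarrow> act M h1 m;
          (l, m0) \<leftarrow> coact M m1;
          a \<leftarrow> qmul H l h2;
          ket (a, m0)})"

definition yd_hom ::
    "('h, 'k::field) quasi_hopf \<Rightarrow> ('h, 'i, 'k, 'y) yd_scheme \<Rightarrow> ('h, 'j, 'k, 'z) yd_scheme \<Rightarrow>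
     ('i \<Rightarrow> ('j \<Rightarrow>\<^sub>0 'k)) \<Rightarrow> bool"
  where "yd_hom H M N f \<longleftrightarrow>
    (\<forall>h\<in>qbasis H. \<forall>m. do {m1 \<leftarrow> act M h m; f m1} = do {n \<leftarrow> f m; act N h n}) \<and>
    (\<forall>m. do {n \<leftarrow> f m; coact N n} = do {(h, m0) \<leftarrow> coact M m; n0 \<leftarrow> f m0; ket (h, n0)})"

definition yd_unit :: "('h, 'k::field) quasi_hopf \<Rightarrow> ('h, unit, 'k) yd"
  where "yd_unit H = \<lparr>
    act = (\<lambda>h _. scal (qeps H h) (ket ())),
    coact = (\<lambda>_. do {h \<leftarrow> qone H; ket (h, ())})\<rparr>"

definition yd_tensor ::
    "('h, 'k::field) quasi_hopf \<Rightarrow> ('h, 'i, 'k, 'y) yd_scheme \<Rightarrow> ('h, 'j, 'k, 'z) yd_scheme \<Rightarrow>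
     ('h, 'i \<times> 'j, 'k) yd"
  where "yd_tensor H M N = \<lparr>
    act = (\<lambda>h (m, n).
      do {(h1, h2) \<leftarrow> qDelta H h;
          m1 \<leftarrow> act M h1 m;
          n1 \<leftarrow> act N h2 n;
          ket (m1, n1)}),
    coact = (\<lambda>(m, n).
      do {(X1, X2, X3) \<leftarrow> qPhi H;
          (x1, x2, x3) \<leftarrow> qPhi_inv H;
          (Y1, Y2, Y3) \<leftarrow> qPhi H;
          x1Y1 \<leftarrow> qmul H x1 Y1;
          m1 \<leftarrow> act M x1Y1 m;
          (h, m0) \<leftarrow> coact M m1;
          n1 \<leftarrow> act N Y2 n;
          (l, n0) \<leftarrow> coact N n1;
          a \<leftarrow> vmul (qmul H) (vmul (qmul H) (vmul (qmul H) (qmul H X1 h) (ket x2)) (ket l)) (ket Y3);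
          m2 \<leftarrow> act M X2 m0;
          X3x3 \<leftarrow> qmul H X3 x3;
          n2 \<leftarrow> act N X3x3 n0;
          ket (a, (m2, n2))})\<rparr>"

definition yd_assoc ::
    "('h, 'k::field) quasi_hopf \<Rightarrow> ('h, 'i, 'k, 'x) yd_scheme \<Rightarrow> ('h, 'j, 'k, 'y) yd_scheme \<Rightarrow>
     ('h, 'l, 'k, 'z) yd_scheme \<Rightarrow> ('i \<times> 'j) \<times> 'l \<Rightarrow> ('i \<times> ('j \<times> 'l) \<Rightarrow>\<^sub>0 'k)"
  where "yd_assoc H M N P = (\<lambda>((m, n), p).
    do {(X1, X2, X3) \<leftarrow> qPhi H;
        m' \<leftarrow> act M X1 m;
        n' \<leftarrow> act N X2 n;
        p' \<leftarrow> act P X3 p;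
        ket (m', (n', p'))})"

definition yd_assoc_inv ::
    "('h, 'k::field) quasi_hopf \<Rightarrow> ('h, 'i, 'k, 'x) yd_scheme \<Rightarrow> ('h, 'j, 'k, 'y) yd_scheme \<Rightarrow>
     ('h, 'l, 'k, 'z) yd_scheme \<Rightarrow> 'i \<times> ('j \<times> 'l) \<Rightarrow> (('i \<times> 'j) \<times> 'l \<Rightarrow>\<^sub>0 'k)"
  where "yd_assoc_inv H M N P = (\<lambda>(m, (n, p)).
    do {(x1, x2, x3) \<leftarrow> qPhi_inv H;
        m' \<leftarrow> act M x1 m;
        n' \<leftarrow> act N x2 n;
        p' \<leftarrow> act P x3 p;
        ket ((m', n'), p')})"

definition yd_braid ::
    "('h, 'i, 'k::field, 'y) yd_scheme \<Rightarrow> ('h, 'j, 'k, 'z) yd_scheme \<Rightarrow>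
     'i \<times> 'j \<Rightarrow> ('j \<times> 'i \<Rightarrow>\<^sub>0 'k)"
  where "yd_braid M N = (\<lambda>(m, n).
    do {(h, m0) \<leftarrow> coact M m;
        n' \<leftarrow> act N h n;
        ket (n', m0)})"


section \<open>Braided Hopf algebras\<close>

record (overloaded) ('h, 'i, 'k) braided_hopf = "('h, 'i, 'k) yd" +
  bmul :: "'i \<times> 'i \<Rightarrow> ('i \<Rightarrow>\<^sub>0 'k)"
  bone :: "unit \<Rightarrow> ('i \<Rightarrow>\<^sub>0 'k)"
  bDelta :: "'i \<Rightarrow> ('i \<times> 'i \<Rightarrow>\<^sub>0 'k)"
  beps :: "'i \<Rightarrow> (unit \<Rightarrow>\<^sub>0 'k)"
  bS :: "'i \<Rightarrow> ('i \<Rightarrow>\<^sub>0 'k)"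

text \<open>
  The middle-four interchange $(B \otimes B) \otimes (B \otimes B) \to (B \otimes B) \otimes (B \otimes B)$,
  that is $\mathrm{id} \otimes c_{B,B} \otimes \mathrm{id}$ with the associativity constraints inserted;
  it enters the multiplication of the algebra $B \otimes B$.
\<close>

definition yd_interchange ::
    "('h, 'k::field) quasi_hopf \<Rightarrow> ('h, 'i, 'k, 'z) yd_scheme \<Rightarrow>
     ('i \<times> 'i) \<times> ('i \<times> 'i) \<Rightarrow> (('i \<times> 'i) \<times> ('i \<times> 'i) \<Rightarrow>\<^sub>0 'k)"
  where "yd_interchange H B =
    yd_assoc_inv H B B (yd_tensor H B B) \<circ>\<^sub>l (ket \<boxtimes> yd_assoc H B B B) \<circ>\<^sub>l
    (ket \<boxtimes> (yd_braid B B \<boxtimes> ket)) \<circ>\<^sub>l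
    (ket \<boxtimes> yd_assoc_inv H B B B) \<circ>\<^sub>l yd_assoc H B B (yd_tensor H B B)"

definition braided_hopf_algebra ::
    "('h, 'k::field) quasi_hopf \<Rightarrow> ('h, 'i, 'k) braided_hopf \<Rightarrow> bool"
  where "braided_hopf_algebra H B \<longleftrightarrow>
    yd_module H B \<and>
    yd_hom H (yd_tensor H B B) B (bmul B) \<and> yd_hom H (yd_unit H) B (bone B) \<and>
    yd_hom H B (yd_tensor H B B) (bDelta B) \<and> yd_hom H B (yd_unit H) (beps B) \<and>
    yd_hom H B B (bS B) \<and>
    \<comment> \<open>algebra\<close>
    bmul B \<circ>\<^sub>l (bmul B \<boxtimes> ket) = bmul B \<circ>\<^sub>l (ket \<boxtimes> bmul B) \<circ>\<^sub>l yd_assoc H B B B \<and>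
    bmul B \<circ>\<^sub>l (bone B \<boxtimes> ket) = (\<lambda>((), i). ket i) \<and>
    bmul B \<circ>\<^sub>l (ket \<boxtimes> bone B) = (\<lambda>(i, ()). ket i) \<and>
    \<comment> \<open>coalgebra\<close>
    yd_assoc H B B B \<circ>\<^sub>l (bDelta B \<boxtimes> ket) \<circ>\<^sub>l bDelta B = (ket \<boxtimes> bDelta B) \<circ>\<^sub>l bDelta B \<and>
    (beps B \<boxtimes> ket) \<circ>\<^sub>l bDelta B = (\<lambda>i. ket ((), i)) \<and>
    (ket \<boxtimes> beps B) \<circ>\<^sub>l bDelta B = (\<lambda>i. ket (i, ())) \<and>
    \<comment> \<open>\<open>\<Delta>\<close> and \<open>\<epsilon>\<close> are algebra maps\<close>
    bDelta B \<circ>\<^sub>l bmul B = (bmul B \<boxtimes> bmul B) \<circ>\<^sub>l yd_interchange H B \<circ>\<^sub>l (bDelta B \<boxtimes> bDelta B) \<and>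
    bDelta B \<circ>\<^sub>l bone B = (bone B \<boxtimes> bone B) \<circ>\<^sub>l (\<lambda>(). ket ((), ())) \<and>
    beps B \<circ>\<^sub>l bmul B = (\<lambda>((), ()). ket ()) \<circ>\<^sub>l (beps B \<boxtimes> beps B) \<and>
    beps B \<circ>\<^sub>l bone B = ket \<and>
    \<comment> \<open>antipode\<close>
    bmul B \<circ>\<^sub>l (bS B \<boxtimes> ket) \<circ>\<^sub>l bDelta B = bone B \<circ>\<^sub>l beps B \<and>
    bmul B \<circ>\<^sub>l (ket \<boxtimes> bS B) \<circ>\<^sub>l bDelta B = bone B \<circ>\<^sub>l beps B"

definition braided_hopf_iso ::
    "('h, 'k::field) quasi_hopf \<Rightarrow> ('h, 'i, 'k) braided_hopf \<Rightarrow> ('h, 'j, 'k) braided_hopf \<Rightarrow>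
     ('i \<Rightarrow> ('j \<Rightarrow>\<^sub>0 'k)) \<Rightarrow> bool"
  where "braided_hopf_iso H B C f \<longleftrightarrow>
    yd_hom H B C f \<and> (\<exists>g. g \<circ>\<^sub>l f = ket \<and> f \<circ>\<^sub>l g = ket) \<and>
    f \<circ>\<^sub>l bmul B = bmul C \<circ>\<^sub>l (f \<boxtimes> f) \<and> f \<circ>\<^sub>l bone B = bone C \<and>
    bDelta C \<circ>\<^sub>l f = (f \<boxtimes> f) \<circ>\<^sub>l bDelta B \<and> beps C \<circ>\<^sub>l f = beps B \<and>
    f \<circ>\<^sub>l bS B = bS C \<circ>\<^sub>l f"

text \<open>
  The group $C_2$ is \<open>bool\<close> with exclusive or, i.e. with operation \<open>(\<noteq>)\<close> and neutral element
  \<open>False\<close>; \<open>ket g\<close> is the group-like element \<open>g\<close>.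
\<close>

definition group_hopf_C2 :: "('h, 'k::field) quasi_hopf \<Rightarrow> ('h, bool, 'k) braided_hopf"
  where "group_hopf_C2 H = \<lparr>
    act = (\<lambda>h g. scal (qeps H h) (ket g)),
    coact = (\<lambda>g. do {h \<leftarrow> qone H; ket (h, g)}),
    bmul = (\<lambda>(g, g'). ket (g \<noteq> g')),
    bone = (\<lambda>_. ket False),
    bDelta = (\<lambda>g. ket (g, g)),
    beps = (\<lambda>_. ket ()),
    bS = ket\<rparr>"

text \<open>
  A two-dimensional space is one with a two-element basis, for which \<open>bool\<close> serves.
\<close>

definition nontrivial_two_dim_braided_hopf ::
    "('h, 'k::field) quasi_hopf \<Rightarrow> ('h, bool, 'k) braided_hopf \<Rightarrow> bool"
  where "nontrivial_two_dim_braided_hopf H B \<longleftrightarrow>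
    braided_hopf_algebra H B \<and> \<not> (\<exists>f. braided_hopf_iso H B (group_hopf_C2 H) f)"


section \<open>The quasi-Hopf algebra of functions on a finite group\<close>

text \<open>The basis vector \<open>ket g\<close> is the element $P_g$ of the basis dual to \<open>G\<close>.\<close>

definition function_quasi_hopf ::
    "('g, 'z) monoid_scheme \<Rightarrow> ('g \<Rightarrow> 'g \<Rightarrow> 'g \<Rightarrow> 'k::field) \<Rightarrow> ('g, 'k) quasi_hopf"
  where "function_quasi_hopf G w = \<lparr>
    qbasis = carrier G,
    qmul = (\<lambda>g h. if g = h then ket g else 0),
    qone = (\<Sum>g\<in>carrier G. ket g),
    qDelta = (\<lambda>h. \<Sum>(x, y) | x \<in> carrier G \<and> y \<in> carrier G \<and> x \<otimes>\<^bsub>G\<^esub> y = h. ket (x, y)),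
    qeps = (\<lambda>h. if h = \<one>\<^bsub>G\<^esub> then 1 else 0),
    qPhi = (\<Sum>(a, b, c)\<in>carrier G \<times> carrier G \<times> carrier G. scal (w a b c) (ket (a, b, c))),
    qPhi_inv = (\<Sum>(a, b, c)\<in>carrier G \<times> carrier G \<times> carrier G. scal (inverse (w a b c)) (ket (a, b, c))),
    qS = (\<lambda>g. ket (inv\<^bsub>G\<^esub> g)),
    qalpha = (\<Sum>g\<in>carrier G. ket g),
    qbeta = (\<Sum>g\<in>carrier G. scal (inverse (w g (inv\<^bsub>G\<^esub> g) g)) (ket g))\<rparr>"

definition normalized_3_cocycle ::
    "('g, 'z) monoid_scheme \<Rightarrow> ('g \<Rightarrow> 'g \<Rightarrow> 'g \<Rightarrow> 'k::field) \<Rightarrow> bool"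
  where "normalized_3_cocycle G w \<longleftrightarrow>
    (\<forall>a\<in>carrier G. \<forall>b\<in>carrier G. \<forall>c\<in>carrier G. w a b c \<noteq> 0) \<and>
    (\<forall>a\<in>carrier G. \<forall>b\<in>carrier G. \<forall>c\<in>carrier G. \<forall>d\<in>carrier G.
      w b c d * w a (b \<otimes>\<^bsub>G\<^esub> c) d * w a b c = w a b (c \<otimes>\<^bsub>G\<^esub> d) * w (a \<otimes>\<^bsub>G\<^esub> b) c d) \<and>
    (\<forall>a\<in>carrier G. \<forall>b\<in>carrier G. w \<one>\<^bsub>G\<^esub> a b = 1 \<and> w a \<one>\<^bsub>G\<^esub> b = 1 \<and> w a b \<one>\<^bsub>G\<^esub> = 1)"


definition pm :: "'i \<Rightarrow> 'i \<Rightarrow> ('i \<Rightarrow>\<^sub>0 'k::field)" where "pm a b = (if a = b then ket a else 0)"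

lemma lookup_vmul [simp]: "Poly_Mapping.lookup (vmul pm u v) x = Poly_Mapping.lookup u x * Poly_Mapping.lookup v x"
proof -
  have "Poly_Mapping.lookup (vmul pm u v) x = (\<Sum>i\<in>insert x (Poly_Mapping.keys u). Poly_Mapping.lookup u i *
     (\<Sum>j\<in>insert x (Poly_Mapping.keys v). Poly_Mapping.lookup v j * (if i = j \<and> i = x then 1 else 0)))"
    unfolding vmul_def
    apply (subst lookup_lbind[of "insert x (Poly_Mapping.keys u)"]) apply (auto)
    apply (rule sum.cong[OF refl])
    apply (subst lookup_lbind[of "insert x (Poly_Mapping.keys v)"]) apply (auto simp: pm_def lookup_ket intro!: sum.cong)
    done
  also have "\<dots> = (\<Sum>i\<in>insert x (Poly_Mapping.keys u). if i = x then Poly_Mapping.lookup u x * Poly_Mapping.lookup v x else 0)"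
    by (intro sum.cong refl) (auto simp: if_distrib cong: if_cong)
  also have "\<dots> = Poly_Mapping.lookup u x * Poly_Mapping.lookup v x" 
    by (subst sum.delta) auto
  finally show ?thesis .
qed

lemma mul_tensor_pm [simp]: "mul_tensor pm pm = pm"
  by (auto simp: mul_tensor_def pm_def fun_eq_iff)

lemma function_qmul: "qmul (function_quasi_hopf G w) = pm"
  by (simp add: function_quasi_hopf_def pm_def fun_eq_iff)

lemma function_qDelta:
  assumes "group G" "finite (carrier G)" "h \<in> carrier G"
  shows "qDelta (function_quasi_hopf G w) h = (\<Sum>x\<in>carrier G. ket (x, inv\<^bsub>G\<^esub> x \<otimes>\<^bsub>G\<^esub> h))"
    and "qDelta (function_quasi_hopf G w) h = (\<Sum>y\<in>carrier G. ket (h \<otimes>\<^bsub>G\<^esub> inv\<^bsub>G\<^esub> y, y))"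
proof -
  interpret group G by fact
  show "qDelta (function_quasi_hopf G w) h = (\<Sum>x\<in>carrier G. ket (x, inv\<^bsub>G\<^esub> x \<otimes>\<^bsub>G\<^esub> h))"
    unfolding function_quasi_hopf_def quasi_hopf.simps
    by (rule sum.reindex_bij_witness[of _ "\<lambda>x. (x, inv\<^bsub>G\<^esub> x \<otimes>\<^bsub>G\<^esub> h)" fst])
       (use assms in \<open>auto simp: m_assoc[symmetric] inv_solve_left inv_solve_left'\<close>)
  show "qDelta (function_quasi_hopf G w) h = (\<Sum>y\<in>carrier G. ket (h \<otimes>\<^bsub>G\<^esub> inv\<^bsub>G\<^esub> y, y))"
    unfolding function_quasi_hopf_def quasi_hopf.simps
    by (rule sum.reindex_bij_witness[of _ "\<lambda>y. (h \<otimes>\<^bsub>G\<^esub> inv\<^bsub>G\<^esub> y, y)" snd])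
       (use assms in \<open>auto simp: m_assoc inv_solve_right inv_solve_right'\<close>)
qed

lemma cocycle_inv:
  assumes "group G" "normalized_3_cocycle G w" "g \<in> carrier G"
  shows "w g (inv\<^bsub>G\<^esub> g) g * w (inv\<^bsub>G\<^esub> g) g (inv\<^bsub>G\<^esub> g) = 1"
proof -
  interpret group G by fact
  have "w (inv\<^bsub>G\<^esub> g) g (inv\<^bsub>G\<^esub> g) * w g (inv\<^bsub>G\<^esub> g \<otimes>\<^bsub>G\<^esub> g) (inv\<^bsub>G\<^esub> g) * w g (inv\<^bsub>G\<^esub> g) g
    = w g (inv\<^bsub>G\<^esub> g) (g \<otimes>\<^bsub>G\<^esub> inv\<^bsub>G\<^esub> g) * w (g \<otimes>\<^bsub>G\<^esub> inv\<^bsub>G\<^esub> g) g (inv\<^bsub>G\<^esub> g)"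
    using assms(2,3) unfolding normalized_3_cocycle_def by blast
  then show ?thesis
    using assms(2,3) unfolding normalized_3_cocycle_def by (simp add: mult.commute)
qed


lemma lookup_lbind_inj:
  assumes "\<And>i. f i = j \<longleftrightarrow> P \<and> i = i0"
  shows "Poly_Mapping.lookup (lbind v (\<lambda>i. ket (f i))) j = (if P then Poly_Mapping.lookup v i0 else 0)"
proof -
  have "Poly_Mapping.lookup (lbind v (\<lambda>i. ket (f i))) j =
    (\<Sum>i\<in>insert i0 (Poly_Mapping.keys v). if i = i0 then (if P then Poly_Mapping.lookup v i0 else 0) else 0)"
    by (subst lookup_lbind[of "insert i0 (Poly_Mapping.keys v)"], simp, blast, rule sum.cong)
       (auto simp: lookup_ket assms)
  then show ?thesis by simp
qed

lemma vmul_ket_left: "vmul pm (ket a) v = scal (Poly_Mapping.lookup v a) (ket a)"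
  by (rule poly_mapping_eqI) (auto simp: lookup_ket)

lemma vmul_ket_right: "vmul pm v (ket a) = scal (Poly_Mapping.lookup v a) (ket a)"
  by (rule poly_mapping_eqI) (auto simp: lookup_ket)

lemma scal_simps [simp]: "scal 0 v = 0" "scal 1 v = v" "scal c 0 = 0" "scal c (scal d v) = scal (c * d) v"
  by (auto intro!: poly_mapping_eqI simp: mult.assoc)

lemma lookup_sum_ket: "finite S \<Longrightarrow> Poly_Mapping.lookup (\<Sum>x\<in>S. ket x) y = (if y \<in> S then 1 else 0)"
  by (simp add: lookup_sum lookup_ket)

lemma lookup_sum_scal_ket:
  "finite S \<Longrightarrow> Poly_Mapping.lookup (\<Sum>x\<in>S. scal (c x) (ket x)) y = (if y \<in> S then c y else 0)"
  by (simp add: lookup_sum lookup_ket if_distrib cong: if_cong)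

lemma keys_sumI: "(\<And>x. x \<in> S \<Longrightarrow> Poly_Mapping.keys (f x) \<subseteq> T) \<Longrightarrow> Poly_Mapping.keys (sum f S) \<subseteq> T"
  using keys_sum by fastforce

lemma keys_scal_ket: "i \<in> T \<Longrightarrow> Poly_Mapping.keys (scal c (ket i)) \<subseteq> T"
  by (auto simp: in_keys_iff lookup_ket split: if_splits)

lemma keys_ket: "Poly_Mapping.keys (ket i :: 'i \<Rightarrow>\<^sub>0 'k::field) = {i}"
  by (auto simp: in_keys_iff lookup_ket split: if_splits)

lemma lookup_lbind_single:
  assumes "\<And>i. i \<noteq> i0 \<Longrightarrow> i \<in> Poly_Mapping.keys v \<Longrightarrow> Poly_Mapping.lookup (f i) j = 0"
  shows "Poly_Mapping.lookup (lbind v f) j = Poly_Mapping.lookup v i0 * Poly_Mapping.lookup (f i0) j"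
proof -
  have "Poly_Mapping.lookup (lbind v f) j =
    (\<Sum>i\<in>insert i0 (Poly_Mapping.keys v). Poly_Mapping.lookup v i * Poly_Mapping.lookup (f i) j)"
    by (intro lookup_lbind) auto
  also have "\<dots> = (\<Sum>i\<in>{i0}. Poly_Mapping.lookup v i * Poly_Mapping.lookup (f i) j)"
    using assms by (intro sum.mono_neutral_right) auto
  finally show ?thesis by simp
qed

lemma lookup_pair: "Poly_Mapping.lookup (do {a \<leftarrow> u; b \<leftarrow> v; ket (a, b)}) (x, y) =
  Poly_Mapping.lookup u x * Poly_Mapping.lookup v y"
proof -
  have "Poly_Mapping.lookup (lbind v (\<lambda>b. ket (a, b))) (x, y) = (if a = x then Poly_Mapping.lookup v y else 0)" for a
    by (rule lookup_lbind_inj) auto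
  then show ?thesis by (subst lookup_lbind_single[of x]) auto
qed

lemma sum_sum_scal: "finite S \<Longrightarrow> (\<Sum>x\<in>S. scal (if x = a then 1 else 0) (f x)) = (if a \<in> S then f a else 0)"
proof -
  assume "finite S"
  moreover have "(\<Sum>x\<in>S. scal (if x = a then 1 else 0) (f x)) = (\<Sum>x\<in>S. if x = a then f x else 0)"
    by (intro sum.cong) auto
  ultimately show ?thesis by simp
qed

lemma quasi_hopf_algebra_function:
  assumes G: "group G" and fin: "finite (carrier G)" and w: "normalized_3_cocycle G w"
  shows "quasi_hopf_algebra (function_quasi_hopf G w)"
proof -
  interpret group G by fact
  let ?H = "function_quasi_hopf G w" and ?C = "carrier G"
  let ?l = "Poly_Mapping.lookup"
  note D = function_qDelta[OF G fin]
  have basis: "qbasis ?H = ?C" and one: "qone ?H = (\<Sum>g\<in>?C. ket g)"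
    and eps: "qeps ?H = (\<lambda>h. if h = \<one>\<^bsub>G\<^esub> then 1 else 0)"
    and S: "qS ?H = (\<lambda>g. ket (inv\<^bsub>G\<^esub> g))" and al: "qalpha ?H = (\<Sum>g\<in>?C. ket g)"
    and be: "qbeta ?H = (\<Sum>g\<in>?C. scal (inverse (w g (inv\<^bsub>G\<^esub> g) g)) (ket g))"
    and Phi': "qPhi ?H = (\<Sum>t\<in>?C \<times> ?C \<times> ?C. scal (case t of (a, b, c) \<Rightarrow> w a b c) (ket t))"
    and Phi_inv': "qPhi_inv ?H = (\<Sum>t\<in>?C \<times> ?C \<times> ?C. scal (case t of (a, b, c) \<Rightarrow> inverse (w a b c)) (ket t))"
    by (auto simp: function_quasi_hopf_def intro!: sum.cong)
  have Phi: "qPhi ?H = (\<Sum>a\<in>?C. \<Sum>b\<in>?C. \<Sum>c\<in>?C. scal (w a b c) (ket (a, b, c)))"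
    and Phi_inv: "qPhi_inv ?H = (\<Sum>a\<in>?C. \<Sum>b\<in>?C. \<Sum>c\<in>?C. scal (inverse (w a b c)) (ket (a, b, c)))"
    by (auto simp: function_quasi_hopf_def sum.cartesian_product)
  have lPhi: "?l (qPhi ?H) (a, b, c) = (if a \<in> ?C \<and> b \<in> ?C \<and> c \<in> ?C then w a b c else 0)"
    and lPhi_inv: "?l (qPhi_inv ?H) (a, b, c) = (if a \<in> ?C \<and> b \<in> ?C \<and> c \<in> ?C then inverse (w a b c) else 0)" for a b c
    unfolding Phi' Phi_inv' using fin by (auto simp: lookup_sum_scal_ket)
  have lD: "?l (qDelta ?H h) (x, y) = (if x \<in> ?C \<and> y \<in> ?C \<and> x \<otimes>\<^bsub>G\<^esub> y = h then 1 else 0)" for h x y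
  proof -
    have "?l (qDelta ?H h) (x, y) = ?l (\<Sum>t | t \<in> ?C \<times> ?C \<and> fst t \<otimes>\<^bsub>G\<^esub> snd t = h. ket t) (x, y)"
      by (auto simp: function_quasi_hopf_def intro!: arg_cong[where f = "\<lambda>u. ?l u (x, y)"] sum.cong)
    also have "\<dots> = (if x \<in> ?C \<and> y \<in> ?C \<and> x \<otimes>\<^bsub>G\<^esub> y = h then 1 else 0)"
      using fin by (subst lookup_sum_ket) auto
    finally show ?thesis .
  qed
  have lone: "?l (qone ?H) x = (if x \<in> ?C then 1 else 0)" for x
    using fin by (simp add: one lookup_sum_ket)
  have nz: "w a b c \<noteq> 0" if "a \<in> ?C" "b \<in> ?C" "c \<in> ?C" for a b c
    using w that by (auto simp: normalized_3_cocycle_def)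
  have norm: "w a \<one>\<^bsub>G\<^esub> c = 1" if "a \<in> ?C" "c \<in> ?C" for a c
    using w that by (auto simp: normalized_3_cocycle_def)
  have coc: "w b c d * w a (b \<otimes>\<^bsub>G\<^esub> c) d * w a b c = w a b (c \<otimes>\<^bsub>G\<^esub> d) * w (a \<otimes>\<^bsub>G\<^esub> b) c d"
    if "a \<in> ?C" "b \<in> ?C" "c \<in> ?C" "d \<in> ?C" for a b c d
    using w that by (auto simp: normalized_3_cocycle_def)

  have closure: "Poly_Mapping.keys (qone ?H) \<subseteq> ?C" "Poly_Mapping.keys (qPhi ?H) \<subseteq> ?C \<times> ?C \<times> ?C"
    "Poly_Mapping.keys (qPhi_inv ?H) \<subseteq> ?C \<times> ?C \<times> ?C" "Poly_Mapping.keys (qalpha ?H) \<subseteq> ?C"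
    "Poly_Mapping.keys (qbeta ?H) \<subseteq> ?C"
    unfolding one Phi' Phi_inv' al be
    by (auto intro!: keys_sumI keys_scal_ket simp: keys_ket[THEN equalityD1] keys_ket
      dest: subsetD[OF keys_sumI] subsetD[OF keys_scal_ket])
  have closure_D: "Poly_Mapping.keys (qDelta ?H a) \<subseteq> ?C \<times> ?C" for a
    using lD by (auto simp: in_keys_iff split: if_splits)
  have assoc: "do {x \<leftarrow> pm a b; pm x c} = do {y \<leftarrow> pm b c; pm a y}" for a b c :: 'a
    by (auto simp: pm_def)
  have unit: "vmul pm (qone ?H) (ket a) = ket a" "vmul pm (ket a) (qone ?H) = ket a" if "a \<in> ?C" for a
    using that by (auto simp: vmul_ket_left vmul_ket_right lone)
  have D_hom: "do {c \<leftarrow> pm a b; qDelta ?H c} = vmul pm (qDelta ?H a) (qDelta ?H b)" for a b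
    by (auto intro!: poly_mapping_eqI simp: pm_def lD)
  define one2 :: "'a \<times> 'a \<Rightarrow>\<^sub>0 'c" where "one2 = do {a \<leftarrow> qone ?H; b \<leftarrow> qone ?H; ket (a, b)}"
  define one3 :: "'a \<times> 'a \<times> 'a \<Rightarrow>\<^sub>0 'c" where "one3 = do {a \<leftarrow> qone ?H; b \<leftarrow> one2; ket (a, b)}"
  have lone2: "?l one2 (x, y) = (if x \<in> ?C \<and> y \<in> ?C then 1 else 0)" for x y
    by (simp add: one2_def lookup_pair lone)
  have lone3: "?l one3 (x, y, z) = (if x \<in> ?C \<and> y \<in> ?C \<and> z \<in> ?C then 1 else 0)" for x y z
    by (simp add: one3_def lookup_pair lone lone2)
  have D_one: "do {a \<leftarrow> qone ?H; qDelta ?H a} = one2"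
  proof (rule poly_mapping_eqI)
    fix k :: "'a \<times> 'a"
    obtain x y where k: "k = (x, y)" by fastforce
    show "?l (do {a \<leftarrow> qone ?H; qDelta ?H a}) k = ?l one2 k"
      unfolding k lone2 by (subst lookup_lbind_single[of "x \<otimes>\<^bsub>G\<^esub> y"]) (auto simp: lD lone)
  qed
  have eps_hom: "do {c \<leftarrow> pm a b; scal (qeps ?H c) (ket ())} = scal (qeps ?H a * qeps ?H b) (ket ())" for a b
    by (auto simp: pm_def eps)
  have eps_one: "do {a \<leftarrow> qone ?H; scal (qeps ?H a) (ket ())} = ket ()"
    using fin by (simp add: one eps sum_sum_scal)
  have counit: "do {(h1, h2) \<leftarrow> qDelta ?H h; scal (qeps ?H h1) (ket h2)} = ket h"
    "do {(h1, h2) \<leftarrow> qDelta ?H h; scal (qeps ?H h2) (ket h1)} = ket h" if "h \<in> ?C" for h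
    by (simp add: D(1)[OF that] eps sum_sum_scal fin that)
       (simp add: D(2)[OF that] eps sum_sum_scal fin that)
  have Phi_invertible: "vmul pm (qPhi ?H) (qPhi_inv ?H) = one3" "vmul pm (qPhi_inv ?H) (qPhi ?H) = one3"
    by (auto intro!: poly_mapping_eqI simp: lPhi lPhi_inv lone3 nz)
  have quasi_coassoc: "do {(h1, h2) \<leftarrow> qDelta ?H h; (h21, h22) \<leftarrow> qDelta ?H h2; ket (h1, h21, h22)} =
        vmul pm (vmul pm (qPhi ?H)
          (do {(h1, h2) \<leftarrow> qDelta ?H h; (h11, h12) \<leftarrow> qDelta ?H h1; ket (h11, h12, h2)})) (qPhi_inv ?H)"
    (is "?L = vmul pm (vmul pm _ ?R) _") for h
  proof (rule poly_mapping_eqI)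
    fix k :: "'a \<times> 'a \<times> 'a"
    obtain a b c where k: "k = (a, b, c)" by (metis prod_cases3)
    have 1: "?l (do {(h21, h22) \<leftarrow> qDelta ?H h2; ket (h1, h21, h22)}) (a, b, c) =
      (if h1 = a then ?l (qDelta ?H h2) (b, c) else 0)" for h1 h2
      unfolding split_def by (rule lookup_lbind_inj) auto
    have 2: "?l (do {(h11, h12) \<leftarrow> qDelta ?H h1; ket (h11, h12, h2)}) (a, b, c) =
      (if h2 = c then ?l (qDelta ?H h1) (a, b) else 0)" for h1 h2
      unfolding split_def by (rule lookup_lbind_inj) auto
    have L: "?l ?L k = (if a \<in> ?C \<and> b \<in> ?C \<and> c \<in> ?C \<and> a \<otimes>\<^bsub>G\<^esub> (b \<otimes>\<^bsub>G\<^esub> c) = h then 1 else 0)"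
      unfolding k by (subst lookup_lbind_single[of "(a, b \<otimes>\<^bsub>G\<^esub> c)"]) (auto simp: 1 lD split: if_splits)
    have R: "?l ?R k = (if a \<in> ?C \<and> b \<in> ?C \<and> c \<in> ?C \<and> (a \<otimes>\<^bsub>G\<^esub> b) \<otimes>\<^bsub>G\<^esub> c = h then 1 else 0)"
      unfolding k by (subst lookup_lbind_single[of "(a \<otimes>\<^bsub>G\<^esub> b, c)"]) (auto simp: 2 lD split: if_splits)
    show "?l ?L k = ?l (vmul pm (vmul pm (qPhi ?H) ?R) (qPhi_inv ?H)) k"
      unfolding lookup_vmul L R by (auto simp: k lPhi lPhi_inv nz m_assoc)
  qed
  have pentagon: "vmul pm (vmul pm
          (do {u \<leftarrow> qone ?H; (X1, X2, X3) \<leftarrow> qPhi ?H; ket (u, X1, X2, X3)})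
          (do {(X1, X2, X3) \<leftarrow> qPhi ?H; (y, y') \<leftarrow> qDelta ?H X2; ket (X1, y, y', X3)}))
          (do {(X1, X2, X3) \<leftarrow> qPhi ?H; u \<leftarrow> qone ?H; ket (X1, X2, X3, u)}) =
        vmul pm
          (do {(X1, X2, X3) \<leftarrow> qPhi ?H; (y, y') \<leftarrow> qDelta ?H X3; ket (X1, X2, y, y')})
          (do {(X1, X2, X3) \<leftarrow> qPhi ?H; (y, y') \<leftarrow> qDelta ?H X1; ket (y, y', X2, X3)})"
    (is "vmul pm (vmul pm ?A1 ?A2) ?A3 = vmul pm ?B1 ?B2")
  proof (rule poly_mapping_eqI)
    fix k :: "'a \<times> 'a \<times> 'a \<times> 'a"
    obtain a b c d where k: "k = (a, b, c, d)" by (metis prod_cases4)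
    let ?in = "a \<in> ?C \<and> b \<in> ?C \<and> c \<in> ?C \<and> d \<in> ?C"
    have 1: "?l (do {(X1, X2, X3) \<leftarrow> qPhi ?H; ket (u, X1, X2, X3)}) (a, b, c, d) =
      (if u = a then ?l (qPhi ?H) (b, c, d) else 0)" for u
      unfolding split_def by (rule lookup_lbind_inj) auto
    have 2: "?l (do {(y, y') \<leftarrow> qDelta ?H X2; ket (X1, y, y', X3)}) (a, b, c, d) =
      (if X1 = a \<and> X3 = d then ?l (qDelta ?H X2) (b, c) else 0)" for X1 X2 X3
      unfolding split_def by (rule lookup_lbind_inj) auto
    have 3: "?l (do {u \<leftarrow> qone ?H; ket (X1, X2, X3, u)}) (a, b, c, d) =
      (if X1 = a \<and> X2 = b \<and> X3 = c then ?l (qone ?H) d else 0)" for X1 X2 X3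
      by (rule lookup_lbind_inj) auto
    have 4: "?l (do {(y, y') \<leftarrow> qDelta ?H X3; ket (X1, X2, y, y')}) (a, b, c, d) =
      (if X1 = a \<and> X2 = b then ?l (qDelta ?H X3) (c, d) else 0)" for X1 X2 X3
      unfolding split_def by (rule lookup_lbind_inj) auto
    have 5: "?l (do {(y, y') \<leftarrow> qDelta ?H X1; ket (y, y', X2, X3)}) (a, b, c, d) =
      (if X2 = c \<and> X3 = d then ?l (qDelta ?H X1) (a, b) else 0)" for X1 X2 X3
      unfolding split_def by (rule lookup_lbind_inj) auto
    have A1: "?l ?A1 k = (if ?in then w b c d else 0)"
      unfolding k by (subst lookup_lbind_single[of a]) (auto simp: 1 lone lPhi)
    have A2: "?l ?A2 k = (if ?in then w a (b \<otimes>\<^bsub>G\<^esub> c) d else 0)"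
      unfolding k by (subst lookup_lbind_single[of "(a, b \<otimes>\<^bsub>G\<^esub> c, d)"]) (auto simp: 2 lD lPhi split: if_splits)
    have A3: "?l ?A3 k = (if ?in then w a b c else 0)"
      unfolding k by (subst lookup_lbind_single[of "(a, b, c)"]) (auto simp: 3 lone lPhi split: if_splits)
    have B1: "?l ?B1 k = (if ?in then w a b (c \<otimes>\<^bsub>G\<^esub> d) else 0)"
      unfolding k by (subst lookup_lbind_single[of "(a, b, c \<otimes>\<^bsub>G\<^esub> d)"]) (auto simp: 4 lD lPhi split: if_splits)
    have B2: "?l ?B2 k = (if ?in then w (a \<otimes>\<^bsub>G\<^esub> b) c d else 0)"
      unfolding k by (subst lookup_lbind_single[of "(a \<otimes>\<^bsub>G\<^esub> b, c, d)"]) (auto simp: 5 lD lPhi split: if_splits)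
    show "?l (vmul pm (vmul pm ?A1 ?A2) ?A3) k = ?l (vmul pm ?B1 ?B2) k"
      unfolding lookup_vmul A1 A2 A3 B1 B2 using coc[of a b c d] by auto
  qed
  have norm': "do {(X1, X2, X3) \<leftarrow> qPhi ?H; scal (qeps ?H X2) (ket (X1, X3))} = one2"
  proof (rule poly_mapping_eqI)
    fix k :: "'a \<times> 'a"
    obtain x y where k: "k = (x, y)" by fastforce
    show "?l (do {(X1, X2, X3) \<leftarrow> qPhi ?H; scal (qeps ?H X2) (ket (X1, X3))}) k = ?l one2 k"
      unfolding k lone2 by (subst lookup_lbind_single[of "(x, \<one>\<^bsub>G\<^esub>, y)"])
        (auto simp: lPhi eps lookup_ket norm split: if_splits)
  qed
  have S_hom: "do {c \<leftarrow> pm a b; qS ?H c} = vmul pm (qS ?H b) (qS ?H a)" if "a \<in> ?C" "b \<in> ?C" for a b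
    using that inv_inj by (auto simp: pm_def S vmul_ket_left lookup_ket inj_on_def)
  have sum_inv: "(\<Sum>x\<in>?C. f (inv\<^bsub>G\<^esub> x)) = (\<Sum>x\<in>?C. f x)" for f :: "'a \<Rightarrow> 'a \<Rightarrow>\<^sub>0 'c"
    by (rule sum.reindex_bij_witness[of _ "\<lambda>x. inv\<^bsub>G\<^esub> x" "\<lambda>x. inv\<^bsub>G\<^esub> x"]) auto
  have S_one: "do {a \<leftarrow> qone ?H; qS ?H a} = qone ?H"
    by (simp add: one S sum_inv)
  have lal: "?l (qalpha ?H) x = (if x \<in> ?C then 1 else 0)" for x
    using lone by (simp add: al one)
  have lbe: "?l (qbeta ?H) x = (if x \<in> ?C then inverse (w x (inv\<^bsub>G\<^esub> x) x) else 0)" for x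
    using fin by (simp add: be lookup_sum_scal_ket)
  have S_alpha: "do {(h1, h2) \<leftarrow> qDelta ?H h; vmul pm (vmul pm (qS ?H h1) (qalpha ?H)) (ket h2)} =
        scal (qeps ?H h) (qalpha ?H)" if h: "h \<in> ?C" for h
  proof -
    have "do {(h1, h2) \<leftarrow> qDelta ?H h; vmul pm (vmul pm (qS ?H h1) (qalpha ?H)) (ket h2)} =
      (\<Sum>x\<in>?C. if h = \<one>\<^bsub>G\<^esub> then ket (inv\<^bsub>G\<^esub> x) else 0)"
      using h by (simp add: D(1)[OF h]) 
        (auto simp: S vmul_ket_left vmul_ket_right lal lookup_ket r_cancel_one' intro!: sum.cong)
    also have "\<dots> = scal (qeps ?H h) (qalpha ?H)"
      using sum_inv[of ket] by (simp add: eps al)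
    finally show ?thesis .
  qed
  have S_beta: "do {(h1, h2) \<leftarrow> qDelta ?H h; vmul pm (vmul pm (ket h1) (qbeta ?H)) (qS ?H h2)} =
        scal (qeps ?H h) (qbeta ?H)" if h: "h \<in> ?C" for h
  proof -
    have "do {(h1, h2) \<leftarrow> qDelta ?H h; vmul pm (vmul pm (ket h1) (qbeta ?H)) (qS ?H h2)} =
      (\<Sum>y\<in>?C. if h = \<one>\<^bsub>G\<^esub> then scal (?l (qbeta ?H) (inv\<^bsub>G\<^esub> y)) (ket (inv\<^bsub>G\<^esub> y)) else 0)"
      using h by (simp add: D(2)[OF h]) 
        (auto simp: S vmul_ket_left vmul_ket_right lbe lookup_ket l_cancel_one l_cancel_one' intro!: sum.cong)
    also have "\<dots> = scal (qeps ?H h) (qbeta ?H)"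
      using sum_inv[of "\<lambda>y. scal (?l (qbeta ?H) y) (ket y)"] by (simp add: eps be lbe[unfolded be])
    finally show ?thesis .
  qed
  have SS: "do {(X1, X2, X3) \<leftarrow> qPhi ?H;
        vmul pm (vmul pm (vmul pm (vmul pm (ket X1) (qbeta ?H)) (qS ?H X2)) (qalpha ?H)) (ket X3)} = qone ?H"
  proof (rule poly_mapping_eqI)
    fix g
    show "?l (do {(X1, X2, X3) \<leftarrow> qPhi ?H;
        vmul pm (vmul pm (vmul pm (vmul pm (ket X1) (qbeta ?H)) (qS ?H X2)) (qalpha ?H)) (ket X3)}) g = ?l (qone ?H) g"
      by (subst lookup_lbind_single[of "(g, inv\<^bsub>G\<^esub> g, g)"])
        (auto simp: in_keys_iff lPhi S lbe lal lone lookup_ket nz split: if_splits)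
  qed
  have SS': "do {(x1, x2, x3) \<leftarrow> qPhi_inv ?H;
        vmul pm (vmul pm (vmul pm (vmul pm (qS ?H x1) (qalpha ?H)) (ket x2)) (qbeta ?H)) (qS ?H x3)} = qone ?H"
  proof (rule poly_mapping_eqI)
    fix g
    show "?l (do {(x1, x2, x3) \<leftarrow> qPhi_inv ?H;
        vmul pm (vmul pm (vmul pm (vmul pm (qS ?H x1) (qalpha ?H)) (ket x2)) (qbeta ?H)) (qS ?H x3)}) g = ?l (qone ?H) g"
      using cocycle_inv[OF G w, of g]
      by (subst lookup_lbind_single[of "(inv\<^bsub>G\<^esub> g, g, inv\<^bsub>G\<^esub> g)"])
        (auto simp: in_keys_iff inj_on_eq_iff[OF inv_inj] lPhi_inv S lbe lal lone lookup_ket nz field_simps split: if_splits)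
  qed
  have mul_closed: "Poly_Mapping.keys (pm a b :: 'a \<Rightarrow>\<^sub>0 'c) \<subseteq> ?C" if "a \<in> ?C" for a b
    using that by (auto simp: pm_def keys_ket)
  have S_closed: "Poly_Mapping.keys (qS ?H a) \<subseteq> ?C" if "a \<in> ?C" for a
    using that by (auto simp: S keys_ket)
  show ?thesis
    unfolding quasi_hopf_algebra_def Let_def function_qmul mul_tensor_pm basis
      one2_def[symmetric] one3_def[symmetric]
    using closure closure_D mul_closed S_closed assoc unit D_hom D_one eps_hom eps_one counit
      Phi_invertible quasi_coassoc pentagon norm' S_hom S_one S_alpha S_beta SS SS'
    by (intro conjI ballI) assumption+
qed


section \<open>The double dihedral group and its cocycles\<close>

text \<open>
  The pair \<open>(A, a)\<close> stands for $X^A R^a$. By the defining relations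
  $X^A R^a X^B R^b = X^{A+B} R^{(-1)^B a + b}$, where $X^2 = R^n$, and exponents of $R$ are reduced
  modulo $2n$ to the range from $-n+1$ to $n$.
\<close>

definition dd_red :: "nat \<Rightarrow> int \<Rightarrow> int"
  where "dd_red n x = (x + int n - 1) mod (2 * int n) - int n + 1"

definition double_dihedral :: "nat \<Rightarrow> (nat \<times> int) monoid"
  where "double_dihedral n = \<lparr>
    carrier = {0, 1} \<times> {- int n + 1..int n},
    monoid.mult = (\<lambda>(A, a) (B, b).
      ((A + B) mod 2, dd_red n ((-1) ^ B * a + b + int n * int A * int B))),
    one = (0, 0)\<rparr>"

definition primitive_root_of_unity :: "nat \<Rightarrow> 'k::field \<Rightarrow> bool"
  where "primitive_root_of_unity N z \<longleftrightarrow> N > 0 \<and> z ^ N = 1 \<and> (\<forall>m. 0 < m \<and> m < N \<longrightarrow> z ^ m \<noteq> 1)"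

text \<open>The operation \<open>div\<close> on \<open>int\<close> is the floor of the quotient.\<close>

definition dd_omega ::
    "nat \<Rightarrow> 'k::field \<Rightarrow> 'k \<Rightarrow> nat \<Rightarrow> nat \<times> int \<Rightarrow> nat \<times> int \<Rightarrow> nat \<times> int \<Rightarrow> 'k"
  where "dd_omega n \<xi> \<xi>4 p = (\<lambda>(A, a) (B, b) (C, c).
    (\<xi> ^ n) powi (int p * (-1) ^ (B + C + 1) * a * int B * int C) *
    (\<xi> ^ (2 * n)) powi (int p * (-1) ^ (B + C + 1) * a *
      ((int n - (-1) ^ C * b - c - int n * int B * int C) div (2 * int n))) *
    \<xi>4 powi (- int p * int A * int B * int C))"

lemma dd_red_eq: "n \<ge> 1 \<Longrightarrow> dd_red n x = x - 2 * int n * ((x + int n - 1) div (2 * int n))"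
  by (simp add: dd_red_def minus_div_mult_eq_mod[symmetric] algebra_simps)

lemma dd_red_range:
  assumes "n \<ge> 1"
  shows "dd_red n x \<in> {- int n + 1..int n}"
proof -
  have "0 < 2 * int n" using assms by simp
  then have "0 \<le> (x + int n - 1) mod (2 * int n)" "(x + int n - 1) mod (2 * int n) < 2 * int n"
    by (rule pos_mod_sign, rule pos_mod_bound)
  then show ?thesis unfolding dd_red_def atLeastAtMost_iff by linarith
qed

lemma dd_red_id: "x \<in> {- int n + 1..int n} \<Longrightarrow> dd_red n x = x"
  by (auto simp: dd_red_def)

lemma dd_red_cong: "2 * int n dvd x - y \<Longrightarrow> dd_red n x = dd_red n y"
proof -
  assume "2 * int n dvd x - y"
  then have "2 * int n dvd (x + int n - 1) - (y + int n - 1)" by simp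
  then have "(x + int n - 1) mod (2 * int n) = (y + int n - 1) mod (2 * int n)"
    by (rule mod_eq_dvd_iff[THEN iffD2])
  then show ?thesis by (simp only: dd_red_def)
qed

lemma dd_red_dvd: "n \<ge> 1 \<Longrightarrow> 2 * int n dvd dd_red n x - x"
  by (simp add: dd_red_eq)

lemma dd_red_obtain:
  assumes "n \<ge> 1"
  obtains u where "dd_red n x = x + 2 * int n * u"
  by (rule that[of "- ((x + int n - 1) div (2 * int n))"], subst dd_red_eq[OF assms], simp only: mult_minus_right diff_conv_add_uminus)

lemma dd_mult: "(A, a) \<otimes>\<^bsub>double_dihedral n\<^esub> (B, b) =
    ((A + B) mod 2, dd_red n ((-1) ^ B * a + b + int n * int A * int B))"
  by (simp add: double_dihedral_def)

lemma dd_one: "\<one>\<^bsub>double_dihedral n\<^esub> = (0, 0)"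
  by (simp add: double_dihedral_def)

lemma dd_carrier: "carrier (double_dihedral n) = {0, 1} \<times> {- int n + 1..int n}"
  by (simp add: double_dihedral_def)

lemma dd_assoc_aux:
  assumes "n \<ge> 1" "A \<in> {0, 1}" "B \<in> {0, 1}" "C \<in> {0, 1 :: nat}"
  shows "dd_red n ((-1) ^ C * dd_red n ((-1) ^ B * a + b + int n * int A * int B) + c + int n * int ((A + B) mod 2) * int C) =
    dd_red n ((-1) ^ ((B + C) mod 2) * a + dd_red n ((-1) ^ C * b + c + int n * int B * int C) + int n * int A * int ((B + C) mod 2))"
    (is "dd_red n ((-1) ^ C * dd_red n ?x + _ + _) = dd_red n (_ + dd_red n ?y + _)")
proof (rule dd_red_cong)
  obtain u where u: "dd_red n ?x = ?x + 2 * int n * u"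
    by (rule dd_red_obtain[OF assms(1)])
  obtain v where v: "dd_red n ?y = ?y + 2 * int n * v"
    by (rule dd_red_obtain[OF assms(1)])
  have "((-1) ^ C * dd_red n ?x + c + int n * int ((A + B) mod 2) * int C)
    - ((-1) ^ ((B + C) mod 2) * a + dd_red n ?y + int n * int A * int ((B + C) mod 2))
    = 2 * int n * ((-1) ^ C * u - v - int A * int B * int C)"
    unfolding u v using assms(2-4) by (auto simp: algebra_simps)
  then show "2 * int n dvd ((-1) ^ C * dd_red n ?x + c + int n * int ((A + B) mod 2) * int C)
    - ((-1) ^ ((B + C) mod 2) * a + dd_red n ?y + int n * int A * int ((B + C) mod 2))"
    by (rule dvdI)
qed

lemma group_double_dihedral:
  assumes "n \<ge> 1"
  shows "group (double_dihedral n)"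
proof (rule groupI)
  let ?G = "double_dihedral n"
  fix x assume x: "x \<in> carrier ?G"
  obtain A a where xe: "x = (A, a)" by fastforce
  have A: "A \<in> {0, 1}" and a: "a \<in> {- int n + 1..int n}" using x by (auto simp: xe dd_carrier)
  show "\<one>\<^bsub>?G\<^esub> \<otimes>\<^bsub>?G\<^esub> x = x"
    using A a by (auto simp: xe dd_one dd_mult dd_red_id)
  show "\<exists>y\<in>carrier ?G. y \<otimes>\<^bsub>?G\<^esub> x = \<one>\<^bsub>?G\<^esub>"
  proof
    let ?y = "(A, dd_red n (if A = 0 then - a else a + int n))"
    show "?y \<in> carrier ?G" using A dd_red_range[OF assms] by (auto simp: dd_carrier)
    have "dd_red n ((-1) ^ A * dd_red n (if A = 0 then - a else a + int n) + a + int n * int A * int A) = dd_red n 0"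
    proof (rule dd_red_cong)
      obtain u where u: "dd_red n (- a) = - a + 2 * int n * u" by (rule dd_red_obtain[OF assms])
      obtain v where v: "dd_red n (a + int n) = a + int n + 2 * int n * v" by (rule dd_red_obtain[OF assms])
      have "(-1) ^ A * dd_red n (if A = 0 then - a else a + int n) + a + int n * int A * int A - 0 =
        2 * int n * (if A = 0 then u else - v)"
        using A by (auto simp: u v algebra_simps)
      then show "2 * int n dvd (-1) ^ A * dd_red n (if A = 0 then - a else a + int n) + a + int n * int A * int A - 0"
        by (rule dvdI)
    qed
    then show "?y \<otimes>\<^bsub>?G\<^esub> x = \<one>\<^bsub>?G\<^esub>"
      using A dd_red_id[of 0 n] assms by (auto simp: xe dd_one dd_mult)
  qed
  fix y assume y: "y \<in> carrier ?G"
  show "x \<otimes>\<^bsub>?G\<^esub> y \<in> carrier ?G"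
    using x y dd_red_range[OF assms] by (cases x; cases y) (auto simp: dd_carrier dd_mult)
  fix z assume z: "z \<in> carrier ?G"
  show "x \<otimes>\<^bsub>?G\<^esub> y \<otimes>\<^bsub>?G\<^esub> z = x \<otimes>\<^bsub>?G\<^esub> (y \<otimes>\<^bsub>?G\<^esub> z)"
  proof -
    obtain B b C c where e: "y = (B, b)" "z = (C, c)" by fastforce
    have BC: "B \<in> {0, 1}" "C \<in> {0, 1}" using y z by (auto simp: e dd_carrier)
    have "((A + B) mod 2 + C) mod 2 = (A + (B + C) mod 2) mod 2"
      by (simp add: mod_simps add.assoc)
    then show ?thesis
      unfolding xe e dd_mult using dd_assoc_aux[OF assms A BC, of a b c] by simp
  qed
qed (use assms in \<open>auto simp: dd_one dd_carrier\<close>)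

lemma card_double_dihedral: "card (carrier (double_dihedral n)) = 4 * n"
  by (simp add: dd_carrier card_cartesian_product)

lemma dd_R_pow:
  assumes "n \<ge> 1"
  shows "(0, 1) [^]\<^bsub>double_dihedral n\<^esub> (k :: nat) = (0, dd_red n (int k))"
proof (induction k)
  case 0
  then show ?case using assms by (simp add: dd_one dd_red_id)
next
  case (Suc k)
  have "dd_red n (dd_red n (int k) + 1) = dd_red n (int (Suc k))"
    using dd_red_dvd[OF assms, of "int k"] by (intro dd_red_cong) (simp add: algebra_simps)
  then show ?case by (simp add: Suc dd_mult)
qed

lemma double_dihedral_relations:
  fixes n defines "G \<equiv> double_dihedral n" and "R \<equiv> (0, 1) :: nat \<times> int" and "X \<equiv> (1, 0) :: nat \<times> int"
  assumes "n \<ge> 1"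
  shows "R [^]\<^bsub>G\<^esub> (2 * n) = \<one>\<^bsub>G\<^esub>" and "X [^]\<^bsub>G\<^esub> (2 :: nat) = R [^]\<^bsub>G\<^esub> n"
    and "X \<otimes>\<^bsub>G\<^esub> R = inv\<^bsub>G\<^esub> R \<otimes>\<^bsub>G\<^esub> X"
    and "(A, a) \<in> carrier G \<Longrightarrow> (A, a) = X [^]\<^bsub>G\<^esub> A \<otimes>\<^bsub>G\<^esub> R [^]\<^bsub>G\<^esub> a"
proof -
  interpret group G unfolding G_def by (rule group_double_dihedral) fact
  have R: "R \<in> carrier G" and X: "X \<in> carrier G" using assms by (auto simp: dd_carrier)
  have 0: "dd_red n 0 = 0" using assms by (simp add: dd_red_id)
  have red2n: "dd_red n (2 * int n) = 0"
    using dd_red_cong[of n "2 * int n" 0] 0 by simp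
  show "R [^]\<^bsub>G\<^esub> (2 * n) = \<one>\<^bsub>G\<^esub>"
    unfolding R_def G_def dd_R_pow[OF assms(4)] by (simp add: dd_one red2n)
  show "X [^]\<^bsub>G\<^esub> (2 :: nat) = R [^]\<^bsub>G\<^esub> n"
    unfolding R_def G_def dd_R_pow[OF assms(4)] X_def by (simp add: numeral_2_eq_2 dd_mult dd_one 0)
  have "R \<otimes>\<^bsub>G\<^esub> (X \<otimes>\<^bsub>G\<^esub> R) = X"
  proof -
    have "dd_red n (dd_red n 1 - 1) = 0" "dd_red n (dd_red n 1 - 1) = dd_red n (1 - 1)"
      using dd_red_dvd[OF assms(4), of 1] 0 dd_red_cong[of n "dd_red n 1 - 1" 0] by auto
    moreover have "dd_red n (dd_red n 1 + - 1) = 0" using calculation by simp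
    ultimately show ?thesis unfolding G_def R_def X_def dd_mult by (simp add: dd_mult)
  qed
  then show "X \<otimes>\<^bsub>G\<^esub> R = inv\<^bsub>G\<^esub> R \<otimes>\<^bsub>G\<^esub> X"
    using R X inv_solve_left[of "X \<otimes>\<^bsub>G\<^esub> R" R X] by simp
  have Rint: "R [^]\<^bsub>G\<^esub> a = (0, dd_red n a)" for a :: int
  proof (cases a rule: int_cases2)
    case (nonneg k)
    then show ?thesis by (simp add: int_pow_int R_def G_def dd_R_pow[OF assms(4)])
  next
    case (nonpos k)
    have "(0, dd_red n (- int k)) \<otimes>\<^bsub>G\<^esub> R [^]\<^bsub>G\<^esub> k = \<one>\<^bsub>G\<^esub>"
    proof -
      have "dd_red n (dd_red n (- int k) + dd_red n (int k)) = dd_red n 0"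
        using dvd_add[OF dd_red_dvd[OF assms(4), of "- int k"] dd_red_dvd[OF assms(4), of "int k"]]
        by (intro dd_red_cong) simp
      then show ?thesis unfolding R_def G_def dd_R_pow[OF assms(4)] by (simp add: dd_mult dd_one 0)
    qed
    then have "inv\<^bsub>G\<^esub> (R [^]\<^bsub>G\<^esub> k) = (0, dd_red n (- int k))"
      using R nat_pow_closed[OF R, of k] dd_red_range[OF assms(4), of "- int k"]
      by (intro inv_equality) (simp_all add: G_def dd_carrier)
    then show ?thesis using nonpos R by (simp add: int_pow_neg int_pow_int)
  qed
  show "(A, a) = X [^]\<^bsub>G\<^esub> A \<otimes>\<^bsub>G\<^esub> R [^]\<^bsub>G\<^esub> a" if "(A, a) \<in> carrier G"
    using that unfolding Rint by (auto simp: G_def X_def dd_carrier dd_one dd_mult dd_red_id)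
qed

lemma dd_omega_alt:
  assumes "n \<ge> 1" "\<xi> \<noteq> 0"
  shows "dd_omega n \<xi> \<xi>4 p (A, a) (B, b) (C, c) =
    \<xi> powi (int p * (-1) ^ (B + C + 1) * a *
      (snd ((B, b) \<otimes>\<^bsub>double_dihedral n\<^esub> (C, c)) - (-1) ^ C * b - c)) *
    \<xi>4 powi (- int p * int A * int B * int C)"
proof -
  define y where "y = (-1) ^ C * b + c + int n * int B * int C"
  have neg: "(int n - y) div (2 * int n) = - ((y + int n - 1) div (2 * int n))"
  proof -
    let ?q = "(y + int n - 1) div (2 * int n)" and ?r = "(y + int n - 1) mod (2 * int n)"
    have "0 < 2 * int n" using assms(1) by simp
    then have r: "0 \<le> ?r" "?r < 2 * int n" by (rule pos_mod_sign, rule pos_mod_bound)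
    have "y + int n - 1 = 2 * int n * ?q + ?r" by (rule mult_div_mod_eq[symmetric])
    then have "int n - y = 2 * int n * (- ?q) + (2 * int n - 1 - ?r)"
      by (simp only: mult_minus_right)
    then show ?thesis by (rule int_div_pos_eq) (use r in linarith)+
  qed
  define q where "q = (int n - (-1) ^ C * b - c - int n * int B * int C) div (2 * int n)"
  have "int n - y = int n - (-1) ^ C * b - c - int n * int B * int C" by (simp add: y_def)
  then have q: "q = (int n - y) div (2 * int n)" by (simp only: q_def)
  have "dd_red n y = y + 2 * int n * q"
    unfolding q neg by (subst dd_red_eq[OF assms(1)], simp only: mult_minus_right diff_conv_add_uminus)
  then have red: "dd_red n y - (-1) ^ C * b - c = int n * int B * int C + 2 * int n * q"
    by (simp add: y_def)
  have pw: "(\<xi> ^ m) powi i * (\<xi> ^ m') powi j = \<xi> powi (int m * i + int m' * j)" for m m' i j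
    using assms(2) by (simp add: power_int_add power_int_power)
  show ?thesis
    unfolding dd_mult snd_conv y_def[symmetric] red dd_omega_def prod.case pw q_def[symmetric]
    by (simp add: algebra_simps)
qed

lemma powi_minus_one: "(-1) powi k = (if even k then 1 else -1 :: 'k::field)"
  by (cases "even k") (auto elim!: evenE oddE simp: power_int_add power_int_mult)

lemma normalized_3_cocycle_dd_omega:
  fixes \<xi> \<xi>4 :: "'k::field"
  assumes n: "n \<ge> 1" and xi: "primitive_root_of_unity (2 * n ^ 2) \<xi>" and xi4: "primitive_root_of_unity 4 \<xi>4"
  shows "normalized_3_cocycle (double_dihedral n) (dd_omega n \<xi> \<xi>4 p)"
proof -
  let ?G = "double_dihedral n" and ?w = "dd_omega n \<xi> \<xi>4 p"
  have xi0: "\<xi> \<noteq> 0" and xi40: "\<xi>4 \<noteq> 0" using xi xi4 n by (auto simp: primitive_root_of_unity_def power_0_left)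
  note alt = dd_omega_alt[OF n xi0]
  have minus_one: "u = -1" if "u ^ 2 = 1" "u \<noteq> 1" for u :: 'k
    using that by (simp add: power2_eq_1_iff)
  have "(\<xi> ^ (n ^ 2)) ^ 2 = 1" "\<xi> ^ (n ^ 2) \<noteq> 1"
    using xi n by (auto simp: primitive_root_of_unity_def power_mult[symmetric] mult.commute)
  then have xin: "\<xi> ^ (n ^ 2) = -1" by (rule minus_one)
  have "(\<xi>4 ^ 2) ^ 2 = 1" "\<xi>4 ^ 2 \<noteq> 1"
    using xi4 unfolding primitive_root_of_unity_def by (simp_all flip: power_mult)
  then have xi42: "\<xi>4 ^ 2 = -1" by (rule minus_one)
  interpret group ?G by (rule group_double_dihedral) fact
  have nonzero: "?w x y z \<noteq> 0" for x y z
    using xi0 xi40 by (cases x; cases y; cases z) (simp add: alt power_int_not_zero)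
  show ?thesis
    unfolding normalized_3_cocycle_def
  proof (intro conjI ballI nonzero)
    fix x y assume x: "x \<in> carrier ?G" and y: "y \<in> carrier ?G"
    show "?w \<one>\<^bsub>?G\<^esub> x y = 1" "?w x \<one>\<^bsub>?G\<^esub> y = 1" "?w x y \<one>\<^bsub>?G\<^esub> = 1"
      using x y by (cases x; cases y; auto simp: alt dd_one dd_mult dd_carrier dd_red_id)+
  next
    fix x y z t
    assume G: "x \<in> carrier ?G" "y \<in> carrier ?G" "z \<in> carrier ?G" "t \<in> carrier ?G"
    obtain A a B b C c D d where e: "x = (A, a)" "y = (B, b)" "z = (C, c)" "t = (D, d)" by fastforce
    have ABCD: "A \<in> {0, 1}" "B \<in> {0, 1}" "C \<in> {0, 1}" "D \<in> {0, 1}"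
      using G by (auto simp: e dd_carrier)
    define r where "r x y = snd (x \<otimes>\<^bsub>?G\<^esub> y)" for x y
    have m: "(A, a) \<otimes>\<^bsub>?G\<^esub> (B, b) = ((A + B) mod 2, r (A, a) (B, b))" for A a B b
      by (simp add: r_def dd_mult)
    let ?D = "\<lambda>x y. r x y - (-1) ^ fst y * snd x - snd y"
    have assoc: "r y (z \<otimes>\<^bsub>?G\<^esub> t) = r (y \<otimes>\<^bsub>?G\<^esub> z) t"
      using G by (simp add: r_def m_assoc)
    define u where "u = r x y - (-1) ^ B * a - b"
    define v where "v = r z t - (-1) ^ D * c - d"
    obtain u' where "dd_red n ((-1) ^ B * a + b + int n * int A * int B) =
      ((-1) ^ B * a + b + int n * int A * int B) + 2 * int n * u'" by (rule dd_red_obtain[OF n])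
    then have u': "u = int n * (int A * int B + 2 * u')"
      by (simp add: u_def r_def e dd_mult algebra_simps)
    obtain v' where "dd_red n ((-1) ^ D * c + d + int n * int C * int D) =
      ((-1) ^ D * c + d + int n * int C * int D) + 2 * int n * v'" by (rule dd_red_obtain[OF n])
    then have v': "v = int n * (int C * int D + 2 * v')"
      by (simp add: v_def r_def e dd_mult algebra_simps)
    define P where "P = int p"
    let ?E = "\<lambda>x y z. P * (-1) ^ (fst y + fst z + 1) * snd x * (r y z - (-1) ^ fst z * snd y - snd z)"
    let ?F = "\<lambda>x y z. - P * int (fst x) * int (fst y) * int (fst z)"
    have w: "?w x y z = \<xi> powi ?E x y z * \<xi>4 powi ?F x y z" for x y z
      by (cases x; cases y; cases z) (simp add: alt r_def P_def)
    have E: "?E y z t + ?E x (y \<otimes>\<^bsub>?G\<^esub> z) t + ?E x y z = ?E x y (z \<otimes>\<^bsub>?G\<^esub> t) + ?E (x \<otimes>\<^bsub>?G\<^esub> y) z t + P * (-1) ^ (C + D) * (u * v)"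
      using assoc ABCD unfolding e m u_def v_def by (auto simp: algebra_simps)
    have F: "?F y z t + ?F x (y \<otimes>\<^bsub>?G\<^esub> z) t + ?F x y z = ?F x y (z \<otimes>\<^bsub>?G\<^esub> t) + ?F (x \<otimes>\<^bsub>?G\<^esub> y) z t - 2 * (P * int A * int B * int C * int D)"
      using ABCD unfolding e m by auto
    define s where "s = int A * int B * int C * int D + 2 * (u' * int C * int D + v' * int A * int B + 2 * u' * v')"
    have uv: "u * v = int (n ^ 2) * s"
      unfolding u' v' s_def by (simp add: power2_eq_square algebra_simps)
    have "\<xi> powi (P * (-1) ^ (C + D) * (u * v)) = (\<xi> ^ (n ^ 2)) powi (P * (-1) ^ (C + D) * s)"
      unfolding uv power_int_power by (simp add: mult_ac)
    also have "\<dots> = (-1) powi (P * int A * int B * int C * int D)"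
      unfolding xin powi_minus_one by (simp add: s_def)
    finally have xi_uv: "\<xi> powi (P * (-1) ^ (C + D) * (u * v)) = (-1) powi (P * int A * int B * int C * int D)" .
    have "\<xi>4 powi (- 2 * (P * int A * int B * int C * int D)) = (\<xi>4 ^ 2) powi (- (P * int A * int B * int C * int D))"
      unfolding power_int_power by simp
    also have "\<dots> = (-1) powi (P * int A * int B * int C * int D)"
      unfolding xi42 powi_minus_one by simp
    finally have xi4_F: "\<xi>4 powi (- 2 * (P * int A * int B * int C * int D)) = (-1) powi (P * int A * int B * int C * int D)" .
    have sgn: "(-1) powi k * (-1) powi k = (1 :: 'k)" for k
      by (simp add: powi_minus_one)
    have "?w y z t * ?w x (y \<otimes>\<^bsub>?G\<^esub> z) t * ?w x y z =
        \<xi> powi (?E y z t + ?E x (y \<otimes>\<^bsub>?G\<^esub> z) t + ?E x y z) * \<xi>4 powi (?F y z t + ?F x (y \<otimes>\<^bsub>?G\<^esub> z) t + ?F x y z)"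
      unfolding w power_int_add[OF disjI1[OF xi0]] power_int_add[OF disjI1[OF xi40]] by (simp only: mult_ac)
    also have "\<dots> = \<xi> powi (?E x y (z \<otimes>\<^bsub>?G\<^esub> t) + ?E (x \<otimes>\<^bsub>?G\<^esub> y) z t + P * (-1) ^ (C + D) * (u * v)) *
        \<xi>4 powi (?F x y (z \<otimes>\<^bsub>?G\<^esub> t) + ?F (x \<otimes>\<^bsub>?G\<^esub> y) z t + - 2 * (P * int A * int B * int C * int D))"
      unfolding E F by simp
    also have "\<dots> = ?w x y (z \<otimes>\<^bsub>?G\<^esub> t) * ?w (x \<otimes>\<^bsub>?G\<^esub> y) z t *
        ((-1) powi (P * int A * int B * int C * int D) * (-1) powi (P * int A * int B * int C * int D))"
      unfolding w power_int_add[OF disjI1[OF xi0]] power_int_add[OF disjI1[OF xi40]] xi_uv xi4_F by (simp only: mult_ac)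
    also have "\<dots> = ?w x y (z \<otimes>\<^bsub>?G\<^esub> t) * ?w (x \<otimes>\<^bsub>?G\<^esub> y) z t"
      unfolding sgn by simp
    finally show "?w y z t * ?w x (y \<otimes>\<^bsub>?G\<^esub> z) t * ?w x y z = ?w x y (z \<otimes>\<^bsub>?G\<^esub> t) * ?w (x \<otimes>\<^bsub>?G\<^esub> y) z t" .
  qed
qed

corollary quasi_hopf_algebra_dd:
  assumes "n \<ge> 1" "primitive_root_of_unity (2 * n ^ 2) \<xi>" "primitive_root_of_unity 4 \<xi>4"
  shows "quasi_hopf_algebra (function_quasi_hopf (double_dihedral n) (dd_omega n \<xi> \<xi>4 p))"
  by (intro quasi_hopf_algebra_function group_double_dihedral normalized_3_cocycle_dd_omega assms)
     (simp add: dd_carrier)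

end

theory Submission
  imports Defs
begin

text \<open>
  Let $B$ be a two-dimensional braided Hopf algebra over $H = (k^G, \Phi_\omega)$. The kernel of the
  counit is a one-dimensional Yetter--Drinfeld submodule $kx$. On a line, an action of $k^G$ is the
  choice of an element $g \in G$ (the degree), and a coaction is multiplication by the values of a
  function $\chi$ on $G$. The Yetter--Drinfeld axioms say exactly that $g$ is central and that $\chi$ is a
  quasi-character,
  \[ \chi(ab)\,\omega(a,b,g)\,\omega(g,a,b) = \chi(a)\,\chi(b)\,\omega(a,g,b), \quad \chi(e) = 1 \]
  (\<open>yd_moduleI\<close>, \<open>yd_module_homogD\<close>).

  With $u$ the unit of $B$, the axioms on unit and counit force $x^2 = bx$ and
  $\Delta(x) = x \otimes u + u \otimes x + c\,x \otimes x$. If $b$ or $c$ is nonzero, then $x \otimes x$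
  and $x$ are of the same type, so $g = e$ and $\chi = 1$; then $B$ is an ordinary Hopf algebra.
  Multiplicativity of $\Delta$ and the antipode give $bc = -2$, and $u + cx$ is a group-like element of
  order two that exhibits $B$ as $k[C_2]$. If $b = c = 0$, every reassociator that occurs in
  $\Delta(x)^2$ has an argument $e$ and drops out, so multiplicativity of $\Delta$ reads
  $0 = (1 + \chi(g))\, x \otimes x$. Conversely, if $\chi(g) = -1$, the exterior algebra on $x$ is a
  braided Hopf algebra, and it is not isomorphic to $k[C_2]$ because $\chi(g) \neq 1$. Hence
  non-trivial examples exist if and only if some central $g$ has a quasi-character with
  $\chi(g) = -1$ (\<open>nontrivial_two_dim_braided_hopf_iff\<close>).

  The centre of the double dihedral group is $\{e, R^n\}$, and $\chi(e) = 1 \neq -1$. For $g = R^n$,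
  every choice of $\epsilon = \pm 1$ and of $c$ with $c^2 = \epsilon^n$ defines a quasi-character
  $\chi(X^A R^a) = c^A (\epsilon\,\xi^{-np})^a$, and $\chi(R^n) = \epsilon^n (-1)^p$ because
  $\xi^{n^2} = -1$. A sign $\epsilon$ with $\epsilon^n (-1)^p = -1$ exists unless $n$ and $p$ are both
  even. In that case every quasi-character has $\chi(R^n) = 1$, since $R X = X R^{-1}$ forces
  $\chi(R)^2 = \xi^{-2np}$.
\<close>

section \<open>Vectors, tensors and bases\<close>

abbreviation lookup where "lookup \<equiv> Poly_Mapping.lookup"

lemma scal_add: "scal c (u + v) = scal c u + scal c v"
  and scal_add_left: "scal (c + d) v = scal c v + scal d v"
  and scal_uminus: "scal (- c) v = - scal c v"
  and scal_uminus_right: "scal c (- v) = - scal c v"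
  and scal_sum: "scal c (\<Sum>x\<in>S. f x) = (\<Sum>x\<in>S. scal c (f x))"
  by (auto intro!: poly_mapping_eqI simp: lookup_add algebra_simps lookup_sum sum_distrib_left)

lemma scal_if: "scal c (if P then u else v) = (if P then scal c u else scal c v)"
  by simp

lemma scal_eq_0_iff [simp]: "scal c v = 0 \<longleftrightarrow> c = 0 \<or> v = 0"
  by (auto simp: poly_mapping_eq_iff fun_eq_iff)

lemma ket_neq_0 [simp]: "ket i \<noteq> (0 :: 'i \<Rightarrow>\<^sub>0 'k::field)"
  by (metis keys_ket keys_zero insert_not_empty)

lemma keys_uminus_subset: "Poly_Mapping.keys (- v) \<subseteq> Poly_Mapping.keys (v :: 'i \<Rightarrow>\<^sub>0 'k::field)"
  by (auto simp: in_keys_iff)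

lemma lbind_add_right: "lbind v (\<lambda>i. f i + g i) = lbind v f + lbind v g"
  and lbind_scal_right: "lbind v (\<lambda>i. scal c (f i)) = scal c (lbind v f)"
  and lbind_zero_right [simp]: "lbind v (\<lambda>i. 0) = 0"
  and lbind_uminus: "lbind (- v) f = - lbind v f"
  by (auto intro!: poly_mapping_eqI
     simp: lookup_lbind[of "Poly_Mapping.keys v"] lookup_lbind[of "Poly_Mapping.keys v" "- v", OF finite_keys keys_uminus_subset] lookup_add
       algebra_simps sum.distrib sum_distrib_left sum_negf)

lemma lbind_if_right: "lbind v (\<lambda>i. if P then f i else g i) = (if P then lbind v f else lbind v g)"
  by simp

lemma lbind_ket_right [simp]: "lbind v ket = v"
proof (rule poly_mapping_eqI)
  show "lookup (lbind v ket) j = lookup v j" for j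
    by (subst lookup_lbind_single[of j]) (auto simp: lookup_ket)
qed

lemma vector_eq_sum_ket: "v = (\<Sum>i\<in>Poly_Mapping.keys v. scal (lookup v i) (ket i))"
  using lbind_ket_right[of v] by (simp add: lbind_def)

lemma lbind_assoc: "lbind (lbind v f) g = lbind v (\<lambda>i. lbind (f i) g)"
  unfolding lbind_def[of v] lbind_sum lbind_scal ..

text \<open>This is what makes Sweedler notation independent of the order in which independent
  components are named.\<close>

lemma lbind_swap: "lbind v (\<lambda>i. lbind u (\<lambda>j. f i j)) = lbind u (\<lambda>j. lbind v (\<lambda>i. f i j))"
  unfolding lbind_def[of v] lbind_sum_right lbind_scal_right ..

lemma lbind_lcomp: "lbind v (g \<circ>\<^sub>l f) = lbind (lbind v f) g"
  unfolding lbind_assoc lcomp_def ..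

definition vtensor :: "('i \<Rightarrow>\<^sub>0 'k::field) \<Rightarrow> ('j \<Rightarrow>\<^sub>0 'k) \<Rightarrow> ('i \<times> 'j \<Rightarrow>\<^sub>0 'k)"  (infixr \<open>\<otimes>\<^sub>v\<close> 75)
  where "u \<otimes>\<^sub>v v = lbind u (\<lambda>i. lbind v (\<lambda>j. ket (i, j)))"

lemma vtensor_ket: "ket i \<otimes>\<^sub>v ket j = ket (i, j)"
  by (simp add: vtensor_def)

lemma lookup_vtensor: "lookup (u \<otimes>\<^sub>v v) (i, j) = lookup u i * lookup v j"
  by (simp add: vtensor_def lookup_pair)

lemma vtensor_simps [simp]:
  "0 \<otimes>\<^sub>v v = 0" "u \<otimes>\<^sub>v 0 = 0" "scal c u \<otimes>\<^sub>v v = scal c (u \<otimes>\<^sub>v v)" "u \<otimes>\<^sub>v scal c v = scal c (u \<otimes>\<^sub>v v)"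
  "(- u) \<otimes>\<^sub>v v = - (u \<otimes>\<^sub>v v)" "u \<otimes>\<^sub>v (- v) = - (u \<otimes>\<^sub>v v)"
  by (auto intro!: poly_mapping_eqI simp: lookup_vtensor)

lemma vtensor_add: "(u + u') \<otimes>\<^sub>v v = u \<otimes>\<^sub>v v + u' \<otimes>\<^sub>v v" "u \<otimes>\<^sub>v (v + v') = u \<otimes>\<^sub>v v + u \<otimes>\<^sub>v v'"
  by (auto intro!: poly_mapping_eqI simp: lookup_vtensor lookup_add algebra_simps)

lemma vtensor_eq_0_iff: "u \<otimes>\<^sub>v v = 0 \<longleftrightarrow> u = 0 \<or> v = 0"
proof
  assume 0: "u \<otimes>\<^sub>v v = 0"
  have "lookup u i * lookup v j = 0" for i j
    using lookup_vtensor[of u v i j] by (simp add: 0)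
  then show "u = 0 \<or> v = 0"
    by (metis mult_eq_0_iff poly_mapping_eqI lookup_zero)
qed auto

lemma lbind_vtensor: "lbind (u \<otimes>\<^sub>v v) f = lbind u (\<lambda>i. lbind v (\<lambda>j. f (i, j)))"
  by (simp add: vtensor_def lbind_assoc)

lemma lbind_ltensor: "lbind (u \<otimes>\<^sub>v v) (f \<boxtimes> g) = lbind u f \<otimes>\<^sub>v lbind v g"
  unfolding lbind_vtensor ltensor_def vtensor_def lbind_assoc prod.case
  by (subst (2) lbind_swap) simp

lemma lbind_vtensor_ket: "lbind v (\<lambda>i. ket (a, i)) = ket a \<otimes>\<^sub>v v"
  by (simp add: vtensor_def)

lemma lcomp_apply: "(g \<circ>\<^sub>l f) i = lbind (f i) g"
  by (simp add: lcomp_def)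

lemma ltensor_apply: "(f \<boxtimes> g) (i, j) = f i \<otimes>\<^sub>v g j"
  by (simp add: ltensor_def vtensor_def)

lemma case_unit_const: "case_unit f x = f"
  by (cases x) (simp only: old.unit.case)

lemma scal_diff: "scal c (u - v) = scal c u - scal c v"
  using scal_add[of c u "- v"] by (simp add: scal_uminus_right)

lemma lbind_diff: "lbind (u - v) f = lbind u f - lbind v f"
  using lbind_add[of u "- v" f] by (simp add: lbind_uminus)

text \<open>The vectors \<open>P b\<close> form a basis, with coordinates given by \<open>Q\<close>. In a braided Hopf algebra on an
  abstract two-element basis neither the unit nor a generator of the kernel of the counit need be a
  basis vector; identities between structure maps are therefore checked on an adapted basis \<open>P\<close>.\<close>

locale vector_basis =
  fixes P :: "'b \<Rightarrow> ('i \<Rightarrow>\<^sub>0 'k::field)" and Q :: "'i \<Rightarrow> ('b \<Rightarrow>\<^sub>0 'k)"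
  assumes lbind_P_Q: "lbind (P b) Q = ket b" and lbind_Q_P: "lbind (Q i) P = ket i"
begin

lemma basis_expansion: "lbind (lbind v Q) P = v"
  by (simp add: lbind_assoc lbind_Q_P)

lemma ext_basis:
  assumes "\<And>b. lbind (P b) f = lbind (P b) g"
  shows "f = g"
proof
  fix i
  have "lbind (Q i) (\<lambda>b. lbind (P b) f) = lbind (Q i) (\<lambda>b. lbind (P b) g)" using assms by simp
  then show "f i = g i" by (simp add: lbind_assoc[symmetric] lbind_Q_P)
qed

lemma ext_basis_pair:
  assumes "\<And>b c. lbind (P b \<otimes>\<^sub>v P c) f = lbind (P b \<otimes>\<^sub>v P c) g"
  shows "f = g"
proof
  fix ij :: "'i \<times> 'i"
  obtain i j where ij: "ij = (i, j)" by fastforce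
  have "(\<lambda>i. lbind (P c) (\<lambda>j. f (i, j))) = (\<lambda>i. lbind (P c) (\<lambda>j. g (i, j)))" for c
    using assms[of _ c] by (intro ext_basis) (simp add: lbind_vtensor)
  then have "(\<lambda>j. f (i, j)) = (\<lambda>j. g (i, j))" by (intro ext_basis) metis
  then show "f ij = g ij" using ij by metis
qed

lemma P_nonzero: "P b \<noteq> 0"
  using lbind_P_Q[of b] by auto

end

lemma scal_left_imp_eq: "scal c v = scal d v \<Longrightarrow> v \<noteq> 0 \<Longrightarrow> c = (d :: 'k::field)"
  by (metis lookup_scal mult_cancel_right poly_mapping_eqI lookup_zero)

lemma lbind_bool:
  "lbind v f = scal (lookup v False) (f False) + scal (lookup v True) (f True)" for v :: "bool \<Rightarrow>\<^sub>0 'k::field"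
  by (rule poly_mapping_eqI, subst lookup_lbind[of UNIV], simp, simp, simp add: UNIV_bool lookup_add)

lemma vtensor_lbind_left: "lbind v (\<lambda>i. f i \<otimes>\<^sub>v u) = lbind v f \<otimes>\<^sub>v u"
  by (simp add: vtensor_def lbind_assoc)

lemma exists_adapted_basis:
  fixes \<epsilon> :: "bool \<Rightarrow> (unit \<Rightarrow>\<^sub>0 'k::field)" and u :: "bool \<Rightarrow>\<^sub>0 'k"
  assumes "lbind u \<epsilon> = ket ()"
  obtains x Q where "vector_basis (\<lambda>b. if b then x else u) Q" and "lbind x \<epsilon> = 0"
proof -
  define e where "e i = lookup (\<epsilon> i) ()" for i
  \<comment> \<open>The matrix with columns \<open>u\<close> and \<open>x\<close> has determinant \<open>-1\<close>; this makes its inverse \<open>Q\<close> explicit.\<close>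
  define x where "x = scal (e True) (ket False) + scal (- e False) (ket True)"
  define Q where "Q i = scal (e i) (ket False) + scal (if i then - lookup u False else lookup u True) (ket True)" for i :: bool
  have eu: "lookup u False * e False + lookup u True * e True = 1"
    using arg_cong[OF assms, of "\<lambda>v. lookup v ()"] by (simp add: lbind_bool lookup_add lookup_ket e_def)
  show ?thesis
  proof
    show "lbind x \<epsilon> = 0"
      by (rule poly_mapping_eqI) (simp add: lbind_bool lookup_add x_def lookup_ket e_def)
    show "vector_basis (\<lambda>b. if b then x else u) Q"
    proof
      fix b
      show "lbind (if b then x else u) Q = ket b"
      proof (rule poly_mapping_eqI)
        fix i
        show "lookup (lbind (if b then x else u) Q) i = lookup (ket b) i"
          using eu by (cases b; cases i) (simp_all add: lbind_bool x_def Q_def lookup_add lookup_ket algebra_simps)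
      qed
    next
      fix b
      show "lbind (Q b) (\<lambda>b. if b then x else u) = ket b"
      proof (rule poly_mapping_eqI)
        fix i
        show "lookup (lbind (Q b) (\<lambda>b. if b then x else u)) i = lookup (ket b) i"
          using eu by (cases b; cases i) (simp_all add: lbind_bool x_def Q_def lookup_add lookup_ket algebra_simps)
      qed
    qed
  qed
qed

text \<open>The coordinates \<open>p\<close> and \<open>q\<close> play the role of the two columns of \<open>W\<close>; applying a counit
  with \<open>\<epsilon>(u) = 1\<close> and \<open>\<epsilon>(x) = 0\<close> to the right factor isolates \<open>p\<close>.\<close>

lemma adapted_basis_tensor:
  fixes W :: "'j \<times> bool \<Rightarrow>\<^sub>0 'k::field"
  assumes "vector_basis (\<lambda>b. if b then x else u) Q"
  obtains p q where "W = p \<otimes>\<^sub>v u + q \<otimes>\<^sub>v x"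
proof -
  interpret vector_basis "\<lambda>b. if b then x else u" Q by fact
  have ket: "ket i = scal (lookup (Q i) False) u + scal (lookup (Q i) True) x" for i
    unfolding lbind_Q_P[symmetric] lbind_bool[of "Q i"] by simp
  have "W = lbind W (\<lambda>(j, i). ket j \<otimes>\<^sub>v ket i)"
    by (simp add: vtensor_ket)
  also have "\<dots> = lbind W (\<lambda>(j, i). scal (lookup (Q i) False) (ket j) \<otimes>\<^sub>v u + scal (lookup (Q i) True) (ket j) \<otimes>\<^sub>v x)"
    by (subst ket) (simp add: vtensor_add)
  finally show ?thesis
    by (intro that) (simp add: case_prod_unfold lbind_add_right vtensor_lbind_left del: vtensor_simps)
qed

section \<open>Homogeneous vectors in Yetter--Drinfeld modules\<close>

text \<open>The structure maps of the category act on such vectors by explicit scalars, so every categorical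
  identity turns into an identity between values of \<open>\<chi>\<close> and of the cocycle. Only
  \<open>h \<in> carrier G\<close> is constrained, since the action of other indices is arbitrary.\<close>

definition yd_homogeneous ::
    "('g, 'y) monoid_scheme \<Rightarrow> ('g, 'i, 'k::field, 'z) yd_scheme \<Rightarrow> 'g \<Rightarrow> ('g \<Rightarrow> 'k) \<Rightarrow> ('i \<Rightarrow>\<^sub>0 'k) \<Rightarrow> bool"
  where "yd_homogeneous G M g \<chi> v \<longleftrightarrow>
    (\<forall>h\<in>carrier G. lbind v (act M h) = (if h = g then v else 0)) \<and>
    lbind v (coact M) = (\<Sum>l\<in>carrier G. scal (\<chi> l) (ket l \<otimes>\<^sub>v v))"

text \<open>Written as $\chi(ab) = \chi(a)\,\chi(b)\,\tau_g(a,b)$ with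
  $\tau_g(a,b) = \omega(a,g,b)\,\omega(a,b,g)^{-1}\,\omega(g,a,b)^{-1}$, the condition says that \<open>\<chi>\<close>
  trivialises $\tau_g$. For central \<open>g\<close> this is a 2-cocycle, up to inversion the slant product of
  $\omega$ with \<open>g\<close>.\<close>

definition quasi_character :: "('g, 'z) monoid_scheme \<Rightarrow> ('g \<Rightarrow> 'g \<Rightarrow> 'g \<Rightarrow> 'k::field) \<Rightarrow> 'g \<Rightarrow> ('g \<Rightarrow> 'k) \<Rightarrow> bool"
  where "quasi_character G w g \<chi> \<longleftrightarrow> \<chi> \<one>\<^bsub>G\<^esub> = 1 \<and>
    (\<forall>a\<in>carrier G. \<forall>b\<in>carrier G. \<chi> (a \<otimes>\<^bsub>G\<^esub> b) * w a b g * w g a b = \<chi> a * \<chi> b * w a g b)"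

locale finite_group_cocycle = group G for G :: "('g, 'z) monoid_scheme" (structure) +
  fixes w :: "'g \<Rightarrow> 'g \<Rightarrow> 'g \<Rightarrow> 'k::field"
  assumes fin: "finite (carrier G)" and cocycle: "normalized_3_cocycle G w"
begin

abbreviation "H \<equiv> function_quasi_hopf G w"
abbreviation "homog \<equiv> yd_homogeneous G"

lemma w_nonzero: "a \<in> carrier G \<Longrightarrow> b \<in> carrier G \<Longrightarrow> c \<in> carrier G \<Longrightarrow> w a b c \<noteq> 0"
  and w_normalized [simp]: "a \<in> carrier G \<Longrightarrow> b \<in> carrier G \<Longrightarrow> w \<one> a b = 1"
    "a \<in> carrier G \<Longrightarrow> b \<in> carrier G \<Longrightarrow> w a \<one> b = 1"
    "a \<in> carrier G \<Longrightarrow> b \<in> carrier G \<Longrightarrow> w a b \<one> = 1"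
  using cocycle by (auto simp: normalized_3_cocycle_def)

lemma qbasis_H [simp]: "qbasis H = carrier G"
  and qeps_H: "qeps H h = (if h = \<one> then 1 else 0)"
  and qone_H: "qone H = (\<Sum>g\<in>carrier G. ket g)"
  by (simp_all add: function_quasi_hopf_def)

lemma lbind_qone: "lbind (qone H) f = (\<Sum>g\<in>carrier G. f g)"
  by (simp add: qone_H)

lemma lbind_qPhi: "lbind (qPhi H) f =
    (\<Sum>a\<in>carrier G. \<Sum>b\<in>carrier G. \<Sum>c\<in>carrier G. scal (w a b c) (f (a, b, c)))"
  and lbind_qPhi_inv: "lbind (qPhi_inv H) f =
    (\<Sum>a\<in>carrier G. \<Sum>b\<in>carrier G. \<Sum>c\<in>carrier G. scal (inverse (w a b c)) (f (a, b, c)))"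
  by (simp_all add: function_quasi_hopf_def sum.cartesian_product case_prod_unfold)

lemma lbind_qDelta: "h \<in> carrier G \<Longrightarrow> lbind (qDelta H h) f = (\<Sum>x\<in>carrier G. f (x, inv x \<otimes> h))"
  by (simp add: function_qDelta(1)[OF group_axioms fin])

lemma lbind_pm: "lbind (pm a b) f = (if a = b then f a else 0)"
  by (simp add: pm_def)

lemma lookup_pm: "lookup (pm a b) c = (if a = b \<and> a = c then 1 else 0)"
  by (simp add: pm_def lookup_ket)

lemma homog_act: "homog M g \<chi> v \<Longrightarrow> h \<in> carrier G \<Longrightarrow>
    lbind v (\<lambda>m. lbind (act M h m) f) = (if h = g then lbind v f else 0)"
  unfolding lbind_assoc[symmetric] by (auto simp: yd_homogeneous_def)

lemma homog_coact: "homog M g \<chi> v \<Longrightarrow>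
    lbind v (\<lambda>m. lbind (coact M m) f) = (\<Sum>l\<in>carrier G. scal (\<chi> l) (lbind v (\<lambda>m. f (l, m))))"
  unfolding lbind_assoc[symmetric] by (simp add: yd_homogeneous_def lbind_vtensor)

lemma homog_0 [simp]: "homog M g \<chi> 0"
  by (simp add: yd_homogeneous_def)

lemma homog_scal: "homog M g \<chi> v \<Longrightarrow> homog M g \<chi> (scal c v)"
  by (auto simp: yd_homogeneous_def scal_sum mult.commute)

lemma homog_add: "homog M g \<chi> u \<Longrightarrow> homog M g \<chi> v \<Longrightarrow> homog M g \<chi> (u + v)"
  by (auto simp: yd_homogeneous_def lbind_add vtensor_add scal_add sum.distrib)

text \<open>The type \<open>(g, \<chi>)\<close> of a nonzero homogeneous vector is an invariant; comparing two
  computations of it is how degrees and characters get restricted later.\<close>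

lemma homog_unique:
  assumes "homog M g \<chi> v" "homog M h \<psi> v" "v \<noteq> 0" "g \<in> carrier G" "h \<in> carrier G"
  shows "g = h" and "\<And>l. l \<in> carrier G \<Longrightarrow> \<chi> l = \<psi> l"
proof -
  show "g = h"
    using assms by (auto simp: yd_homogeneous_def split: if_splits)
  fix l assume l: "l \<in> carrier G"
  obtain i where i: "lookup v i \<noteq> 0" using assms(3) by (metis poly_mapping_eqI lookup_zero)
  have "lookup (lbind v (coact M)) (l, i) = \<chi> l * lookup v i"
    if "homog M g \<chi> v" for g \<chi>
  proof -
    have "lookup (lbind v (coact M)) (l, i) = (\<Sum>x\<in>carrier G. if x = l then \<chi> x * lookup v i else 0)"
      using that by (auto simp: yd_homogeneous_def lookup_sum lookup_vtensor lookup_ket intro!: sum.cong)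
    then show ?thesis using l fin by simp
  qed
  from this[OF assms(1)] this[OF assms(2)] i show "\<chi> l = \<psi> l" by simp
qed

lemma homog_cong:
  "g = h \<Longrightarrow> (\<And>l. l \<in> carrier G \<Longrightarrow> \<chi> l = \<psi> l) \<Longrightarrow> u = v \<Longrightarrow> homog M g \<chi> u \<longleftrightarrow> homog M h \<psi> v"
  by (simp add: yd_homogeneous_def)

lemma homog_unit: "homog (yd_unit H) \<one> (\<lambda>_. 1) v"
proof -
  have v: "v = scal (lookup v ()) (ket ())"
    by (rule poly_mapping_eqI) (simp add: lookup_ket)
  show ?thesis
    by (subst v, rule homog_scal) (simp add: yd_homogeneous_def yd_unit_def qeps_H lbind_qone vtensor_ket)
qed

lemma homog_braid:
  assumes "homog M g \<chi> u" "homog N h \<psi> v" "h \<in> carrier G"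
  shows "lbind (u \<otimes>\<^sub>v v) (yd_braid M N) = scal (\<chi> h) (v \<otimes>\<^sub>v u)"
proof -
  have "lbind (u \<otimes>\<^sub>v v) (yd_braid M N) =
    lbind v (\<lambda>n. lbind u (\<lambda>m. lbind (coact M m) (\<lambda>(h, m0). lbind (act N h n) (\<lambda>n'. ket (n', m0)))))"
    unfolding lbind_vtensor yd_braid_def prod.case by (rule lbind_swap)
  also have "\<dots> = (\<Sum>l\<in>carrier G. scal (\<chi> l) (lbind v (\<lambda>n. lbind u (\<lambda>m0. lbind (act N l n) (\<lambda>n'. ket (n', m0))))))"
    by (simp add: homog_coact[OF assms(1)] lbind_scal_right)
  also have "\<dots> = (\<Sum>l\<in>carrier G. scal (\<chi> l) (lbind v (\<lambda>n. lbind (act N l n) (\<lambda>n'. lbind u (\<lambda>m0. ket (n', m0))))))"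
    by (subst lbind_swap) (rule refl)
  also have "\<dots> = (\<Sum>l\<in>carrier G. if l = h then scal (\<chi> l) (lbind v (\<lambda>n'. lbind u (\<lambda>m0. ket (n', m0)))) else 0)"
    by (intro sum.cong refl) (simp add: homog_act[OF assms(2)])
  finally show ?thesis using assms(3) fin by (simp add: vtensor_def)
qed

text \<open>The next lemmas evaluate diagonal actions and coactions. The interleaved binds for the two tensor
  factors are disentangled by \<open>lbind_swap\<close>, after which each factor is evaluated by itself.\<close>

lemma homog_act_pair:
  assumes "homog M g \<chi> u" "homog N h \<psi> v" "x \<in> carrier G" "y \<in> carrier G"
  shows "lbind u (\<lambda>m. lbind v (\<lambda>n. lbind (act M x m) (\<lambda>m'. lbind (act N y n) (\<lambda>n'. f m' n')))) =
    (if x = g \<and> y = h then lbind u (\<lambda>m. lbind v (\<lambda>n. f m n)) else 0)"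
proof -
  have "lbind u (\<lambda>m. lbind v (\<lambda>n. lbind (act M x m) (\<lambda>m'. lbind (act N y n) (\<lambda>n'. f m' n')))) =
    lbind u (\<lambda>m. lbind (act M x m) (\<lambda>m'. lbind v (\<lambda>n. lbind (act N y n) (\<lambda>n'. f m' n'))))"
    by (subst lbind_swap) (rule refl)
  then show ?thesis
    by (auto simp: homog_act[OF assms(1,3)] homog_act[OF assms(2,4)])
qed

lemma homog_act_triple:
  assumes "homog M a \<chi> u" "homog N b \<psi> v" "homog P c \<theta> z" "x \<in> carrier G" "y \<in> carrier G" "t \<in> carrier G"
  shows "lbind u (\<lambda>i. lbind v (\<lambda>j. lbind z (\<lambda>k.
      lbind (act M x i) (\<lambda>i'. lbind (act N y j) (\<lambda>j'. lbind (act P t k) (\<lambda>k'. f i' j' k')))))) =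
    (if x = a \<and> y = b \<and> t = c then lbind u (\<lambda>i. lbind v (\<lambda>j. lbind z (\<lambda>k. f i j k))) else 0)"
proof -
  have "lbind u (\<lambda>i. lbind v (\<lambda>j. lbind z (\<lambda>k.
      lbind (act M x i) (\<lambda>i'. lbind (act N y j) (\<lambda>j'. lbind (act P t k) (\<lambda>k'. f i' j' k')))))) =
    lbind u (\<lambda>i. lbind v (\<lambda>j. lbind (act M x i) (\<lambda>i'. lbind (act N y j) (\<lambda>j'.
      lbind z (\<lambda>k. lbind (act P t k) (\<lambda>k'. f i' j' k'))))))"
    by (subst lbind_swap, subst (3) lbind_swap) (rule refl)
  then show ?thesis
    by (simp add: homog_act_pair[OF assms(1,2,4,5)] homog_act[OF assms(3,6)])
qed

text \<open>Acting on homogeneous vectors by the legs of a reassociator leaves a single summand, the one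
  indexed by the degrees.\<close>

lemma sum3_delta:
  assumes "a \<in> carrier G" "b \<in> carrier G" "c \<in> carrier G"
    and "\<And>x y z. x \<in> carrier G \<Longrightarrow> y \<in> carrier G \<Longrightarrow> z \<in> carrier G \<Longrightarrow>
      f x y z = (if x = a \<and> y = b \<and> z = c then F else 0)"
  shows "(\<Sum>x\<in>carrier G. \<Sum>y\<in>carrier G. \<Sum>z\<in>carrier G. scal (r x y z) (f x y z)) = scal (r a b c) F"
proof -
  have "(\<Sum>x\<in>carrier G. \<Sum>y\<in>carrier G. \<Sum>z\<in>carrier G. scal (r x y z) (f x y z)) =
    (\<Sum>x\<in>carrier G. if x = a then \<Sum>y\<in>carrier G. if y = b then \<Sum>z\<in>carrier G. if z = c then scal (r x y z) F else 0 else 0 else 0)"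
    by (auto intro!: sum.cong simp: assms(4))
  then show ?thesis using assms fin by simp
qed

lemma homog_assoc:
  assumes "homog M a \<chi> u" "homog N b \<psi> v" "homog P c \<theta> z" "a \<in> carrier G" "b \<in> carrier G" "c \<in> carrier G"
  shows "lbind ((u \<otimes>\<^sub>v v) \<otimes>\<^sub>v z) (yd_assoc H M N P) = scal (w a b c) (u \<otimes>\<^sub>v (v \<otimes>\<^sub>v z))"
    and "lbind (u \<otimes>\<^sub>v (v \<otimes>\<^sub>v z)) (yd_assoc_inv H M N P) = scal (inverse (w a b c)) ((u \<otimes>\<^sub>v v) \<otimes>\<^sub>v z)"
proof -
  note eval = homog_act_triple[OF assms(1-3)]
  show "lbind ((u \<otimes>\<^sub>v v) \<otimes>\<^sub>v z) (yd_assoc H M N P) = scal (w a b c) (u \<otimes>\<^sub>v (v \<otimes>\<^sub>v z))"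
    unfolding lbind_vtensor yd_assoc_def prod.case lbind_qPhi lbind_sum_right lbind_scal_right
    by (rule sum3_delta[OF assms(4-6), where r = w], subst eval) (simp_all add: vtensor_def lbind_assoc)
  show "lbind (u \<otimes>\<^sub>v (v \<otimes>\<^sub>v z)) (yd_assoc_inv H M N P) = scal (inverse (w a b c)) ((u \<otimes>\<^sub>v v) \<otimes>\<^sub>v z)"
    unfolding lbind_vtensor yd_assoc_inv_def prod.case lbind_qPhi_inv lbind_sum_right lbind_scal_right
    by (rule sum3_delta[OF assms(4-6), where r = "\<lambda>x y z. inverse (w x y z)"], subst eval)
       (simp_all add: vtensor_def lbind_assoc)
qed

lemma lbind_vmul_ket: "lbind (vmul pm (vmul pm (vmul pm (pm a b) (ket c)) (ket d)) (ket e)) f =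
    (if b = a \<and> c = a \<and> d = a \<and> e = a then f a else 0)"
  "lbind (vmul pm (pm a b) (ket c)) f = (if b = a \<and> c = a then f a else 0)"
  by (auto simp: vmul_ket_right lookup_pm lookup_ket)

lemma homog_act_coact:
  assumes "homog M g \<chi> u" "x \<in> carrier G"
  shows "lbind u (\<lambda>m. lbind (act M x m) (\<lambda>m1. lbind (coact M m1) f)) =
    (if x = g then \<Sum>l\<in>carrier G. scal (\<chi> l) (lbind u (\<lambda>m. f (l, m))) else 0)"
  by (simp add: homog_act[OF assms] homog_coact[OF assms(1)])

lemma homog_act_coact_pair:
  assumes "homog M g \<chi> u" "homog N h \<psi> v" "x \<in> carrier G" "y \<in> carrier G"
  shows "lbind u (\<lambda>m. lbind v (\<lambda>n. lbind (act M x m) (\<lambda>m1. lbind (coact M m1) (\<lambda>(k, m0).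
      lbind (act N y n) (\<lambda>n1. lbind (coact N n1) (\<lambda>(l, n0). f k m0 l n0)))))) =
    (if x = g \<and> y = h then \<Sum>k\<in>carrier G. \<Sum>l\<in>carrier G. scal (\<chi> k * \<psi> l) (lbind u (\<lambda>m. lbind v (\<lambda>n. f k m l n))) else 0)"
proof -
  have "lbind u (\<lambda>m. lbind v (\<lambda>n. lbind (act M x m) (\<lambda>m1. lbind (coact M m1) (\<lambda>(k, m0).
      lbind (act N y n) (\<lambda>n1. lbind (coact N n1) (\<lambda>(l, n0). f k m0 l n0)))))) =
    lbind u (\<lambda>m. lbind (act M x m) (\<lambda>m1. lbind (coact M m1) (\<lambda>(k, m0). lbind v (\<lambda>n. 
      lbind (act N y n) (\<lambda>n1. lbind (coact N n1) (\<lambda>(l, n0). f k m0 l n0))))))"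
    unfolding case_prod_unfold by (subst lbind_swap, subst (3) lbind_swap) (rule refl)
  then show ?thesis
    by (auto simp: homog_act_coact[OF assms(1,3)] homog_act_coact[OF assms(2,4)] lbind_scal_right scal_sum)
qed

text \<open>The three values of the cocycle come from $X$, $x$ and $Y$ in the coaction of a tensor product: once
  the two coactions have produced the same element \<open>P_l\<close>, every other leg is forced by the degrees.\<close>

lemma homog_tensor:
  assumes u: "homog M g \<chi> u" and v: "homog N h \<psi> v" and g: "g \<in> carrier G" and h: "h \<in> carrier G"
  shows "homog (yd_tensor H M N) (g \<otimes> h)
    (\<lambda>l. w l g h * inverse (w g l h) * w g h l * (\<chi> l * \<psi> l)) (u \<otimes>\<^sub>v v)"
  unfolding yd_homogeneous_def
proof (intro conjI ballI)
  fix k assume k: "k \<in> carrier G"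
  have "lbind (u \<otimes>\<^sub>v v) (act (yd_tensor H M N) k) =
    (\<Sum>x\<in>carrier G. if x = g \<and> inv x \<otimes> k = h then u \<otimes>\<^sub>v v else 0)"
    unfolding lbind_vtensor yd_tensor_def yd.simps prod.case lbind_qDelta[OF k] lbind_sum_right
    by (intro sum.cong refl, subst homog_act_pair[OF u v]) (use k in \<open>auto simp: vtensor_def\<close>)
  also have "\<dots> = (\<Sum>x\<in>carrier G. if x = g then if k = g \<otimes> h then u \<otimes>\<^sub>v v else 0 else 0)"
    using g h k by (intro sum.cong refl) (auto simp: inv_solve_left')
  finally show "lbind (u \<otimes>\<^sub>v v) (act (yd_tensor H M N) k) = (if k = g \<otimes> h then u \<otimes>\<^sub>v v else 0)"
    using g fin by simp
next
  let ?E = "\<lambda>X1 X2 X3 x1 x2 x3 Y1 Y2 Y3. lbind u (\<lambda>m. lbind v (\<lambda>n.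
     do {x1Y1 \<leftarrow> pm x1 Y1;
          m1 \<leftarrow> act M x1Y1 m;
          (h, m0) \<leftarrow> coact M m1;
          n1 \<leftarrow> act N Y2 n;
          (l, n0) \<leftarrow> coact N n1;
          a \<leftarrow> vmul pm (vmul pm (vmul pm (pm X1 h) (ket x2)) (ket l)) (ket Y3);
          m2 \<leftarrow> act M X2 m0;
          X3x3 \<leftarrow> pm X3 x3;
          n2 \<leftarrow> act N X3x3 n0;
          ket (a, (m2, n2))}))"
  have E: "?E X1 X2 X3 x1 x2 x3 Y1 Y2 Y3 = (if Y1 = g \<and> Y2 = h \<and> Y3 = X1 then
      if x1 = g \<and> x2 = X1 \<and> x3 = h then if X2 = g \<and> X3 = h then
        scal (\<chi> X1 * \<psi> X1) (ket X1 \<otimes>\<^sub>v (u \<otimes>\<^sub>v v)) else 0 else 0 else 0)"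
    if C: "X1 \<in> carrier G" "X2 \<in> carrier G" "X3 \<in> carrier G" "x1 \<in> carrier G" "x2 \<in> carrier G" "x3 \<in> carrier G"
      "Y1 \<in> carrier G" "Y2 \<in> carrier G" "Y3 \<in> carrier G" for X1 X2 X3 x1 x2 x3 Y1 Y2 Y3
  proof -
    have 1: "lbind u (\<lambda>m. lbind v (\<lambda>n. do {a \<leftarrow> vmul pm (vmul pm (vmul pm (pm X1 k) (ket x2)) (ket l)) (ket Y3);
          m2 \<leftarrow> act M X2 m; X3x3 \<leftarrow> pm X3 x3; n2 \<leftarrow> act N X3x3 n; ket (a, (m2, n2))})) =
      (if l = X1 then if k = X1 then if x2 = X1 \<and> Y3 = X1 \<and> X2 = g \<and> X3 = h \<and> x3 = h then 
          ket X1 \<otimes>\<^sub>v (u \<otimes>\<^sub>v v) else 0 else 0 else 0)" for k l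
      using homog_act_pair[OF u v C(2,3), of "\<lambda>m n. ket (X1, m, n)"]
      by (cases "k = X1"; cases "l = X1"; cases "x2 = X1"; cases "Y3 = X1"; cases "x3 = X3")
        (auto simp: lbind_vmul_ket lbind_pm vtensor_def lbind_assoc)
    have "?E X1 X2 X3 x1 x2 x3 Y1 Y2 Y3 = (if x1 = Y1 then lbind u (\<lambda>m. lbind v (\<lambda>n.
      do {m1 \<leftarrow> act M x1 m;
          (h, m0) \<leftarrow> coact M m1;
          n1 \<leftarrow> act N Y2 n;
          (l, n0) \<leftarrow> coact N n1;
          a \<leftarrow> vmul pm (vmul pm (vmul pm (pm X1 h) (ket x2)) (ket l)) (ket Y3);
          m2 \<leftarrow> act M X2 m0;
          X3x3 \<leftarrow> pm X3 x3;
          n2 \<leftarrow> act N X3x3 n0;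
          ket (a, (m2, n2))})) else 0)"
      by (simp add: lbind_pm)
    also have "\<dots> = (if x1 = Y1 then if x1 = g \<and> Y2 = h then \<Sum>k\<in>carrier G. \<Sum>l\<in>carrier G. 
       if l = X1 then if k = X1 then if x2 = X1 \<and> Y3 = X1 \<and> X2 = g \<and> X3 = h \<and> x3 = h then 
          scal (\<chi> k * \<psi> l) (ket X1 \<otimes>\<^sub>v (u \<otimes>\<^sub>v v)) else 0 else 0 else 0 else 0 else 0)"
      unfolding homog_act_coact_pair[OF u v C(4,8)] 1 by (simp add: scal_if cong: if_cong)
    finally show ?thesis
      using C fin by auto
  qed
  show "lbind (u \<otimes>\<^sub>v v) (coact (yd_tensor H M N)) = (\<Sum>l\<in>carrier G.
      scal (w l g h * inverse (w g l h) * w g h l * (\<chi> l * \<psi> l)) (ket l \<otimes>\<^sub>v (u \<otimes>\<^sub>v v)))"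
    unfolding lbind_vtensor yd_tensor_def yd.simps prod.case lbind_qPhi lbind_qPhi_inv lbind_sum_right
      lbind_scal_right function_qmul
  proof (rule sum.cong[OF refl])
    fix X1 assume X1: "X1 \<in> carrier G"
    \<comment> \<open>The sums are collapsed from the innermost reassociator outwards.\<close>
    let ?R = "\<lambda>X2 X3. if X2 = g \<and> X3 = h then scal (\<chi> X1 * \<psi> X1) (ket X1 \<otimes>\<^sub>v (u \<otimes>\<^sub>v v)) else 0"
    have Y: "(\<Sum>Y1\<in>carrier G. \<Sum>Y2\<in>carrier G. \<Sum>Y3\<in>carrier G. scal (w Y1 Y2 Y3) (?E X1 X2 X3 x1 x2 x3 Y1 Y2 Y3)) =
      (if x1 = g \<and> x2 = X1 \<and> x3 = h then scal (w g h X1) (?R X2 X3) else 0)"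
      if C: "X2 \<in> carrier G" "X3 \<in> carrier G" "x1 \<in> carrier G" "x2 \<in> carrier G" "x3 \<in> carrier G" for X2 X3 x1 x2 x3
      by (subst sum3_delta[OF g h X1, where r = w, OF E[OF X1 C]]) auto
    have x: "(\<Sum>x1\<in>carrier G. \<Sum>x2\<in>carrier G. \<Sum>x3\<in>carrier G. scal (inverse (w x1 x2 x3))
        (\<Sum>Y1\<in>carrier G. \<Sum>Y2\<in>carrier G. \<Sum>Y3\<in>carrier G. scal (w Y1 Y2 Y3) (?E X1 X2 X3 x1 x2 x3 Y1 Y2 Y3))) =
      scal (inverse (w g X1 h)) (scal (w g h X1) (?R X2 X3))"
      if C: "X2 \<in> carrier G" "X3 \<in> carrier G" for X2 X3
      by (rule sum3_delta[OF g X1 h, where r = "\<lambda>x y z. inverse (w x y z)", OF Y[OF C]])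
    have "(\<Sum>X2\<in>carrier G. \<Sum>X3\<in>carrier G. scal (w X1 X2 X3) (\<Sum>x1\<in>carrier G. \<Sum>x2\<in>carrier G. \<Sum>x3\<in>carrier G. scal (inverse (w x1 x2 x3))
        (\<Sum>Y1\<in>carrier G. \<Sum>Y2\<in>carrier G. \<Sum>Y3\<in>carrier G. scal (w Y1 Y2 Y3) (?E X1 X2 X3 x1 x2 x3 Y1 Y2 Y3)))) =
     (\<Sum>X2\<in>carrier G. if X2 = g then \<Sum>X3\<in>carrier G. if X3 = h then scal (w X1 X2 X3) (scal (inverse (w g X1 h)) (scal (w g h X1) (?R X2 X3))) else 0 else 0)"
      by (auto intro!: sum.cong simp: x mult.assoc)
    also have "\<dots> = scal (w X1 g h * inverse (w g X1 h) * w g h X1 * (\<chi> X1 * \<psi> X1)) (ket X1 \<otimes>\<^sub>v (u \<otimes>\<^sub>v v))"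
      using g h fin by (simp add: mult.assoc)
    finally show "(\<Sum>X2\<in>carrier G. \<Sum>X3\<in>carrier G. scal (w X1 X2 X3) (\<Sum>x1\<in>carrier G. \<Sum>x2\<in>carrier G. \<Sum>x3\<in>carrier G. scal (inverse (w x1 x2 x3))
        (\<Sum>Y1\<in>carrier G. \<Sum>Y2\<in>carrier G. \<Sum>Y3\<in>carrier G. scal (w Y1 Y2 Y3) (?E X1 X2 X3 x1 x2 x3 Y1 Y2 Y3)))) =
       scal (w X1 g h * inverse (w g X1 h) * w g h X1 * (\<chi> X1 * \<psi> X1)) (ket X1 \<otimes>\<^sub>v (u \<otimes>\<^sub>v v))" .
  qed
qed

lemma homog_qone: "homog M g \<chi> v \<Longrightarrow> g \<in> carrier G \<Longrightarrow> lbind v (\<lambda>m. lbind (qone H) (\<lambda>h. act M h m)) = v"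
  using fin by (simp add: lbind_qone yd_homogeneous_def)

lemma homog_counit: "homog M g \<chi> v \<Longrightarrow>
   lbind v (\<lambda>m. lbind (coact M m) (\<lambda>(h, m0). scal (qeps H h) (ket m0))) = scal (\<chi> \<one>) v"
proof -
  assume v: "homog M g \<chi> v"
  have "lbind v (\<lambda>m. lbind (coact M m) (\<lambda>(h, m0). scal (qeps H h) (ket m0))) =
    (\<Sum>l\<in>carrier G. if l = \<one> then scal (\<chi> l) v else 0)"
    unfolding homog_coact[OF v] by (intro sum.cong refl) (auto simp: qeps_H)
  then show ?thesis using fin by simp
qed

text \<open>The two sides of the coassociativity axiom of a Yetter--Drinfeld module on a homogeneous vector.
  Their coefficients at $P_a \otimes P_b$ are the two sides of the quasi-character equation.\<close>

lemma homog_coassoc_left: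
  assumes v: "homog M g \<chi> v" and g: "g \<in> carrier G"
  shows "lbind v (\<lambda>m. do {(X1, X2, X3) \<leftarrow> qPhi H;
          (h, m0) \<leftarrow> coact M m;
          m1 \<leftarrow> act M X2 m0;
          (l, m2) \<leftarrow> coact M m1;
          a \<leftarrow> pm X1 h;
          b \<leftarrow> pm l X3;
          ket (a, b, m2)}) =
   (\<Sum>a\<in>carrier G. \<Sum>b\<in>carrier G. scal (w a g b * \<chi> a * \<chi> b) (ket a \<otimes>\<^sub>v ket b \<otimes>\<^sub>v v))"
proof -
  have E: "lbind v (\<lambda>m. do {
          (h, m0) \<leftarrow> coact M m;
          m1 \<leftarrow> act M X2 m0;
          (l, m2) \<leftarrow> coact M m1;
          a \<leftarrow> pm X1 h;
          b \<leftarrow> pm l X3;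
          ket (a, b, m2)}) = (if X2 = g then scal (\<chi> X1 * \<chi> X3) (ket X1 \<otimes>\<^sub>v ket X3 \<otimes>\<^sub>v v) else 0)"
    if X: "X1 \<in> carrier G" "X2 \<in> carrier G" "X3 \<in> carrier G" for X1 X2 X3
  proof -
    have "lbind v (\<lambda>m. do {
          (h, m0) \<leftarrow> coact M m;
          m1 \<leftarrow> act M X2 m0;
          (l, m2) \<leftarrow> coact M m1;
          a \<leftarrow> pm X1 h;
          b \<leftarrow> pm l X3;
          ket (a, b, m2)}) = (\<Sum>h\<in>carrier G. if h = X1 then \<Sum>l\<in>carrier G. if l = X3 then
            if X2 = g then scal (\<chi> h * \<chi> l) (ket X1 \<otimes>\<^sub>v ket X3 \<otimes>\<^sub>v v) else 0 else 0 else 0)"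
      unfolding homog_coact[OF v] prod.case
      by (auto simp: homog_act_coact[OF v] X lbind_pm scal_sum vtensor_def lbind_assoc intro!: sum.cong sum.neutral)
    then show ?thesis using X fin by (cases "X2 = g") simp_all
  qed
  show ?thesis
    unfolding lbind_qPhi prod.case lbind_sum_right lbind_scal_right
  proof (rule sum.cong[OF refl])
    fix X1 assume X1: "X1 \<in> carrier G"
    let ?E = "\<lambda>X2 X3. lbind v (\<lambda>m. do {
          (h, m0) \<leftarrow> coact M m;
          m1 \<leftarrow> act M X2 m0;
          (l, m2) \<leftarrow> coact M m1;
          a \<leftarrow> pm X1 h;
          b \<leftarrow> pm l X3;
          ket (a, b, m2)})"
    have "(\<Sum>X2\<in>carrier G. \<Sum>X3\<in>carrier G. scal (w X1 X2 X3) (?E X2 X3)) =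
      (\<Sum>X2\<in>carrier G. if X2 = g then \<Sum>X3\<in>carrier G. scal (w X1 g X3 * \<chi> X1 * \<chi> X3) (ket X1 \<otimes>\<^sub>v ket X3 \<otimes>\<^sub>v v) else 0)"
      by (auto intro!: sum.cong simp: E X1 mult.assoc)
    also have "\<dots> = (\<Sum>X3\<in>carrier G. scal (w X1 g X3 * \<chi> X1 * \<chi> X3) (ket X1 \<otimes>\<^sub>v ket X3 \<otimes>\<^sub>v v))"
      using g fin by simp
    finally show "(\<Sum>X2\<in>carrier G. \<Sum>X3\<in>carrier G. scal (w X1 X2 X3) (?E X2 X3)) =
      (\<Sum>X3\<in>carrier G. scal (w X1 g X3 * \<chi> X1 * \<chi> X3) (ket X1 \<otimes>\<^sub>v ket X3 \<otimes>\<^sub>v v))" .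
  qed
qed

lemma homog_coassoc_right:
  assumes v: "homog M g \<chi> v" and g: "g \<in> carrier G"
  shows "lbind v (\<lambda>m. do {(X1, X2, X3) \<leftarrow> qPhi H;
          (Y1, Y2, Y3) \<leftarrow> qPhi H;
          m1 \<leftarrow> act M Y1 m;
          (h, m0) \<leftarrow> coact M m1;
          (h1, h2) \<leftarrow> qDelta H h;
          a \<leftarrow> vmul pm (pm X1 h1) (ket Y2);
          b \<leftarrow> vmul pm (pm X2 h2) (ket Y3);
          m2 \<leftarrow> act M X3 m0;
          ket (a, b, m2)}) =
   (\<Sum>a\<in>carrier G. \<Sum>b\<in>carrier G. scal (w a b g * w g a b * \<chi> (a \<otimes> b)) (ket a \<otimes>\<^sub>v ket b \<otimes>\<^sub>v v))"
proof -
  let ?E = "\<lambda>X1 X2 X3 Y1 Y2 Y3. lbind v (\<lambda>m. do {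
          m1 \<leftarrow> act M Y1 m;
          (h, m0) \<leftarrow> coact M m1;
          (h1, h2) \<leftarrow> qDelta H h;
          a \<leftarrow> vmul pm (pm X1 h1) (ket Y2);
          b \<leftarrow> vmul pm (pm X2 h2) (ket Y3);
          m2 \<leftarrow> act M X3 m0;
          ket (a, b, m2)})"
  have E: "?E X1 X2 X3 Y1 Y2 Y3 = (if Y1 = g \<and> Y2 = X1 \<and> Y3 = X2 then if X3 = g then
       scal (\<chi> (X1 \<otimes> X2)) (ket X1 \<otimes>\<^sub>v ket X2 \<otimes>\<^sub>v v) else 0 else 0)"
    if X: "X1 \<in> carrier G" "X2 \<in> carrier G" "X3 \<in> carrier G" "Y1 \<in> carrier G" for X1 X2 X3 Y1 Y2 Y3
  proof -
    have "?E X1 X2 X3 Y1 Y2 Y3 = (if Y1 = g then \<Sum>l\<in>carrier G. scal (\<chi> l) (lbind v (\<lambda>m0. do {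
          (h1, h2) \<leftarrow> qDelta H l;
          a \<leftarrow> vmul pm (pm X1 h1) (ket Y2);
          b \<leftarrow> vmul pm (pm X2 h2) (ket Y3);
          m2 \<leftarrow> act M X3 m0;
          ket (a, b, m2)})) else 0)"
      by (simp add: homog_act_coact[OF v] X)
    also have "\<dots> = (if Y1 = g then \<Sum>l\<in>carrier G. \<Sum>x\<in>carrier G. if x = X1 then if l = X1 \<otimes> X2 then
       if Y2 = X1 \<and> Y3 = X2 \<and> X3 = g then
       scal (\<chi> (X1 \<otimes> X2)) (ket X1 \<otimes>\<^sub>v ket X2 \<otimes>\<^sub>v v) else 0 else 0 else 0 else 0)"
    proof (intro if_cong refl sum.cong)
      fix l assume l: "l \<in> carrier G"
      have X2: "inv X1 \<otimes> l = X2 \<longleftrightarrow> l = X1 \<otimes> X2"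
        using X l by (metis inv_solve_left)
      have "lbind v (\<lambda>m0. do {
          (h1, h2) \<leftarrow> qDelta H l;
          a \<leftarrow> vmul pm (pm X1 h1) (ket Y2);
          b \<leftarrow> vmul pm (pm X2 h2) (ket Y3);
          m2 \<leftarrow> act M X3 m0;
          ket (a, b, m2)}) = (\<Sum>x\<in>carrier G. if x = X1 then if l = X1 \<otimes> X2 then
       if Y2 = X1 \<and> Y3 = X2 \<and> X3 = g then ket X1 \<otimes>\<^sub>v ket X2 \<otimes>\<^sub>v v else 0 else 0 else 0)"
        unfolding lbind_qDelta[OF l] lbind_vmul_ket prod.case lbind_sum_right lbind_if_right homog_act[OF v X(3)] 
        by (intro sum.cong refl) (auto simp: X2 vtensor_def lbind_assoc)
      then show "scal (\<chi> l) (lbind v (\<lambda>m0. do {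
          (h1, h2) \<leftarrow> qDelta H l;
          a \<leftarrow> vmul pm (pm X1 h1) (ket Y2);
          b \<leftarrow> vmul pm (pm X2 h2) (ket Y3);
          m2 \<leftarrow> act M X3 m0;
          ket (a, b, m2)})) = (\<Sum>x\<in>carrier G. if x = X1 then if l = X1 \<otimes> X2 then
       if Y2 = X1 \<and> Y3 = X2 \<and> X3 = g then
       scal (\<chi> (X1 \<otimes> X2)) (ket X1 \<otimes>\<^sub>v ket X2 \<otimes>\<^sub>v v) else 0 else 0 else 0)"
        by (auto simp: scal_sum intro!: sum.cong)
    qed
    finally show ?thesis using X fin by auto
  qed
  show ?thesis
    unfolding lbind_qPhi prod.case lbind_sum_right lbind_scal_right
  proof (intro sum.cong refl)
    fix X1 X2 assume X: "X1 \<in> carrier G" "X2 \<in> carrier G"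
    have Y: "(\<Sum>Y1\<in>carrier G. \<Sum>Y2\<in>carrier G. \<Sum>Y3\<in>carrier G. scal (w Y1 Y2 Y3) (?E X1 X2 X3 Y1 Y2 Y3)) =
      scal (w g X1 X2) (if X3 = g then scal (\<chi> (X1 \<otimes> X2)) (ket X1 \<otimes>\<^sub>v ket X2 \<otimes>\<^sub>v v) else 0)"
      if X3: "X3 \<in> carrier G" for X3
      by (rule sum3_delta[OF g X, where r = w, OF E[OF X X3]])
    have "(\<Sum>X3\<in>carrier G. scal (w X1 X2 X3) (\<Sum>Y1\<in>carrier G. \<Sum>Y2\<in>carrier G. \<Sum>Y3\<in>carrier G. scal (w Y1 Y2 Y3) (?E X1 X2 X3 Y1 Y2 Y3)))
      = (\<Sum>X3\<in>carrier G. if X3 = g then scal (w X1 X2 g * w g X1 X2 * \<chi> (X1 \<otimes> X2)) (ket X1 \<otimes>\<^sub>v ket X2 \<otimes>\<^sub>v v) else 0)"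
      by (intro sum.cong refl) (auto simp: Y mult.assoc)
    then show "(\<Sum>X3\<in>carrier G. scal (w X1 X2 X3) (\<Sum>Y1\<in>carrier G. \<Sum>Y2\<in>carrier G. \<Sum>Y3\<in>carrier G. scal (w Y1 Y2 Y3) (?E X1 X2 X3 Y1 Y2 Y3)))
      = scal (w X1 X2 g * w g X1 X2 * \<chi> (X1 \<otimes> X2)) (ket X1 \<otimes>\<^sub>v ket X2 \<otimes>\<^sub>v v)"
      using g fin by simp
  qed
qed

text \<open>The two sides of the compatibility of action and coaction. They are supported at $h g^{-1}$ and at
  $g^{-1} h$, so that they agree for all \<open>h\<close> only if \<open>g\<close> is central.\<close>

lemma homog_crossed_left:
  assumes v: "homog M g \<chi> v" and g: "g \<in> carrier G" and h: "h \<in> carrier G"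
  shows "lbind v (\<lambda>m. do {(h1, h2) \<leftarrow> qDelta H h;
          (l, m0) \<leftarrow> coact M m;
          a \<leftarrow> pm h1 l;
          m1 \<leftarrow> act M h2 m0;
          ket (a, m1)}) = scal (\<chi> (h \<otimes> inv g)) (ket (h \<otimes> inv g) \<otimes>\<^sub>v v)"
proof -
  have "lbind v (\<lambda>m. do {(h1, h2) \<leftarrow> qDelta H h;
          (l, m0) \<leftarrow> coact M m;
          a \<leftarrow> pm h1 l;
          m1 \<leftarrow> act M h2 m0;
          ket (a, m1)}) = (\<Sum>x\<in>carrier G. if x = h \<otimes> inv g then \<Sum>l\<in>carrier G. if l = x then
            scal (\<chi> l) (ket x \<otimes>\<^sub>v v) else 0 else 0)"
  proof (unfold lbind_qDelta[OF h] prod.case lbind_sum_right homog_coact[OF v], rule sum.cong[OF refl])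
    fix x assume x: "x \<in> carrier G"
    have "inv x \<otimes> h = g \<longleftrightarrow> x = h \<otimes> inv g"
      using x h g by (metis inv_solve_left inv_solve_right)
    then show "(\<Sum>l\<in>carrier G. scal (\<chi> l) (lbind v (\<lambda>m0. do {
          a \<leftarrow> pm x l; m1 \<leftarrow> act M (inv x \<otimes> h) m0; ket (a, m1)}))) =
       (if x = h \<otimes> inv g then \<Sum>l\<in>carrier G. if l = x then scal (\<chi> l) (ket x \<otimes>\<^sub>v v) else 0 else 0)"
      using x h by (auto simp: lbind_pm lbind_if_right homog_act[OF v] vtensor_def intro!: sum.cong sum.neutral)
  qed
  then show ?thesis using g h fin by simp
qed

lemma homog_crossed_right:
  assumes v: "homog M g \<chi> v" and g: "g \<in> carrier G" and h: "h \<in> carrier G"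
  shows "lbind v (\<lambda>m. do {(h1, h2) \<leftarrow> qDelta H h;
          m1 \<leftarrow> act M h1 m;
          (l, m0) \<leftarrow> coact M m1;
          a \<leftarrow> pm l h2;
          ket (a, m0)}) = scal (\<chi> (inv g \<otimes> h)) (ket (inv g \<otimes> h) \<otimes>\<^sub>v v)"
proof -
  have "lbind v (\<lambda>m. do {(h1, h2) \<leftarrow> qDelta H h;
          m1 \<leftarrow> act M h1 m;
          (l, m0) \<leftarrow> coact M m1;
          a \<leftarrow> pm l h2;
          ket (a, m0)}) = (\<Sum>x\<in>carrier G. if x = g then \<Sum>l\<in>carrier G. if l = inv g \<otimes> h then
            scal (\<chi> l) (ket l \<otimes>\<^sub>v v) else 0 else 0)"
    unfolding lbind_qDelta[OF h] prod.case lbind_sum_right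
    by (intro sum.cong refl) (auto simp: homog_act_coact[OF v] lbind_pm vtensor_def intro!: sum.cong)
  then show ?thesis using g h fin by simp
qed

lemma lookup_sum2_vtensor:
  assumes "a \<in> carrier G" "b \<in> carrier G"
  shows "lookup (\<Sum>x\<in>carrier G. \<Sum>y\<in>carrier G. scal (r x y) (ket x \<otimes>\<^sub>v ket y \<otimes>\<^sub>v v)) (a, b, i) = r a b * lookup v i"
proof -
  have "lookup (\<Sum>x\<in>carrier G. \<Sum>y\<in>carrier G. scal (r x y) (ket x \<otimes>\<^sub>v ket y \<otimes>\<^sub>v v)) (a, b, i) =
    (\<Sum>x\<in>carrier G. if x = a then \<Sum>y\<in>carrier G. if y = b then r x y * lookup v i else 0 else 0)"
    unfolding lookup_sum by (intro sum.cong refl) (auto simp: lookup_sum lookup_vtensor lookup_ket intro!: sum.cong)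
  then show ?thesis using assms fin by simp
qed

text \<open>Evaluating the equation at \<open>a\<close> and its inverse shows that \<open>\<chi> a\<close> is a unit.\<close>

lemma quasi_character_nonzero:
  assumes \<chi>: "quasi_character G w g \<chi>" and g: "g \<in> carrier G" and a: "a \<in> carrier G"
  shows "\<chi> a \<noteq> 0"
proof -
  have "\<chi> (a \<otimes> inv a) * w a (inv a) g * w g a (inv a) = \<chi> a * \<chi> (inv a) * w a g (inv a)" "\<chi> \<one> = 1"
    using \<chi> a unfolding quasi_character_def by (blast intro: inv_closed)+
  moreover have "w a (inv a) g \<noteq> 0" "w g a (inv a) \<noteq> 0"
    using w_nonzero a g by auto
  ultimately show ?thesis using a by auto
qed

lemma inv_commute_iff:
  assumes "g \<in> carrier G" "h \<in> carrier G"
  shows "inv g \<otimes> h = h \<otimes> inv g \<longleftrightarrow> g \<otimes> h = h \<otimes> g"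
proof -
  have "h \<otimes> inv g = inv g \<otimes> h \<longleftrightarrow> h = (g \<otimes> h) \<otimes> inv g"
    using assms by (simp add: inv_solve_left m_assoc)
  also have "\<dots> \<longleftrightarrow> g \<otimes> h = h \<otimes> g"
    using assms by (simp add: inv_solve_right)
  finally show ?thesis by auto
qed

lemma yd_module_homogD:
  assumes M: "yd_module H M" and v: "homog M g \<chi> v" and v0: "v \<noteq> 0" and g: "g \<in> carrier G"
  shows "quasi_character G w g \<chi>" and "h \<in> carrier G \<Longrightarrow> g \<otimes> h = h \<otimes> g"
proof -
  note M = M[unfolded yd_module_def function_qmul qbasis_H]
  obtain i where i: "lookup v i \<noteq> 0" using v0 by (metis poly_mapping_eqI lookup_zero)
  have "scal (\<chi> \<one>) v = v"
    using M unfolding homog_counit[OF v, symmetric] by simp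
  then have "\<chi> \<one> * lookup v i = lookup v i" by (metis lookup_scal)
  then have one: "\<chi> \<one> = 1" using i by simp
  have "(\<Sum>a\<in>carrier G. \<Sum>b\<in>carrier G. scal (w a g b * \<chi> a * \<chi> b) (ket a \<otimes>\<^sub>v ket b \<otimes>\<^sub>v v)) =
    (\<Sum>a\<in>carrier G. \<Sum>b\<in>carrier G. scal (w a b g * w g a b * \<chi> (a \<otimes> b)) (ket a \<otimes>\<^sub>v ket b \<otimes>\<^sub>v v))"
    using M unfolding homog_coassoc_left[OF v g, symmetric] homog_coassoc_right[OF v g, symmetric] by simp
  then have E: "w a g b * \<chi> a * \<chi> b = w a b g * w g a b * \<chi> (a \<otimes> b)" if "a \<in> carrier G" "b \<in> carrier G" for a b
    using lookup_sum2_vtensor[OF that, of "\<lambda>a b. w a g b * \<chi> a * \<chi> b" v i]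
      lookup_sum2_vtensor[OF that, of "\<lambda>a b. w a b g * w g a b * \<chi> (a \<otimes> b)" v i] i by simp
  show \<chi>: "quasi_character G w g \<chi>"
    unfolding quasi_character_def
  proof (intro conjI ballI one)
    fix a b assume "a \<in> carrier G" "b \<in> carrier G"
    from E[OF this] show "\<chi> (a \<otimes> b) * w a b g * w g a b = \<chi> a * \<chi> b * w a g b"
      by (simp only: mult_ac)
  qed
  fix h assume h: "h \<in> carrier G"
  have "scal (\<chi> (h \<otimes> inv g)) (ket (h \<otimes> inv g) \<otimes>\<^sub>v v) = scal (\<chi> (inv g \<otimes> h)) (ket (inv g \<otimes> h) \<otimes>\<^sub>v v)"
    using M h unfolding homog_crossed_left[OF v g h, symmetric] homog_crossed_right[OF v g h, symmetric] by simp
  from arg_cong[OF this, of "\<lambda>u. lookup u (h \<otimes> inv g, i)"]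
  have "\<chi> (h \<otimes> inv g) * (lookup (ket (h \<otimes> inv g)) (h \<otimes> inv g) * lookup v i) =
     \<chi> (inv g \<otimes> h) * (lookup (ket (inv g \<otimes> h)) (h \<otimes> inv g) * lookup v i)"
    by (simp only: lookup_scal lookup_vtensor)
  moreover have "\<chi> (h \<otimes> inv g) \<noteq> 0"
    using quasi_character_nonzero[OF \<chi> g] h g by simp
  ultimately have "lookup (ket (inv g \<otimes> h) :: 'g \<Rightarrow>\<^sub>0 'k) (h \<otimes> inv g) \<noteq> 0"
    using i by (auto simp: lookup_ket)
  then have "inv g \<otimes> h = h \<otimes> inv g"
    by (metis lookup_ket)
  then show "g \<otimes> h = h \<otimes> g"
    using inv_commute_iff[OF g h] by simp
qed

lemma yd_moduleI:
  assumes "\<And>m. \<exists>g \<chi>. g \<in> carrier G \<and> (\<forall>h\<in>carrier G. g \<otimes> h = h \<otimes> g) \<and> quasi_character G w g \<chi> \<and> homog M g \<chi> (ket m)"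
  shows "yd_module H M"
  unfolding yd_module_def function_qmul qbasis_H
proof (intro conjI allI ballI)
  fix m
  obtain g \<chi> where g: "g \<in> carrier G" and central: "\<forall>h\<in>carrier G. g \<otimes> h = h \<otimes> g"
    and \<chi>: "quasi_character G w g \<chi>" and v: "homog M g \<chi> (ket m)"
    using assms by blast
  have one: "\<chi> \<one> = 1" and mult: "\<And>a b. a \<in> carrier G \<Longrightarrow> b \<in> carrier G \<Longrightarrow> 
       \<chi> (a \<otimes> b) * w a b g * w g a b = \<chi> a * \<chi> b * w a g b"
    using \<chi> by (auto simp: quasi_character_def)
  show "do {h \<leftarrow> qone H; act M h m} = ket m"
    using homog_qone[OF v g] by simp
  show "do {(h, m0) \<leftarrow> coact M m; scal (qeps H h) (ket m0)} = ket m"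
    using homog_counit[OF v] by (simp add: one)
  have eq: "w a g b * \<chi> a * \<chi> b = w a b g * w g a b * \<chi> (a \<otimes> b)" if "a \<in> carrier G" "b \<in> carrier G" for a b
    using mult[OF that] by (simp only: mult_ac)
  have coact: "coact M m = (\<Sum>l\<in>carrier G. scal (\<chi> l) (ket (l, m)))"
    using v by (simp add: yd_homogeneous_def vtensor_ket)
  show "Poly_Mapping.keys (coact M m) \<subseteq> carrier G \<times> UNIV"
    unfolding coact by (intro keys_sumI keys_scal_ket) auto
  show "do {m' \<leftarrow> act M h m; act M k m'} = do {x \<leftarrow> pm k h; act M x m}"
    if "k \<in> carrier G" "h \<in> carrier G" for k h
    using homog_act[OF v that(2), of "act M k"] v that by (auto simp: lbind_pm yd_homogeneous_def)
  show "do {(X1, X2, X3) \<leftarrow> qPhi H;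
          (h, m0) \<leftarrow> coact M m;
          m1 \<leftarrow> act M X2 m0;
          (l, m2) \<leftarrow> coact M m1;
          a \<leftarrow> pm X1 h;
          b \<leftarrow> pm l X3;
          ket (a, b, m2)} =
      do {(X1, X2, X3) \<leftarrow> qPhi H;
          (Y1, Y2, Y3) \<leftarrow> qPhi H;
          m1 \<leftarrow> act M Y1 m;
          (h, m0) \<leftarrow> coact M m1;
          (h1, h2) \<leftarrow> qDelta H h;
          a \<leftarrow> vmul pm (pm X1 h1) (ket Y2);
          b \<leftarrow> vmul pm (pm X2 h2) (ket Y3);
          m2 \<leftarrow> act M X3 m0;
          ket (a, b, m2)}"
    using homog_coassoc_left[OF v g] homog_coassoc_right[OF v g] unfolding lbind_ket
    by (simp add: eq)
  show "do {(h1, h2) \<leftarrow> qDelta H h;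
          (l, m0) \<leftarrow> coact M m;
          a \<leftarrow> pm h1 l;
          m1 \<leftarrow> act M h2 m0;
          ket (a, m1)} =
      do {(h1, h2) \<leftarrow> qDelta H h;
          m1 \<leftarrow> act M h1 m;
          (l, m0) \<leftarrow> coact M m1;
          a \<leftarrow> pm l h2;
          ket (a, m0)}" if h: "h \<in> carrier G" for h
  proof -
    have "h \<otimes> inv g = inv g \<otimes> h"
      using inv_commute_iff[OF g h] central h by simp
    then show ?thesis
      using homog_crossed_left[OF v g h] homog_crossed_right[OF v g h] unfolding lbind_ket by simp
  qed
qed

lemma yd_hom_homogD:
  assumes f: "yd_hom H M N f" and v: "homog M g \<chi> v"
  shows "homog N g \<chi> (lbind v f)"
  unfolding yd_homogeneous_def
proof (intro conjI ballI)
  fix h assume h: "h \<in> carrier G"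
  have "lbind (lbind v f) (act N h) = lbind v (\<lambda>m. lbind (act M h m) f)"
    using f h by (simp add: lbind_assoc yd_hom_def)
  then show "lbind (lbind v f) (act N h) = (if h = g then lbind v f else 0)"
    by (simp add: homog_act[OF v h])
next
  have "lbind (lbind v f) (coact N) = lbind v (\<lambda>m. lbind (coact M m) (\<lambda>(h, m0). lbind (f m0) (\<lambda>n0. ket (h, n0))))"
    using f by (simp add: lbind_assoc yd_hom_def)
  then show "lbind (lbind v f) (coact N) = (\<Sum>l\<in>carrier G. scal (\<chi> l) (ket l \<otimes>\<^sub>v lbind v f))"
    by (simp add: homog_coact[OF v] lbind_vtensor_ket[symmetric] lbind_assoc)
qed

lemma yd_homI:
  assumes "\<And>m. \<exists>g \<chi>. homog M g \<chi> (ket m) \<and> homog N g \<chi> (f m)"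
  shows "yd_hom H M N f"
  unfolding yd_hom_def qbasis_H
proof (intro conjI ballI allI)
  fix m
  obtain g \<chi> where m: "homog M g \<chi> (ket m)" and fm: "homog N g \<chi> (f m)" using assms by blast
  show "do {m1 \<leftarrow> act M h m; f m1} = do {n \<leftarrow> f m; act N h n}" if "h \<in> carrier G" for h
    using homog_act[OF m that, of f] fm that by (simp add: yd_homogeneous_def)
  show "do {n \<leftarrow> f m; coact N n} = do {(h, m0) \<leftarrow> coact M m; n0 \<leftarrow> f m0; ket (h, n0)}"
    using homog_coact[OF m, of "\<lambda>(h, m0). lbind (f m0) (\<lambda>n0. ket (h, n0))"] fm
    by (simp add: yd_homogeneous_def lbind_vtensor_ket)
qed

text \<open>The factors are those of the five maps in the definition of the interchange, in order; the middle
  one is the braiding of the two inner vectors.\<close>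

lemma homog_interchange:
  assumes v: "homog B g1 \<chi>1 v1" "homog B g2 \<chi>2 v2" "homog B g3 \<chi>3 v3" "homog B g4 \<chi>4 v4"
    and g: "g1 \<in> carrier G" "g2 \<in> carrier G" "g3 \<in> carrier G" "g4 \<in> carrier G"
  shows "lbind ((v1 \<otimes>\<^sub>v v2) \<otimes>\<^sub>v (v3 \<otimes>\<^sub>v v4)) (yd_interchange H B) =
    scal (w g1 g2 (g3 \<otimes> g4) * inverse (w g2 g3 g4) * \<chi>2 g3 * w g3 g2 g4 * inverse (w g1 g3 (g2 \<otimes> g4)))
      ((v1 \<otimes>\<^sub>v v3) \<otimes>\<^sub>v (v2 \<otimes>\<^sub>v v4))"
proof -
  note [simp] = homog_assoc(1)[OF v(1,2) homog_tensor[OF v(3,4) g(3,4)] g(1,2) m_closed[OF g(3,4)]]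
    homog_assoc(2)[OF v(2,3,4) g(2,3,4)]
    homog_braid[OF v(2,3) g(3)]
    homog_assoc(1)[OF v(3,2,4) g(3,2,4)]
    homog_assoc(2)[OF v(1,3) homog_tensor[OF v(2,4) g(2,4)] g(1,3) m_closed[OF g(2,4)]]
  show ?thesis
    unfolding yd_interchange_def by (simp add: lbind_lcomp lbind_ltensor mult_ac)
qed

end

section \<open>Exterior algebras on a homogeneous vector\<close>

context finite_group_cocycle
begin

text \<open>The exterior algebra on a vector of type \<open>(g, \<chi>)\<close>: \<open>ket False\<close> is the unit and \<open>ket True\<close> is a
  primitive generator of square zero.\<close>

definition exterior_hopf :: "'g \<Rightarrow> ('g \<Rightarrow> 'k) \<Rightarrow> ('g, bool, 'k) braided_hopf"
  where "exterior_hopf g \<chi> = \<lparr>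
    act = (\<lambda>h i. if h = (if i then g else \<one>) then ket i else 0),
    coact = (\<lambda>i. \<Sum>l\<in>carrier G. scal (if i then \<chi> l else 1) (ket (l, i))),
    bmul = (\<lambda>(i, j). if i \<and> j then 0 else ket (i \<or> j)),
    bone = (\<lambda>_. ket False),
    bDelta = (\<lambda>i. if i then ket (True, False) + ket (False, True) else ket (False, False)),
    beps = (\<lambda>i. if i then 0 else ket ()),
    bS = (\<lambda>i. if i then - ket True else ket False)\<rparr>"

lemma exterior_hopf_simps:
  "bmul (exterior_hopf g \<chi>) (i, j) = (if i \<and> j then 0 else ket (i \<or> j))"
  "bone (exterior_hopf g \<chi>) z = ket False"
  "bDelta (exterior_hopf g \<chi>) i = (if i then ket (True, False) + ket (False, True) else ket (False, False))"
  "beps (exterior_hopf g \<chi>) i = (if i then 0 else ket ())"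
  "bS (exterior_hopf g \<chi>) i = (if i then - ket True else ket False)"
  by (simp_all add: exterior_hopf_def)

lemma homog_exterior_hopf:
  "homog (exterior_hopf g \<chi>) (if i then g else \<one>) (\<lambda>l. if i then \<chi> l else 1) (ket i)"
  by (auto simp: yd_homogeneous_def exterior_hopf_def vtensor_ket)

lemma homog_group_hopf_C2: "homog (group_hopf_C2 H) \<one> (\<lambda>_. 1) v"
  by (auto simp: yd_homogeneous_def group_hopf_C2_def qeps_H lbind_scal_right lbind_qone lbind_vtensor_ket)

lemma quasi_character_one: "quasi_character G w \<one> (\<lambda>_. 1)"
  by (simp add: quasi_character_def)

text \<open>The Yetter--Drinfeld axioms hold by the choice of \<open>g\<close> and \<open>\<chi>\<close>. Of the Hopf algebra axioms only
  multiplicativity of the coproduct on the square of the generator has content: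
  the mixed terms of $\Delta(x)^2$ add up to $(1 + \chi(g))\, x \otimes x$, while $x^2 = 0$. In all other
  axioms the scalars contributed by the cocycle have an argument \<open>\<one>\<close> or multiply a zero product.\<close>

lemma braided_hopf_algebra_exterior_hopf:
  assumes g: "g \<in> carrier G" and central: "\<forall>h\<in>carrier G. g \<otimes> h = h \<otimes> g"
    and \<chi>: "quasi_character G w g \<chi>" and \<chi>g: "\<chi> g = -1"
  shows "braided_hopf_algebra H (exterior_hopf g \<chi>)"
proof -
  let ?B = "exterior_hopf g \<chi>"
  have one: "homog ?B \<one> (\<lambda>_. 1) (ket False)" and x: "homog ?B g \<chi> (ket True)"
    using homog_exterior_hopf[of g \<chi> False] homog_exterior_hopf[of g \<chi> True] by simp_all
  define d where "d i = (if i then g else \<one>)" for i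
  define \<psi> where "\<psi> i l = (if i then \<chi> l else 1)" for i l
  have d [simp]: "d i \<in> carrier G" for i using g by (simp add: d_def)
  have hom: "homog ?B (d i) (\<psi> i) (ket i)" for i
    unfolding d_def \<psi>_def[abs_def] by (rule homog_exterior_hopf)
  note hom2 = homog_tensor[OF hom hom d d, unfolded vtensor_ket]
  have hom_FF: "homog (yd_tensor H ?B ?B) \<one> (\<lambda>_. 1) (ket (False, False))"
    and hom_FT: "homog (yd_tensor H ?B ?B) g \<chi> (ket (False, True))"
    and hom_TF: "homog (yd_tensor H ?B ?B) g \<chi> (ket (True, False))"
    using hom2[of False False] hom2[of False True] hom2[of True False] g
    by (simp_all add: d_def \<psi>_def cong: homog_cong)
  have assoc: "yd_assoc H ?B ?B ?B ((i, j), k) = scal (w (d i) (d j) (d k)) (ket (i, j, k))" for i j k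
    using homog_assoc(1)[OF hom hom hom d d d, of i j k] by (simp add: vtensor_ket)
  have interchange: "yd_interchange H ?B ((i, j), (k, l)) = scal (w (d i) (d j) (d k \<otimes> d l) * inverse (w (d j) (d k) (d l)) *
     \<psi> j (d k) * w (d k) (d j) (d l) * inverse (w (d i) (d k) (d j \<otimes> d l))) (ket ((i, k), (j, l)))" for i j k l
    using homog_interchange[OF hom hom hom hom d d d d, of i j k l] by (simp add: vtensor_ket)
  have \<chi>1: "\<chi> \<one> = 1" using \<chi> by (simp add: quasi_character_def)
  note eval = exterior_hopf_simps fun_eq_iff[where 'a = bool] lcomp_apply ltensor_apply lbind_add lbind_uminus vtensor_ket vtensor_add
  show ?thesis
    unfolding braided_hopf_algebra_def
  proof (intro conjI)
    show "yd_module H ?B"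
    proof (rule yd_moduleI)
      fix i
      show "\<exists>h \<theta>. h \<in> carrier G \<and> (\<forall>k\<in>carrier G. h \<otimes> k = k \<otimes> h) \<and> quasi_character G w h \<theta> \<and> homog ?B h \<theta> (ket i)"
        using g central \<chi> quasi_character_one one x
          by (intro exI[of _ "if i then g else \<one>"] exI[of _ "if i then \<chi> else (\<lambda>_. 1)"]) simp
    qed
  next
    show "yd_hom H (yd_tensor H ?B ?B) ?B (bmul ?B)"
    proof (rule yd_homI)
      fix ij :: "bool \<times> bool"
      obtain i j where ij: "ij = (i, j)" by fastforce
      show "\<exists>h \<theta>. homog (yd_tensor H ?B ?B) h \<theta> (ket ij) \<and> homog ?B h \<theta> (bmul ?B ij)"
        using hom_FF hom_FT hom_TF hom2[of i j] one x unfolding ij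
        by (cases i; cases j) (auto simp: exterior_hopf_def)
    qed
  next
    show "yd_hom H (yd_unit H) ?B (bone ?B)"
      using homog_unit one by (intro yd_homI) (auto simp: exterior_hopf_def)
  next
    show "yd_hom H ?B (yd_tensor H ?B ?B) (bDelta ?B)"
    proof (rule yd_homI)
      fix i
      show "\<exists>h \<theta>. homog ?B h \<theta> (ket i) \<and> homog (yd_tensor H ?B ?B) h \<theta> (bDelta ?B i)"
        using hom_FF homog_add[OF hom_TF hom_FT] one x by (cases i) (auto simp: exterior_hopf_def)
    qed
  next
    show "yd_hom H ?B (yd_unit H) (beps ?B)"
    proof (rule yd_homI)
      fix i
      show "\<exists>h \<theta>. homog ?B h \<theta> (ket i) \<and> homog (yd_unit H) h \<theta> (beps ?B i)"
        using homog_unit one x by (cases i) (auto simp: exterior_hopf_def)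
    qed
  next
    show "yd_hom H ?B ?B (bS ?B)"
    proof (rule yd_homI)
      fix i
      show "\<exists>h \<theta>. homog ?B h \<theta> (ket i) \<and> homog ?B h \<theta> (bS ?B i)"
        using homog_scal[OF x, of "-1"] one x by (cases i) (auto simp: exterior_hopf_def scal_uminus)
    qed
  next
    show "bDelta ?B \<circ>\<^sub>l bmul ?B =
      (bmul ?B \<boxtimes> bmul ?B) \<circ>\<^sub>l yd_interchange H ?B \<circ>\<^sub>l (bDelta ?B \<boxtimes> bDelta ?B)"
    proof
      fix ij :: "bool \<times> bool"
      obtain i j where "ij = (i, j)" by fastforce
      then show "(bDelta ?B \<circ>\<^sub>l bmul ?B) ij =
          ((bmul ?B \<boxtimes> bmul ?B) \<circ>\<^sub>l yd_interchange H ?B \<circ>\<^sub>l (bDelta ?B \<boxtimes> bDelta ?B)) ij"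
        using g \<chi>g \<chi>1 by (cases i; cases j) (simp_all add: interchange eval d_def \<psi>_def scal_uminus)
    qed
  next
    show "bmul ?B \<circ>\<^sub>l (bmul ?B \<boxtimes> ket) = bmul ?B \<circ>\<^sub>l (ket \<boxtimes> bmul ?B) \<circ>\<^sub>l yd_assoc H ?B ?B ?B"
      using g by (auto simp: eval assoc d_def)
    show "bmul ?B \<circ>\<^sub>l (bone ?B \<boxtimes> ket) = (\<lambda>((), i). ket i)"
    proof
      fix z :: "unit \<times> bool"
      show "(bmul ?B \<circ>\<^sub>l (bone ?B \<boxtimes> ket)) z = (\<lambda>((), i). ket i) z"
        by (cases z) (simp add: eval case_unit_const)
    qed
    show "bmul ?B \<circ>\<^sub>l (ket \<boxtimes> bone ?B) = (\<lambda>(i, ()). ket i)"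
    proof
      fix z :: "bool \<times> unit"
      show "(bmul ?B \<circ>\<^sub>l (ket \<boxtimes> bone ?B)) z = (\<lambda>(i, ()). ket i) z"
        by (cases z) (simp add: eval case_unit_const)
    qed
    show "yd_assoc H ?B ?B ?B \<circ>\<^sub>l (bDelta ?B \<boxtimes> ket) \<circ>\<^sub>l bDelta ?B = (ket \<boxtimes> bDelta ?B) \<circ>\<^sub>l bDelta ?B"
      using g by (auto simp: eval assoc d_def)
    show "(beps ?B \<boxtimes> ket) \<circ>\<^sub>l bDelta ?B = (\<lambda>i. ket ((), i))" "(ket \<boxtimes> beps ?B) \<circ>\<^sub>l bDelta ?B = (\<lambda>i. ket (i, ()))"
      by (auto simp: eval)
    show "bDelta ?B \<circ>\<^sub>l bone ?B = (bone ?B \<boxtimes> bone ?B) \<circ>\<^sub>l (\<lambda>(). ket ((), ()))"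
      by (rule ext) (simp add: eval case_unit_const)
    show "beps ?B \<circ>\<^sub>l bmul ?B = (\<lambda>((), ()). ket ()) \<circ>\<^sub>l (beps ?B \<boxtimes> beps ?B)"
    proof
      fix z :: "bool \<times> bool"
      show "(beps ?B \<circ>\<^sub>l bmul ?B) z = ((\<lambda>((), ()). ket ()) \<circ>\<^sub>l (beps ?B \<boxtimes> beps ?B)) z"
        by (cases z) (simp add: eval case_unit_const)
    qed
    show "beps ?B \<circ>\<^sub>l bone ?B = ket"
      by (rule ext) (simp add: eval)
    show "bmul ?B \<circ>\<^sub>l (bS ?B \<boxtimes> ket) \<circ>\<^sub>l bDelta ?B = bone ?B \<circ>\<^sub>l beps ?B"
      "bmul ?B \<circ>\<^sub>l (ket \<boxtimes> bS ?B) \<circ>\<^sub>l bDelta ?B = bone ?B \<circ>\<^sub>l beps ?B"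
      by (auto simp: eval)
  qed
qed

text \<open>An isomorphism preserves types, and every vector of the group algebra has the trivial one.\<close>

lemma nontrivial_exterior_hopf:
  assumes g: "g \<in> carrier G" and \<chi>g: "\<chi> g = -1" and two: "(2 :: 'k) \<noteq> 0"
  shows "\<not> braided_hopf_iso H (exterior_hopf g \<chi>) (group_hopf_C2 H) f"
proof
  assume f: "braided_hopf_iso H (exterior_hopf g \<chi>) (group_hopf_C2 H) f"
  have x: "homog (exterior_hopf g \<chi>) g \<chi> (ket True)"
    using homog_exterior_hopf[of g \<chi> True] by simp
  have fx: "homog (group_hopf_C2 H) g \<chi> (f True)"
    using yd_hom_homogD[OF _ x, of _ f] f by (auto simp: braided_hopf_iso_def)
  obtain f' where "f' \<circ>\<^sub>l f = ket" using f by (auto simp: braided_hopf_iso_def)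
  then have "lbind (f True) f' = ket True" by (metis lcomp_apply)
  then have "f True \<noteq> 0" by auto
  from homog_unique(2)[OF fx homog_group_hopf_C2 this g _ g] have "\<chi> g = 1" by simp
  with \<chi>g two show False by (metis add.inverse_inverse eq_neg_iff_add_eq_0 one_add_one)
qed

end

section \<open>Structure of two-dimensional braided Hopf algebras\<close>

context finite_group_cocycle
begin

text \<open>The vector \<open>x\<close> spans the kernel of the counit. This kernel is a Yetter--Drinfeld submodule, hence
  \<open>x\<close> is homogeneous: the action of the orthogonal idempotents $P_h$ by scalars summing to one singles
  out one degree. The unit and counit axioms determine product and coproduct up to the constants \<open>b\<close> and \<open>c\<close>,
  and the antipode axiom on \<open>x\<close> gives the last equation, which serves to exclude $bc = -1$.\<close>

lemma two_dim_braided_hopf_structure: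
  fixes B :: "('g, bool, 'k) braided_hopf"
  assumes B: "braided_hopf_algebra H B"
  obtains u x Q g \<chi> b c s where
    "vector_basis (\<lambda>b. if b then x else u) Q"
    "g \<in> carrier G" "\<forall>h\<in>carrier G. g \<otimes> h = h \<otimes> g" "quasi_character G w g \<chi>"
    "homog B \<one> (\<lambda>_. 1) u" "homog B g \<chi> x"
    "lbind (u \<otimes>\<^sub>v u) (bmul B) = u" "lbind (u \<otimes>\<^sub>v x) (bmul B) = x"
    "lbind (x \<otimes>\<^sub>v u) (bmul B) = x" "lbind (x \<otimes>\<^sub>v x) (bmul B) = scal b x"
    "bone B () = u" "lbind u (bDelta B) = u \<otimes>\<^sub>v u"
    "lbind x (bDelta B) = x \<otimes>\<^sub>v u + u \<otimes>\<^sub>v x + scal c (x \<otimes>\<^sub>v x)"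
    "lbind u (beps B) = ket ()" "lbind x (beps B) = 0"
    "lbind u (bS B) = u" "lbind x (bS B) = scal s x" "s * (1 + b * c) = -1"
proof -
  note B = B[unfolded braided_hopf_algebra_def]
  define u where "u = bone B ()"
  have eps_u: "lbind u (beps B) = ket ()"
    using B unfolding u_def by (metis lcomp_apply)
  obtain x Q where basis: "vector_basis (\<lambda>b. if b then x else u) Q" and eps_x: "lbind x (beps B) = 0"
    by (rule exists_adapted_basis[OF eps_u])
  interpret vector_basis "\<lambda>b. if b then x else u" Q by fact
  have u0: "u \<noteq> 0" and x0: "x \<noteq> 0" using P_nonzero[of False] P_nonzero[of True] by simp_all
  have decomp: "\<exists>\<alpha> \<beta>. v = scal \<alpha> u + scal \<beta> x" for v
    using basis_expansion[of v] unfolding lbind_bool[of "lbind v Q"] by simp metis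
  have ker: "\<exists>\<beta>. v = scal \<beta> x" if "lbind v (beps B) = 0" for v
  proof -
    obtain \<alpha> \<beta> where v: "v = scal \<alpha> u + scal \<beta> x" using decomp by blast
    then have "scal \<alpha> (ket ()) = 0" using that by (simp add: lbind_add eps_u eps_x del: scal_eq_0_iff)
    then show ?thesis using v by auto
  qed
  have unit: "lbind (ket () \<otimes>\<^sub>v v) (\<lambda>((), i). ket i) = v" "lbind (v \<otimes>\<^sub>v ket ()) (\<lambda>(i, ()). ket i) = v"
    for v :: "bool \<Rightarrow>\<^sub>0 'k"
    by (simp_all only: lbind_vtensor lbind_ket prod.case old.unit.case lbind_ket_right)
  have mul_u: "lbind (u \<otimes>\<^sub>v v) (bmul B) = v" and mul_u': "lbind (v \<otimes>\<^sub>v u) (bmul B) = v" for v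
  proof -
    have "lbind (ket () \<otimes>\<^sub>v v) (bmul B \<circ>\<^sub>l (bone B \<boxtimes> ket)) = lbind (ket () \<otimes>\<^sub>v v) (\<lambda>((), i). ket i)"
      using B by simp
    then show "lbind (u \<otimes>\<^sub>v v) (bmul B) = v"
      by (simp only: lbind_lcomp lbind_ltensor u_def unit lbind_ket lbind_ket_right)
    have "lbind (v \<otimes>\<^sub>v ket ()) (bmul B \<circ>\<^sub>l (ket \<boxtimes> bone B)) = lbind (v \<otimes>\<^sub>v ket ()) (\<lambda>(i, ()). ket i)"
      using B by simp
    then show "lbind (v \<otimes>\<^sub>v u) (bmul B) = v"
      by (simp only: lbind_lcomp lbind_ltensor u_def unit lbind_ket lbind_ket_right)
  qed
  have "lbind (lbind (x \<otimes>\<^sub>v x) (bmul B)) (beps B) = lbind (x \<otimes>\<^sub>v x) ((\<lambda>((), ()). ket ()) \<circ>\<^sub>l (beps B \<boxtimes> beps B))"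
    using B unfolding lbind_lcomp[symmetric] by simp
  then obtain b where xx: "lbind (x \<otimes>\<^sub>v x) (bmul B) = scal b x"
    using ker by (auto simp: lbind_lcomp lbind_ltensor eps_x)
  have Delta_u: "lbind u (bDelta B) = u \<otimes>\<^sub>v u"
  proof -
    have "(bDelta B \<circ>\<^sub>l bone B) () = ((bone B \<boxtimes> bone B) \<circ>\<^sub>l (\<lambda>(). ket ((), ()))) ()"
      using B by simp
    then show ?thesis by (simp only: lcomp_apply old.unit.case lbind_ket ltensor_apply u_def)
  qed
  have counit: "lbind (lbind v (bDelta B)) (beps B \<boxtimes> ket) = ket () \<otimes>\<^sub>v v"
    "lbind (lbind v (bDelta B)) (ket \<boxtimes> beps B) = v \<otimes>\<^sub>v ket ()" for v
    using B unfolding lbind_lcomp[symmetric] by (simp_all add: vtensor_def)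
  obtain p q where Delta_pq: "lbind x (bDelta B) = p \<otimes>\<^sub>v u + q \<otimes>\<^sub>v x"
    by (rule adapted_basis_tensor[OF basis])
  have "p \<otimes>\<^sub>v ket () = x \<otimes>\<^sub>v ket ()"
    using counit(2)[of x] by (simp add: Delta_pq lbind_add lbind_ltensor eps_u eps_x)
  then have p: "p = x"
    using poly_mapping_eqI[of p x] lookup_vtensor[of _ "ket ()" _ "()"] by (metis lookup_ket mult_cancel_right1 mult.right_neutral)
  obtain \<alpha> c where q: "q = scal \<alpha> u + scal c x" using decomp by blast
  have "scal \<alpha> (ket () \<otimes>\<^sub>v x) = ket () \<otimes>\<^sub>v x"
    using counit(1)[of x] by (simp add: Delta_pq p q lbind_add vtensor_add lbind_ltensor eps_u eps_x)
  then have \<alpha>: "\<alpha> = 1"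
    using scal_left_imp_eq[of \<alpha> "ket () \<otimes>\<^sub>v x" 1] x0 by (simp add: vtensor_eq_0_iff)
  have Delta_x: "lbind x (bDelta B) = x \<otimes>\<^sub>v u + u \<otimes>\<^sub>v x + scal c (x \<otimes>\<^sub>v x)"
    by (simp add: Delta_pq p q \<alpha> vtensor_add add.assoc)
  have antipode: "lbind (lbind (lbind v (bDelta B)) (bS B \<boxtimes> ket)) (bmul B) = lbind (lbind v (beps B)) (bone B)" for v
  proof -
    have "lbind v (bmul B \<circ>\<^sub>l (bS B \<boxtimes> ket) \<circ>\<^sub>l bDelta B) = lbind v (bone B \<circ>\<^sub>l beps B)"
      using B by simp
    then show ?thesis by (simp only: lbind_lcomp)
  qed
  have S_u: "lbind u (bS B) = u"
    using antipode[of u] by (simp add: Delta_u lbind_ltensor mul_u' eps_u) (simp add: u_def)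
  obtain \<tau> s where S_x: "lbind x (bS B) = scal \<tau> u + scal s x" using decomp[of "lbind x (bS B)"] by blast
  have S: "scal \<tau> u + scal s x + x + scal c (scal \<tau> x + scal s (scal b x)) = 0"
    using antipode[of x]
    by (simp add: Delta_x lbind_add lbind_ltensor S_x S_u mul_u mul_u' xx eps_x vtensor_add scal_add mult.assoc)
  \<comment> \<open>Applying the counit to the antipode equation isolates the coefficient of \<open>u\<close>.\<close>
  have "scal \<tau> (ket ()) = 0"
    using arg_cong[OF S, of "\<lambda>v. lbind v (beps B)"] by (simp add: lbind_add eps_u eps_x scal_add del: scal_eq_0_iff)
  then have \<tau>: "\<tau> = 0" by simp
  have "scal (s * (1 + b * c)) x = scal (-1) x"
    using S by (simp add: \<tau> scal_add_left scal_uminus algebra_simps eq_neg_iff_add_eq_0)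
  then have s: "s * (1 + b * c) = -1" by (rule scal_left_imp_eq) (rule x0)
  have hom_u: "homog B \<one> (\<lambda>_. 1) u"
    using yd_hom_homogD[OF _ homog_unit, of B "bone B" "ket ()"] B by (simp add: u_def)
  have M: "yd_module H B" using B by simp
  note M' = M[unfolded yd_module_def function_qmul qbasis_H]
  have "\<exists>d. lbind x (act B h) = scal d x" if h: "h \<in> carrier G" for h
  proof (rule ker)
    have "lbind (lbind x (act B h)) (beps B) = lbind (lbind x (beps B)) (act (yd_unit H) h)"
      using B h unfolding yd_hom_def by (simp add: lbind_assoc)
    then show "lbind (lbind x (act B h)) (beps B) = 0" by (simp add: eps_x)
  qed
  then obtain d where d: "\<And>h. h \<in> carrier G \<Longrightarrow> lbind x (act B h) = scal (d h) x" by metis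
  have dd: "d h * d k = (if k = h then d h else 0)" if hk: "h \<in> carrier G" "k \<in> carrier G" for h k
  proof -
    have "lbind (lbind x (act B h)) (act B k) = lbind x (\<lambda>m. lbind (pm k h) (\<lambda>y. act B y m))"
      using M' hk by (simp add: lbind_assoc)
    then have "scal (d h * d k) x = scal (if k = h then d h else 0) x"
      using hk by (auto simp: d lbind_pm split: if_splits)
    then show ?thesis by (rule scal_left_imp_eq) (rule x0)
  qed
  have "lbind x (\<lambda>m. lbind (qone H) (\<lambda>h. act B h m)) = x"
    using M' by simp
  then have "(\<Sum>h\<in>carrier G. scal (d h) x) = x"
    by (simp add: lbind_qone d)
  moreover have "(\<Sum>h\<in>carrier G. scal (d h) x) = 0" if "\<forall>h\<in>carrier G. d h = 0"
    using that by (intro sum.neutral) simp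
  ultimately have "\<not> (\<forall>h\<in>carrier G. d h = 0)" using x0 by metis
  then obtain g where g: "g \<in> carrier G" "d g \<noteq> 0" by blast
  have dg: "d g = 1" using dd[OF g(1) g(1)] g(2) by simp
  have "d h = (if h = g then 1 else 0)" if "h \<in> carrier G" for h
    using dd[OF that g(1)] dg by (cases "h = g") simp_all
  then have act_x: "lbind x (act B h) = (if h = g then x else 0)" if "h \<in> carrier G" for h
    using d[OF that] that by simp
  obtain p q where coact_pq: "lbind x (coact B) = p \<otimes>\<^sub>v u + q \<otimes>\<^sub>v x"
    by (rule adapted_basis_tensor[OF basis])
  have "lbind (lbind x (coact B)) (ket \<boxtimes> beps B) = lbind (lbind x (beps B)) (coact (yd_unit H))"
    using B unfolding yd_hom_def by (simp add: lbind_assoc ltensor_def)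
  then have "p \<otimes>\<^sub>v ket () = 0"
    by (simp add: eps_x coact_pq lbind_add lbind_ltensor eps_u)
  then have p: "p = 0" by (simp add: vtensor_eq_0_iff)
  define \<chi> where "\<chi> = lookup q"
  obtain i where i: "lookup x i \<noteq> 0" using x0 by (metis poly_mapping_eqI lookup_zero)
  have keys_coact: "Poly_Mapping.keys (coact B j) \<subseteq> carrier G \<times> UNIV" for j
    using M' by simp
  have "Poly_Mapping.keys q \<subseteq> carrier G"
  proof
    fix l assume "l \<in> Poly_Mapping.keys q"
    then have "lookup (lbind x (coact B)) (l, i) \<noteq> 0"
      using i by (simp add: coact_pq p lookup_vtensor in_keys_iff)
    then have "lookup (coact B False) (l, i) \<noteq> 0 \<or> lookup (coact B True) (l, i) \<noteq> 0"
      by (auto simp: lbind_bool lookup_add)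
    then show "l \<in> carrier G" using keys_coact[of False] keys_coact[of True] by (auto simp: in_keys_iff)
  qed
  then have "q = (\<Sum>l\<in>carrier G. scal (\<chi> l) (ket l))"
    by (subst vector_eq_sum_ket[of q], unfold \<chi>_def, intro sum.mono_neutral_left) (auto simp: fin in_keys_iff)
  then have "lbind x (coact B) = (\<Sum>l\<in>carrier G. scal (\<chi> l) (ket l \<otimes>\<^sub>v x))"
    by (simp add: coact_pq p) (simp add: vtensor_def)
  then have hom_x: "homog B g \<chi> x"
    using act_x by (simp add: yd_homogeneous_def)
  have central: "\<forall>h\<in>carrier G. g \<otimes> h = h \<otimes> g"
    using yd_module_homogD(2)[OF M hom_x x0 g(1)] by blast
  have S_x': "lbind x (bS B) = scal s x" by (simp add: S_x \<tau>)
  show ?thesis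
    by (rule that[of x u Q g \<chi> b c s, OF basis g(1) central yd_module_homogD(1)[OF M hom_x x0 g(1)] hom_u hom_x mul_u mul_u mul_u' xx
      u_def[symmetric] Delta_u Delta_x eps_u eps_x S_u S_x' s])
qed

text \<open>Comparing both sides of the multiplicativity of the coproduct on $x \otimes x$: the left one
  vanishes, and on the right only the summand in which $u \otimes x$ meets $x \otimes u$ involves a
  braiding of \<open>x\<close> with itself.\<close>

lemma square_zero_imp_minus_one:
  fixes B :: "('g, bool, 'k) braided_hopf"
  assumes B: "braided_hopf_algebra H B"
    and u: "homog B \<one> (\<lambda>_. 1) u" and x: "homog B g \<chi> x" and g: "g \<in> carrier G"
    and mul: "lbind (u \<otimes>\<^sub>v x) (bmul B) = x" "lbind (x \<otimes>\<^sub>v u) (bmul B) = x" "lbind (x \<otimes>\<^sub>v x) (bmul B) = 0"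
    and Delta: "lbind x (bDelta B) = x \<otimes>\<^sub>v u + u \<otimes>\<^sub>v x"
    and \<chi>1: "\<chi> \<one> = 1" and x0: "x \<noteq> 0"
  shows "\<chi> g = -1"
proof -
  have inter: "lbind ((x \<otimes>\<^sub>v u) \<otimes>\<^sub>v (x \<otimes>\<^sub>v u)) (yd_interchange H B) = (x \<otimes>\<^sub>v x) \<otimes>\<^sub>v (u \<otimes>\<^sub>v u)"
    "lbind ((x \<otimes>\<^sub>v u) \<otimes>\<^sub>v (u \<otimes>\<^sub>v x)) (yd_interchange H B) = (x \<otimes>\<^sub>v u) \<otimes>\<^sub>v (u \<otimes>\<^sub>v x)"
    "lbind ((u \<otimes>\<^sub>v x) \<otimes>\<^sub>v (x \<otimes>\<^sub>v u)) (yd_interchange H B) = scal (\<chi> g) ((u \<otimes>\<^sub>v x) \<otimes>\<^sub>v (x \<otimes>\<^sub>v u))"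
    "lbind ((u \<otimes>\<^sub>v x) \<otimes>\<^sub>v (u \<otimes>\<^sub>v x)) (yd_interchange H B) = (u \<otimes>\<^sub>v u) \<otimes>\<^sub>v (x \<otimes>\<^sub>v x)"
    using homog_interchange[OF x u x u] homog_interchange[OF x u u x]
      homog_interchange[OF u x x u] homog_interchange[OF u x u x] g
    by (simp_all add: \<chi>1)
  have "lbind (x \<otimes>\<^sub>v x) (bDelta B \<circ>\<^sub>l bmul B) =
      lbind (x \<otimes>\<^sub>v x) ((bmul B \<boxtimes> bmul B) \<circ>\<^sub>l yd_interchange H B \<circ>\<^sub>l (bDelta B \<boxtimes> bDelta B))"
    using B by (simp add: braided_hopf_algebra_def)
  then have "scal (\<chi> g) (x \<otimes>\<^sub>v x) + x \<otimes>\<^sub>v x = 0"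
    by (simp add: lbind_lcomp lbind_ltensor mul Delta vtensor_add lbind_add inter)
  then have "scal (\<chi> g) (x \<otimes>\<^sub>v x) = scal (-1) (x \<otimes>\<^sub>v x)"
    by (simp add: scal_uminus eq_neg_iff_add_eq_0)
  then show ?thesis
    by (rule scal_left_imp_eq) (simp add: vtensor_eq_0_iff x0)
qed

text \<open>If \<open>x\<close> and $x \otimes x$ are of the same type then $g^2 = g$, so $g = e$; the cocycle then disappears and
  $\chi^2 = \chi$. The two alternatives are those that occur: the coproduct maps \<open>x\<close> to a multiple
  of $x \otimes x$ modulo vectors of the type of \<open>x\<close>, or the product maps $x \otimes x$ to a multiple of \<open>x\<close>.\<close>

lemma homog_trivial_of_square:
  assumes x: "homog M g \<chi> x" and g: "g \<in> carrier G" and \<chi>: "quasi_character G w g \<chi>" and x0: "x \<noteq> 0"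
    and xx: "homog (yd_tensor H M M) g \<chi> (x \<otimes>\<^sub>v x) \<or> homog M (g \<otimes> g) (\<lambda>l. w l g g * inverse (w g l g) * w g g l * (\<chi> l * \<chi> l)) x"
  shows "homog M \<one> (\<lambda>_. 1) x"
proof -
  have gg: "g \<otimes> g = g \<and> (\<forall>l\<in>carrier G. w l g g * inverse (w g l g) * w g g l * (\<chi> l * \<chi> l) = \<chi> l)"
    using xx
  proof
    assume "homog (yd_tensor H M M) g \<chi> (x \<otimes>\<^sub>v x)"
    from homog_unique[OF homog_tensor[OF x x g g] this] show ?thesis
      using g x0 by (auto simp: vtensor_eq_0_iff)
  next
    assume "homog M (g \<otimes> g) (\<lambda>l. w l g g * inverse (w g l g) * w g g l * (\<chi> l * \<chi> l)) x"
    from homog_unique[OF this x x0] show ?thesis using g by auto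
  qed
  then have g1: "g = \<one>" using g by simp
  have "\<chi> l = 1" if l: "l \<in> carrier G" for l
    using gg l quasi_character_nonzero[OF \<chi> g l] by (auto simp: g1)
  then show ?thesis using x by (simp add: g1 cong: homog_cong)
qed

lemma interchange_trivial:
  assumes "homog B \<one> (\<lambda>_. 1) v1" "homog B \<one> (\<lambda>_. 1) v2" "homog B \<one> (\<lambda>_. 1) v3" "homog B \<one> (\<lambda>_. 1) v4"
  shows "lbind ((v1 \<otimes>\<^sub>v v2) \<otimes>\<^sub>v (v3 \<otimes>\<^sub>v v4)) (yd_interchange H B) = (v1 \<otimes>\<^sub>v v3) \<otimes>\<^sub>v (v2 \<otimes>\<^sub>v v4)"
  using homog_interchange[OF assms] by simp

text \<open>Comparing coefficients of $x \otimes x$ in $\Delta(x)^2 = b\,\Delta(x)$ gives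
  $bc = 2 + 4bc + (bc)^2$.\<close>

lemma structure_constants_trivial:
  fixes B :: "('g, bool, 'k) braided_hopf"
  assumes B: "braided_hopf_algebra H B"
    and u: "homog B \<one> (\<lambda>_. 1) u" and x: "homog B \<one> (\<lambda>_. 1) x"
    and mul: "lbind (u \<otimes>\<^sub>v u) (bmul B) = u" "lbind (u \<otimes>\<^sub>v x) (bmul B) = x" "lbind (x \<otimes>\<^sub>v u) (bmul B) = x" "lbind (x \<otimes>\<^sub>v x) (bmul B) = scal b x"
    and Delta: "lbind x (bDelta B) = x \<otimes>\<^sub>v u + u \<otimes>\<^sub>v x + scal c (x \<otimes>\<^sub>v x)"
    and x0: "x \<noteq> 0"
  shows "(b * c + 1) * (b * c + 2) = 0"
proof -
  note inter = interchange_trivial[OF x u x u] interchange_trivial[OF x u u x] interchange_trivial[OF x u x x]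
    interchange_trivial[OF u x x u] interchange_trivial[OF u x u x] interchange_trivial[OF u x x x]
    interchange_trivial[OF x x x u] interchange_trivial[OF x x u x] interchange_trivial[OF x x x x]
  have "lbind (x \<otimes>\<^sub>v x) (bDelta B \<circ>\<^sub>l bmul B) =
      lbind (x \<otimes>\<^sub>v x) ((bmul B \<boxtimes> bmul B) \<circ>\<^sub>l yd_interchange H B \<circ>\<^sub>l (bDelta B \<boxtimes> bDelta B))"
    using B by (simp add: braided_hopf_algebra_def)
  moreover have "lbind (x \<otimes>\<^sub>v x) (bDelta B \<circ>\<^sub>l bmul B) = scal b (x \<otimes>\<^sub>v u + u \<otimes>\<^sub>v x + scal c (x \<otimes>\<^sub>v x))"
    by (simp add: lbind_lcomp mul Delta)
  moreover have "lbind (x \<otimes>\<^sub>v x) ((bmul B \<boxtimes> bmul B) \<circ>\<^sub>l yd_interchange H B \<circ>\<^sub>l (bDelta B \<boxtimes> bDelta B)) =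
     scal b (x \<otimes>\<^sub>v u) + scal b (u \<otimes>\<^sub>v x) + scal (2 + 4 * (b * c) + (b * c) * (b * c)) (x \<otimes>\<^sub>v x)"
    unfolding lbind_lcomp lbind_ltensor Delta
    by (simp add: lbind_ltensor mul vtensor_add lbind_add inter)
       (rule poly_mapping_eqI, simp add: lookup_add algebra_simps)
  ultimately have eq: "scal b (x \<otimes>\<^sub>v u + u \<otimes>\<^sub>v x + scal c (x \<otimes>\<^sub>v x)) =
     scal b (x \<otimes>\<^sub>v u) + scal b (u \<otimes>\<^sub>v x) + scal (2 + 4 * (b * c) + (b * c) * (b * c)) (x \<otimes>\<^sub>v x)"
    by simp
  have "scal (b * c) (x \<otimes>\<^sub>v x) = scal (2 + 4 * (b * c) + (b * c) * (b * c)) (x \<otimes>\<^sub>v x)"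
    using eq by (simp add: scal_add)
  then have "b * c = 2 + 4 * (b * c) + (b * c) * (b * c)"
    by (rule scal_left_imp_eq) (simp add: vtensor_eq_0_iff x0)
  then show ?thesis by (simp add: algebra_simps)
qed

text \<open>The vector $u + cx$ is group-like, and $bc = -2$ makes it an involution; the isomorphism sends it to
  the generator of $C_2$. Since all vectors on both sides are of the trivial type, any linear map is
  a morphism of Yetter--Drinfeld modules.\<close>

lemma iso_group_hopf_C2_of_trivial:
  fixes B :: "('g, bool, 'k) braided_hopf"
  assumes basis: "vector_basis (\<lambda>b. if b then x else u) Q"
    and u: "homog B \<one> (\<lambda>_. 1) u" and x: "homog B \<one> (\<lambda>_. 1) x"
    and mul: "lbind (u \<otimes>\<^sub>v u) (bmul B) = u" "lbind (u \<otimes>\<^sub>v x) (bmul B) = x"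
      "lbind (x \<otimes>\<^sub>v u) (bmul B) = x" "lbind (x \<otimes>\<^sub>v x) (bmul B) = scal b x"
    and one: "bone B () = u"
    and Delta: "lbind u (bDelta B) = u \<otimes>\<^sub>v u"
      "lbind x (bDelta B) = x \<otimes>\<^sub>v u + u \<otimes>\<^sub>v x + scal c (x \<otimes>\<^sub>v x)"
    and eps: "lbind u (beps B) = ket ()" "lbind x (beps B) = 0"
    and S: "lbind u (bS B) = u" "lbind x (bS B) = x"
    and bc: "b * c = -2" and two: "(2 :: 'k) \<noteq> 0"
  shows "\<exists>f. braided_hopf_iso H B (group_hopf_C2 H) f"
proof -
  interpret vector_basis "\<lambda>b. if b then x else u" Q by fact
  have c0: "c \<noteq> 0" using bc two by auto
  moreover have "b = b * c * inverse c" using c0 by simp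
  ultimately have c: "c \<noteq> 0" "b = - 2 * inverse c" unfolding bc by simp_all
  define r where "r = inverse c"
  define K :: "bool \<Rightarrow> (bool \<Rightarrow>\<^sub>0 'k)"
    where "K a = (if a then scal r (ket True) + scal (- r) (ket False) else ket False)" for a
  define f where "f i = lbind (Q i) K" for i
  define f' where "f' a = (if a then u + scal c x else u)" for a
  let ?C = "group_hopf_C2 H :: ('g, bool, 'k) braided_hopf"
  have f: "lbind (if a then x else u) f = K a" for a
    unfolding f_def lbind_assoc[symmetric] lbind_P_Q by simp
  have fu: "lbind u f = ket False" and fx: "lbind x f = scal r (ket True) + scal (- r) (ket False)"
    using f[of False] f[of True] by (simp_all add: K_def)
  have C: "bmul ?C (i, j) = ket (i \<noteq> j)" "bone ?C z = ket False" "bDelta ?C i = ket (i, i)" "beps ?C i = ket ()"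
    "bS ?C i = ket i" for i j z
    by (simp_all add: group_hopf_C2_def)
  have "homog B \<one> (\<lambda>_. 1) v" for v
    using homog_add[OF homog_scal[OF u, of "lookup (lbind v Q) False"] homog_scal[OF x, of "lookup (lbind v Q) True"]]
      basis_expansion[of v] unfolding lbind_bool[of "lbind v Q"] by simp
  then have "yd_hom H B ?C f"
    using homog_group_hopf_C2 by (intro yd_homI) blast
  moreover have "f' \<circ>\<^sub>l f = ket"
  proof (rule ext_basis)
    show "lbind (if a then x else u) (f' \<circ>\<^sub>l f) = lbind (if a then x else u) ket" for a
      using c(1) by (cases a) (simp_all add: lbind_lcomp fu fx lbind_add lbind_diff f'_def scal_add scal_diff scal_uminus r_def)
  qed
  moreover have "f \<circ>\<^sub>l f' = ket"
  proof
    show "(f \<circ>\<^sub>l f') a = ket a" for a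
      using c(1) by (cases a) (simp_all add: lcomp_apply fu fx lbind_add lbind_diff f'_def scal_add scal_diff scal_uminus r_def)
  qed
  moreover have "f \<circ>\<^sub>l bmul B = bmul ?C \<circ>\<^sub>l (f \<boxtimes> f)"
  proof (rule ext_basis_pair)
    show "lbind ((if a then x else u) \<otimes>\<^sub>v (if a' then x else u)) (f \<circ>\<^sub>l bmul B) =
      lbind ((if a then x else u) \<otimes>\<^sub>v (if a' then x else u)) (bmul ?C \<circ>\<^sub>l (f \<boxtimes> f))" for a a'
      unfolding lbind_lcomp lbind_ltensor f
      by (rule poly_mapping_eqI, cases a; cases a')
        (simp_all add: K_def mul fu fx lbind_add vtensor_add vtensor_ket C lookup_add lookup_ket c(2) r_def[symmetric])
  qed
  moreover have "f \<circ>\<^sub>l bone B = bone ?C"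
    by (rule ext) (simp add: lcomp_apply one fu C)
  moreover have "bDelta ?C \<circ>\<^sub>l f = (f \<boxtimes> f) \<circ>\<^sub>l bDelta B"
  proof (rule ext_basis)
    show "lbind (if a then x else u) (bDelta ?C \<circ>\<^sub>l f) = lbind (if a then x else u) ((f \<boxtimes> f) \<circ>\<^sub>l bDelta B)" for a
      unfolding lbind_lcomp f
      by (rule poly_mapping_eqI, cases a) (use c(1) in \<open>simp_all add: K_def Delta fu fx lbind_ltensor lbind_add
        vtensor_add vtensor_ket C lookup_add lookup_ket r_def\<close>)
  qed
  moreover have "beps ?C \<circ>\<^sub>l f = beps B"
  proof (rule ext_basis)
    show "lbind (if a then x else u) (beps ?C \<circ>\<^sub>l f) = lbind (if a then x else u) (beps B)" for a
      unfolding lbind_lcomp f by (cases a) (simp_all add: K_def eps C lbind_add lbind_diff scal_uminus)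
  qed
  moreover have "f \<circ>\<^sub>l bS B = bS ?C \<circ>\<^sub>l f"
  proof (rule ext_basis)
    have "bS ?C = ket" by (simp add: fun_eq_iff C)
    then show "lbind (if a then x else u) (f \<circ>\<^sub>l bS B) = lbind (if a then x else u) (bS ?C \<circ>\<^sub>l f)" for a
      unfolding lbind_lcomp f by (cases a) (simp_all add: K_def S fu fx)
  qed
  ultimately show ?thesis
    unfolding braided_hopf_iso_def by blast
qed

text \<open>The classification for an arbitrary finite group and cocycle: away from the exterior case the type
  of the generator is trivial, and the algebra is then $k[C_2]$.\<close>

theorem nontrivial_two_dim_braided_hopf_iff:
  assumes two: "(2 :: 'k) \<noteq> 0"
  shows "(\<exists>B :: ('g, bool, 'k) braided_hopf. nontrivial_two_dim_braided_hopf H B) \<longleftrightarrow>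
    (\<exists>g\<in>carrier G. \<exists>\<chi>. (\<forall>h\<in>carrier G. g \<otimes> h = h \<otimes> g) \<and> quasi_character G w g \<chi> \<and> \<chi> g = -1)"
proof
  assume "\<exists>B :: ('g, bool, 'k) braided_hopf. nontrivial_two_dim_braided_hopf H B"
  then obtain B :: "('g, bool, 'k) braided_hopf"
    where B: "braided_hopf_algebra H B" and niso: "\<nexists>f. braided_hopf_iso H B (group_hopf_C2 H) f"
    by (auto simp: nontrivial_two_dim_braided_hopf_def)
  obtain u x Q g \<chi> b c s where basis: "vector_basis (\<lambda>b. if b then x else u) Q"
    and g: "g \<in> carrier G" and central: "\<forall>h\<in>carrier G. g \<otimes> h = h \<otimes> g"
    and \<chi>: "quasi_character G w g \<chi>"
    and hom_u: "homog B \<one> (\<lambda>_. 1) u" and hom_x: "homog B g \<chi> x"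
    and mul: "lbind (u \<otimes>\<^sub>v u) (bmul B) = u" "lbind (u \<otimes>\<^sub>v x) (bmul B) = x"
      "lbind (x \<otimes>\<^sub>v u) (bmul B) = x" "lbind (x \<otimes>\<^sub>v x) (bmul B) = scal b x"
    and one: "bone B () = u" and Delta_u: "lbind u (bDelta B) = u \<otimes>\<^sub>v u"
    and Delta_x: "lbind x (bDelta B) = x \<otimes>\<^sub>v u + u \<otimes>\<^sub>v x + scal c (x \<otimes>\<^sub>v x)"
    and eps: "lbind u (beps B) = ket ()" "lbind x (beps B) = 0"
    and S_u: "lbind u (bS B) = u" and S_x: "lbind x (bS B) = scal s x" and s: "s * (1 + b * c) = -1"
    by (rule two_dim_braided_hopf_structure[OF B])
  interpret vector_basis "\<lambda>b. if b then x else u" Q by fact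
  have x0: "x \<noteq> 0" using P_nonzero[of True] by simp
  have hom: "yd_hom H (yd_tensor H B B) B (bmul B)" "yd_hom H B (yd_tensor H B B) (bDelta B)"
    using B by (simp_all add: braided_hopf_algebra_def)
  have "b = 0 \<and> c = 0"
  proof (rule ccontr)
    assume bc: "\<not> (b = 0 \<and> c = 0)"
    have "homog (yd_tensor H B B) g \<chi> (x \<otimes>\<^sub>v x) \<or>
      homog B (g \<otimes> g) (\<lambda>l. w l g g * inverse (w g l g) * w g g l * (\<chi> l * \<chi> l)) x"
    proof (cases "b = 0")
      case False
      have "homog B (g \<otimes> g) (\<lambda>l. w l g g * inverse (w g l g) * w g g l * (\<chi> l * \<chi> l)) (scal b x)"
        using yd_hom_homogD[OF hom(1) homog_tensor[OF hom_x hom_x g g]] by (simp add: mul(4))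
      from homog_scal[OF this, of "inverse b"] False show ?thesis by simp
    next
      case True
      with bc have c: "c \<noteq> 0" by simp
      \<comment> \<open>Subtracting the primitive part of the coproduct leaves a multiple of $x \otimes x$.\<close>
      have xu: "homog (yd_tensor H B B) g \<chi> (x \<otimes>\<^sub>v u)" and ux: "homog (yd_tensor H B B) g \<chi> (u \<otimes>\<^sub>v x)"
        using homog_tensor[OF hom_x hom_u g one_closed] homog_tensor[OF hom_u hom_x one_closed g] g
        by (simp_all cong: homog_cong)
      have "homog (yd_tensor H B B) g \<chi> (x \<otimes>\<^sub>v u + u \<otimes>\<^sub>v x + scal c (x \<otimes>\<^sub>v x))"
        using yd_hom_homogD[OF hom(2) hom_x] by (simp add: Delta_x)
      from homog_add[OF this homog_scal[OF homog_add[OF xu ux], of "-1"]]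
      have "homog (yd_tensor H B B) g \<chi> (scal c (x \<otimes>\<^sub>v x))"
        by (simp add: scal_uminus)
      from homog_scal[OF this, of "inverse c"] c show ?thesis by simp
    qed
    then have x: "homog B \<one> (\<lambda>_. 1) x" by (rule homog_trivial_of_square[OF hom_x g \<chi> x0])
    have "(b * c + 1) * (b * c + 2) = 0"
      by (rule structure_constants_trivial[OF B hom_u x mul Delta_x x0])
    moreover have "b * c + 1 \<noteq> 0" using s by (auto simp: add.commute)
    ultimately have bc2: "b * c = -2" by (simp add: eq_neg_iff_add_eq_0)
    then have "s = 1" using s by simp
    then have "lbind x (bS B) = x" using S_x by simp
    from iso_group_hopf_C2_of_trivial[OF basis hom_u x mul one Delta_u Delta_x eps S_u this bc2 two] niso show False by blast
  qed
  then have "lbind (x \<otimes>\<^sub>v x) (bmul B) = 0" "lbind x (bDelta B) = x \<otimes>\<^sub>v u + u \<otimes>\<^sub>v x"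
    using mul(4) Delta_x by simp_all
  moreover have "\<chi> \<one> = 1" using \<chi> by (simp add: quasi_character_def)
  ultimately have "\<chi> g = -1"
    by (rule square_zero_imp_minus_one[OF B hom_u hom_x g mul(2,3) _ _ _ x0])
  then show "\<exists>g\<in>carrier G. \<exists>\<chi>. (\<forall>h\<in>carrier G. g \<otimes> h = h \<otimes> g) \<and> quasi_character G w g \<chi> \<and> \<chi> g = -1"
    using g central \<chi> by blast
next
  assume "\<exists>g\<in>carrier G. \<exists>\<chi>. (\<forall>h\<in>carrier G. g \<otimes> h = h \<otimes> g) \<and> quasi_character G w g \<chi> \<and> \<chi> g = -1"
  then obtain g \<chi> where g: "g \<in> carrier G" "\<forall>h\<in>carrier G. g \<otimes> h = h \<otimes> g" "quasi_character G w g \<chi>"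
    and \<chi>g: "\<chi> g = -1"
    by blast
  have "nontrivial_two_dim_braided_hopf H (exterior_hopf g \<chi>)"
    unfolding nontrivial_two_dim_braided_hopf_def
    using braided_hopf_algebra_exterior_hopf[of g \<chi>, OF g \<chi>g]
      nontrivial_exterior_hopf[of g \<chi>, OF g(1) \<chi>g two] by blast
  then show "\<exists>B :: ('g, bool, 'k) braided_hopf. nontrivial_two_dim_braided_hopf H B" by (rule exI)
qed

end

section \<open>The double dihedral group\<close>

lemma dd_red_eq_iff:
  assumes "n \<ge> 1"
  shows "dd_red n x = dd_red n y \<longleftrightarrow> 2 * int n dvd x - y"
proof
  assume "dd_red n x = dd_red n y"
  then show "2 * int n dvd x - y"
    using dvd_diff[OF dd_red_dvd[OF assms, of y] dd_red_dvd[OF assms, of x]] by simp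
qed (rule dd_red_cong)

text \<open>Commuting with $R$ excludes the elements $X R^a$, where \<open>n \<ge> 2\<close> matters, and commuting with $X$
  forces $R^{2a} = e$.\<close>

lemma central_double_dihedral_iff:
  assumes n: "n \<ge> 2" and g: "g \<in> carrier (double_dihedral n)"
  shows "(\<forall>h\<in>carrier (double_dihedral n). g \<otimes>\<^bsub>double_dihedral n\<^esub> h = h \<otimes>\<^bsub>double_dihedral n\<^esub> g) \<longleftrightarrow>
    g = (0, 0) \<or> g = (0, int n)"
proof
  assume central: "\<forall>h\<in>carrier (double_dihedral n). g \<otimes>\<^bsub>double_dihedral n\<^esub> h = h \<otimes>\<^bsub>double_dihedral n\<^esub> g"
  obtain A a where ga: "g = (A, a)" by fastforce
  have n1: "n \<ge> 1" using n by simp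
  have RX: "(0, 1) \<in> carrier (double_dihedral n)" "(1, 0) \<in> carrier (double_dihedral n)"
    using n by (auto simp: dd_carrier)
  have "dd_red n (a + 1) = dd_red n ((-1) ^ A + a)"
    using bspec[OF central RX(1)] by (simp add: ga dd_mult)
  then have "2 * int n dvd 1 - (-1) ^ A" by (simp add: dd_red_eq_iff[OF n1])
  moreover have "\<not> 2 * int n dvd 2"
    using n zdvd_imp_le[of "2 * int n" 2] by auto
  ultimately have A: "A = 0" using g by (auto simp: ga dd_carrier)
  have "dd_red n (- a) = dd_red n a"
    using bspec[OF central RX(2)] by (simp add: ga dd_mult A)
  then have "2 * int n dvd 2 * (- a)" by (simp add: dd_red_eq_iff[OF n1])
  then have "int n dvd a" by simp
  then obtain k where k: "a = int n * k" by (rule dvdE)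
  have "int n * (- 1) < int n * k" "int n * k \<le> int n * 1"
    using g by (auto simp: ga dd_carrier k)
  then have "-1 < k" "k \<le> 1"
    using n by (simp_all only: mult_less_cancel_left_pos mult_le_cancel_left_pos)
  then have "k = 0 \<or> k = 1" by auto
  then show "g = (0, 0) \<or> g = (0, int n)" by (auto simp: ga A k)
next
  assume "g = (0, 0) \<or> g = (0, int n)"
  moreover have "dd_red n (b - int n) = dd_red n (int n + b)" for b
    by (rule dd_red_cong) simp
  ultimately show "\<forall>h\<in>carrier (double_dihedral n). g \<otimes>\<^bsub>double_dihedral n\<^esub> h = h \<otimes>\<^bsub>double_dihedral n\<^esub> g"
    by (auto simp: dd_carrier dd_mult add.commute)
qed

lemma primitive_root_half:
  fixes \<xi> :: "'k::field"
  assumes "primitive_root_of_unity (2 * N) \<xi>"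
  shows "\<xi> ^ N = -1"
proof -
  have "(\<xi> ^ N) ^ 2 = 1" "\<xi> ^ N \<noteq> 1"
    using assms by (auto simp: primitive_root_of_unity_def power_mult[symmetric] mult.commute)
  then show ?thesis by (simp add: power2_eq_1_iff)
qed

lemma primitive_root_nonzero: "primitive_root_of_unity N \<xi> \<Longrightarrow> \<xi> \<noteq> 0"
  by (auto simp: primitive_root_of_unity_def power_0_left)

lemma dd_omega_Rn:
  fixes \<xi> \<xi>4 :: "'k::field" and n p :: nat
  assumes n: "n \<ge> 1" and \<xi>: "\<xi> \<noteq> 0"
  defines "G \<equiv> double_dihedral n" and "\<omega> \<equiv> dd_omega n \<xi> \<xi>4 p"
  shows "\<omega> (A, a) (B, b) (0, int n) = \<xi> powi (int p * (-1) ^ (B + 1) * a * (dd_red n (b + int n) - b - int n))"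
    and "\<omega> (A, a) (0, int n) (B, b) =
      \<xi> powi (int p * (-1) ^ (B + 1) * a * (dd_red n (b + int n) - (-1) ^ B * int n - b))"
    and "\<omega> (0, int n) (A, a) (B, b) =
      \<xi> powi (int p * (-1) ^ (A + B + 1) * int n * (snd ((A, a) \<otimes>\<^bsub>G\<^esub> (B, b)) - (-1) ^ B * a - b))"
proof -
  have "dd_red n ((-1) ^ B * int n + b) = dd_red n (b + int n)"
    by (rule dd_red_cong, cases "even B") auto
  then show "\<omega> (A, a) (B, b) (0, int n) = \<xi> powi (int p * (-1) ^ (B + 1) * a * (dd_red n (b + int n) - b - int n))"
    "\<omega> (A, a) (0, int n) (B, b) =
      \<xi> powi (int p * (-1) ^ (B + 1) * a * (dd_red n (b + int n) - (-1) ^ B * int n - b))"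
    "\<omega> (0, int n) (A, a) (B, b) =
      \<xi> powi (int p * (-1) ^ (A + B + 1) * int n * (snd ((A, a) \<otimes>\<^bsub>G\<^esub> (B, b)) - (-1) ^ B * a - b))"
    unfolding \<omega>_def G_def by (simp_all add: dd_omega_alt[OF n \<xi>] dd_mult)
qed

text \<open>For \<open>x = (A, a)\<close> and \<open>y = (B, b)\<close> let \<open>r\<close> be the exponent of $R$ in the product. Then
  $r = (-1)^B a + b + n(AB + 2u)$ for some $u$, and in the quasi-character equation the exponents of
  $\xi$ on the two sides differ by $n^2 p\,(1 + (-1)^{A+B})(AB + 2u)$, an even multiple of $n^2$, while
  $\xi^{2n^2} = 1$. What remains is a sign that matters only when $X$ is squared, and there
  $c^2 = \epsilon^n$ accounts for $X^2 = R^n$.\<close>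

lemma quasi_character_Rn_of_sign:
  fixes \<xi> \<xi>4 c \<epsilon> :: "'k::field" and n p :: nat
  assumes n: "n \<ge> 1" and \<xi>: "primitive_root_of_unity (2 * n ^ 2) \<xi>"
    and \<epsilon>: "\<epsilon> ^ 2 = 1" and c: "c ^ 2 = \<epsilon> ^ n"
  defines "\<chi> \<equiv> \<lambda>(A, a). c ^ A * (\<epsilon> powi a * \<xi> powi (- (int n * int p * a)))"
  shows "quasi_character (double_dihedral n) (dd_omega n \<xi> \<xi>4 p) (0, int n) \<chi>"
    and "\<chi> (0, int n) = \<epsilon> ^ n * (-1) ^ p"
proof -
  let ?G = "double_dihedral n" and ?w = "dd_omega n \<xi> \<xi>4 p"
  have \<xi>0: "\<xi> \<noteq> 0" using \<xi> by (rule primitive_root_nonzero)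
  have \<epsilon>0: "\<epsilon> \<noteq> 0" using \<epsilon> by auto
  have half: "\<xi> ^ (n ^ 2) = -1" using \<xi> by (rule primitive_root_half)
  have \<epsilon>_cong: "\<epsilon> powi k = \<epsilon> powi l" if "even (k - l)" for k l
  proof -
    obtain m where "k - l = 2 * m" using \<open>even (k - l)\<close> by (rule evenE)
    then have m: "k = l + 2 * m" by simp
    have "\<epsilon> powi (2 * m) = (\<epsilon> ^ 2) powi m" unfolding power_int_power by simp
    then show ?thesis by (simp add: m power_int_add \<epsilon>0 \<epsilon>)
  qed
  have \<xi>_cong: "\<xi> powi k = \<xi> powi l" if "k = l + 2 * (int n ^ 2 * m)" for k l m
  proof -
    have "\<xi> powi (2 * (int n ^ 2 * m)) = (\<xi> ^ (n ^ 2)) powi (2 * m)" unfolding power_int_power by (simp add: mult_ac)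
    also have "\<dots> = 1" unfolding half powi_minus_one by simp
    finally show ?thesis by (simp add: that power_int_add \<xi>0)
  qed
  have "\<chi> (0, int n) = \<epsilon> ^ n * \<xi> powi (- (int n * int p * int n))" by (simp add: \<chi>_def)
  also have "\<xi> powi (- (int n * int p * int n)) = (\<xi> ^ (n ^ 2)) powi (- int p)"
    unfolding power_int_power by (simp add: power2_eq_square mult_ac)
  also have "\<dots> = (-1) ^ p" unfolding half powi_minus_one by (simp add: minus_one_power_iff)
  finally show "\<chi> (0, int n) = \<epsilon> ^ n * (-1) ^ p" .
  show "quasi_character ?G ?w (0, int n) \<chi>"
    unfolding quasi_character_def
  proof (intro conjI ballI)
    show "\<chi> \<one>\<^bsub>?G\<^esub> = 1" by (simp add: dd_one \<chi>_def)
  next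
    fix x y assume xy: "x \<in> carrier ?G" "y \<in> carrier ?G"
    obtain A a B b where e: "x = (A, a)" "y = (B, b)" by fastforce
    have AB: "A \<in> {0, 1}" "B \<in> {0, 1}" using xy by (auto simp: e dd_carrier)
    define r where "r = snd (x \<otimes>\<^bsub>?G\<^esub> y)"
    have mult: "x \<otimes>\<^bsub>?G\<^esub> y = ((A + B) mod 2, r)" by (simp add: r_def e dd_mult)
    obtain u where u: "r = (-1) ^ B * a + b + int n * int A * int B + 2 * int n * u"
      unfolding r_def e dd_mult snd_conv by (rule dd_red_obtain[OF n])
    define E1 where "E1 = int p * (-1) ^ (B + 1) * a * (dd_red n (b + int n) - b - int n)"
    define E2 where "E2 = int p * (-1) ^ (A + B + 1) * int n * (r - (-1) ^ B * a - b)"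
    define E3 where "E3 = int p * (-1) ^ (B + 1) * a * (dd_red n (b + int n) - (-1) ^ B * int n - b)"
    note w = dd_omega_Rn[OF n \<xi>0]
    have w1: "?w x y (0, int n) = \<xi> powi E1" and w2: "?w (0, int n) x y = \<xi> powi E2" and w3: "?w x (0, int n) y = \<xi> powi E3"
      unfolding E1_def E2_def E3_def r_def e w by simp_all
    have "c ^ ((A + B) mod 2) * \<epsilon> powi r = c ^ (A + B) * \<epsilon> powi (a + b)"
    proof (cases "A = 1 \<and> B = 1")
      case True
      have "\<epsilon> powi r = \<epsilon> powi (int n + (a + b))"
        by (rule \<epsilon>_cong) (simp add: u True)
      then show ?thesis using True c by (simp add: power_int_add \<epsilon>0 power2_eq_square)
    next
      case False
      then have "(A + B) mod 2 = A + B" "even (r - (a + b))" using AB by (auto simp: u)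
      then show ?thesis by (simp add: \<epsilon>_cong)
    qed
    moreover have "\<xi> powi (- (int n * int p * r) + E1 + E2) = \<xi> powi (- (int n * int p * a) - int n * int p * b + E3)"
    proof (rule \<xi>_cong)
      show "- (int n * int p * r) + E1 + E2 = - (int n * int p * a) - int n * int p * b + E3 +
        2 * (int n ^ 2 * (if A = B then - int p * (int A + 2 * u) else 0))"
        using AB unfolding E1_def E2_def E3_def u
        by (auto simp: algebra_simps power2_eq_square)
    qed
    ultimately have "(c ^ ((A + B) mod 2) * \<epsilon> powi r) * \<xi> powi (- (int n * int p * r) + E1 + E2) =
      (c ^ (A + B) * \<epsilon> powi (a + b)) * \<xi> powi (- (int n * int p * a) - int n * int p * b + E3)"
      by simp
    then show "\<chi> (x \<otimes>\<^bsub>?G\<^esub> y) * ?w x y (0, int n) * ?w (0, int n) x y = \<chi> x * \<chi> y * ?w x (0, int n) y"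
      unfolding mult w1 w2 w3 unfolding e \<chi>_def
      by (simp add: power_int_add power_int_diff power_int_minus \<xi>0 \<epsilon>0 power_add field_simps)
  qed
qed

text \<open>Computing $\chi(R X) = \chi(X R^{-1})$ in two ways gives $\chi(R)^2 = \xi^{-2np}$. For even $n$ this
  determines $\chi(R^n) = \chi(R)^n = \xi^{-n^2 p} = (-1)^p$.\<close>

lemma quasi_character_Rn_even:
  fixes \<xi> \<xi>4 :: "'k::field"
  assumes n: "n \<ge> 2" and \<xi>: "primitive_root_of_unity (2 * n ^ 2) \<xi>" and even: "even n" "even p"
    and \<chi>: "quasi_character (double_dihedral n) (dd_omega n \<xi> \<xi>4 p) (0, int n) \<chi>"
    and X: "\<chi> (1, 0) \<noteq> 0"
  shows "\<chi> (0, int n) = 1"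
proof -
  let ?G = "double_dihedral n" and ?w = "dd_omega n \<xi> \<xi>4 p"
  have n1: "n \<ge> 1" using n by simp
  have \<xi>0: "\<xi> \<noteq> 0" using \<xi> by (rule primitive_root_nonzero)
  have half: "\<xi> ^ (n ^ 2) = -1" using \<xi> by (rule primitive_root_half)
  note w = dd_omega_Rn[OF n1 \<xi>0]
  have one: "\<chi> (0, 0) = 1" using \<chi> by (simp add: quasi_character_def dd_one)
  have mult: "\<chi> (x \<otimes>\<^bsub>?G\<^esub> y) * ?w x y (0, int n) * ?w (0, int n) x y = \<chi> x * \<chi> y * ?w x (0, int n) y"
    if "x \<in> carrier ?G" "y \<in> carrier ?G" for x y
    using \<chi> that by (auto simp: quasi_character_def)
  have rot: "\<chi> (0, a + b) = \<chi> (0, a) * \<chi> (0, b)"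
    if "{a, b, a + b} \<subseteq> {- int n + 1..int n}" for a b
    using mult[of "(0, a)" "(0, b)"] that \<xi>0 unfolding w
    by (simp add: dd_carrier dd_mult dd_red_id diff_right_commute[of _ "int n" b])
  have pow: "k \<le> n \<Longrightarrow> \<chi> (0, int k) = \<chi> (0, 1) ^ k" for k
  proof (induction k)
    case (Suc k)
    then show ?case using rot[of 1 "int k"] n by (simp add: add.commute)
  qed (simp add: one)
  have red: "dd_red n (-1) = -1" "dd_red n 0 = 0" "dd_red n (int n) = int n" using n by (simp_all add: dd_red_id)
  have carrier: "(0, 1) \<in> carrier ?G" "(0, -1) \<in> carrier ?G" "(1, 0) \<in> carrier ?G" using n by (auto simp: dd_carrier)
  have inv: "\<chi> (0, 1) * \<chi> (0, -1) = 1"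
    using rot[of 1 "-1"] n one by simp
  \<comment> \<open>The pair \<open>(1, -1)\<close> is $X R^{-1} = R X$; the factor $\xi^{2np}$ comes from
    reducing the exponent $-n$ in $R^n X = X R^{-n}$ to $n$.\<close>
  have "\<chi> (1, -1) = \<chi> (0, 1) * \<chi> (1, 0) * \<xi> powi (int p * (2 * int n))"
    using mult[OF carrier(1,3)] unfolding w by (simp add: dd_mult red)
  moreover have "\<chi> (1, -1) = \<chi> (1, 0) * \<chi> (0, -1)"
    using mult[OF carrier(3,2)] unfolding w by (simp add: dd_mult red)
  moreover have "\<xi> powi (int p * (2 * int n)) = \<xi> ^ (p * (2 * n))"
    using power_int_of_nat[of \<xi> "p * (2 * n)"] by simp
  ultimately have "\<chi> (1, 0) * \<chi> (0, -1) = \<chi> (1, 0) * (\<chi> (0, 1) * \<xi> ^ (p * (2 * n)))"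
    by (simp only: mult_ac)
  then have "\<chi> (0, -1) = \<chi> (0, 1) * \<xi> ^ (p * (2 * n))"
    using X by (simp only: mult_left_cancel simp_thms)
  then have sq: "\<chi> (0, 1) ^ 2 * \<xi> ^ (p * (2 * n)) = 1"
    using inv by (simp only: power2_eq_square mult.assoc)
  obtain m where m: "n = 2 * m" using even(1) by (rule evenE)
  have "\<chi> (0, int n) = \<chi> (0, 1) ^ (2 * m)" using pow[of n] m by simp
  moreover have "\<chi> (0, 1) ^ (2 * m) * (\<xi> ^ (n ^ 2)) ^ p = (\<chi> (0, 1) ^ 2 * \<xi> ^ (p * (2 * n))) ^ m"
  proof -
    have "(\<xi> ^ (n ^ 2)) ^ p = (\<xi> ^ (p * (2 * n))) ^ m"
      unfolding power_mult[symmetric] by (simp add: m power2_eq_square mult_ac)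
    then show ?thesis by (simp only: power_mult_distrib power_mult[of _ 2 m])
  qed
  ultimately show ?thesis using sq even(2) by (simp add: half)
qed

theorem proposition4p18:
  fixes n p :: nat and \<xi> \<xi>4 :: "'k::field"
  assumes "n \<ge> 2"
    and "p \<in> {0..2 * n - 1}"
    and "CHAR('k) \<noteq> 2"
    and "primitive_root_of_unity (2 * n ^ 2) \<xi>"
    and "primitive_root_of_unity 4 \<xi>4"
    and "even n \<Longrightarrow> \<xi>4 = \<xi> ^ (n ^ 2 div 2)"
  shows "(\<exists>B :: (nat \<times> int, bool, 'k) braided_hopf.
      nontrivial_two_dim_braided_hopf
        (function_quasi_hopf (double_dihedral n) (dd_omega n \<xi> \<xi>4 p)) B) \<longleftrightarrow>
    odd p \<or> (odd p \<noteq> odd n)"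
proof -
  let ?G = "double_dihedral n" and ?w = "dd_omega n \<xi> \<xi>4 p"
  have n1: "n \<ge> 1" using assms(1) by simp
  have two: "(2 :: 'k) \<noteq> 0"
  proof
    assume "(2 :: 'k) = 0"
    then have "of_nat 2 = (0 :: 'k)" by simp
    then have dvd: "CHAR('k) dvd 2" by (simp only: of_nat_eq_0_iff_char_dvd)
    then have "CHAR('k) \<noteq> 0" by (metis dvd_0_left zero_neq_numeral)
    then have "CHAR('k) = Suc 0" using dvd_imp_le[OF dvd] assms(3) by linarith
    then show False by simp
  qed
  interpret finite_group_cocycle ?G ?w
    using group_double_dihedral[OF n1] normalized_3_cocycle_dd_omega[OF n1 assms(4,5)]
    by (auto simp: finite_group_cocycle_def finite_group_cocycle_axioms_def dd_carrier)
  have Rn: "(0, int n) \<in> carrier ?G" and X: "(1, 0) \<in> carrier ?G" using n1 by (auto simp: dd_carrier)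
  have "(\<exists>g\<in>carrier ?G. \<exists>\<chi>. (\<forall>h\<in>carrier ?G. g \<otimes>\<^bsub>?G\<^esub> h = h \<otimes>\<^bsub>?G\<^esub> g) \<and> quasi_character ?G ?w g \<chi> \<and> \<chi> g = -1) \<longleftrightarrow>
    \<not> (even n \<and> even p)" (is "?L \<longleftrightarrow> _")
  proof
    assume ?L
    then obtain g \<chi> where g: "g \<in> carrier ?G" "\<forall>h\<in>carrier ?G. g \<otimes>\<^bsub>?G\<^esub> h = h \<otimes>\<^bsub>?G\<^esub> g"
      and \<chi>: "quasi_character ?G ?w g \<chi>" "\<chi> g = -1" by blast
    have m1: "-1 \<noteq> (1 :: 'k)"
      using two by (metis add.inverse_inverse eq_neg_iff_add_eq_0 one_add_one)
    have "g \<noteq> (0, 0)"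
      using \<chi> m1 by (auto simp: quasi_character_def dd_one)
    then have "g = (0, int n)"
      using g central_double_dihedral_iff[OF assms(1) g(1)] by blast
    then show "\<not> (even n \<and> even p)"
      using quasi_character_Rn_even[OF assms(1,4)] \<chi> m1 quasi_character_nonzero[OF \<chi>(1) g(1) X] by metis
  next
    assume parity: "\<not> (even n \<and> even p)"
    have \<xi>4: "\<xi>4 ^ 2 = -1"
      using primitive_root_half[of 2 \<xi>4] assms(5) by simp
    \<comment> \<open>For even \<open>p\<close> the exponent \<open>n\<close> is odd, and $c^2 = \epsilon^n = -1$ is solved by
      the fourth root of unity.\<close>
    define \<epsilon> :: 'k where "\<epsilon> = (if odd p then 1 else -1)"
    define c :: 'k where "c = (if odd p then 1 else \<xi>4)"
    have \<epsilon>c: "\<epsilon> ^ 2 = 1" "c ^ 2 = \<epsilon> ^ n" and sign: "\<epsilon> ^ n * (-1) ^ p = -1"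
      using parity \<xi>4 by (auto simp: \<epsilon>_def c_def)
    define \<chi> where "\<chi> = (\<lambda>(A, a). c ^ A * (\<epsilon> powi a * \<xi> powi (- (int n * int p * a))))"
    have "quasi_character ?G ?w (0, int n) \<chi>"
      unfolding \<chi>_def by (rule quasi_character_Rn_of_sign(1)[OF n1 assms(4) \<epsilon>c])
    moreover have "\<chi> (0, int n) = -1"
      unfolding \<chi>_def by (rule trans[OF quasi_character_Rn_of_sign(2)[OF n1 assms(4) \<epsilon>c] sign])
    ultimately show ?L
      using Rn central_double_dihedral_iff[OF assms(1) Rn] by blast
  qed
  then show ?thesis
    unfolding nontrivial_two_dim_braided_hopf_iff[OF two] by auto
qed

end
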